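(* Let $k\ge2$ and $\lambda\ge1$. The family $\{(M_{\phi_1},M_{\phi_2})|_{\mathbb P^{11}_\mu(\mathbb A^{(\lambda)}(\mathbb D^2))}:\mu\in\widehat D_{2k}\}$ consists of mutually unitarily inequivalent $\mathscr D_{2k}$-contractions.
   Context: $\boldsymbol\phi(z_1,z_2)=(\phi_1,\phi_2)=(z_1^k+z_2^k,z_1z_2)$ and $\mathscr D_{2k}=\boldsymbol\phi(\mathbb D^2)$; a $\mathscr D_{2k}$-contraction is a commuting pair $T$ with $\|f(T)\|\le\sup_{\boldsymbol\phi(\overline{\mathbb D}^2)}|f|$ for all polynomials $f$. $D_{2k}=G(k,k,2)$ is the dihedral group of order $2k$ generated by $\delta(z_1,z_2)=(\xi z_1,\xi^{-1}z_2)$, $\xi=e^{2\pi i/k}$, and the swap $\sigma(z_1,z_2)=(z_2,z_1)$, acting on $\mathbb D^2$ by $\tau\cdot z=\tau^{-1}z$; $\boldsymbol\phi$ is its basic invariant map. $\widehat D_{2k}$ is the set of equivalence classes of irreducible representations; for $\mu\in\widehat D_{2k}$ fix a unitary matrix realization $(\pi_\mu^{ij})$ and set $(\mathbb P_\mu^{ij}f)(z)=\frac{\deg\mu}{2k}\sum_{\tau\in D_{2k}}\pi_\mu^{ji}(\tau^{-1})f(\tau^{-1}\cdot z)$. For $\lambda>1$, $\mathbb A^{(\lambda)}(\mathbb D^2)$ is the weighted Bergman space with kernel $\prod_i(1-z_i\bar w_i)^{-\lambda}$, and $\mathbb A^{(1)}(\mathbb D^2)=H^2(\mathbb D^2)$.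 *)

theory Defs
  imports "HOL-Analysis.Analysis"
begin

text \<open>A group element (j,s), j < k, stands for delta^j sigma^s, acting linearly on C^2.\<close>

type_synonym grp = "nat \<times> bool"
type_synonym pt = "complex \<times> complex"

definition xi :: "nat \<Rightarrow> complex" where
  "xi k = cis (2 * pi / real k)"

definition Dgrp :: "nat \<Rightarrow> grp set" where
  "Dgrp k = {(j, s). j < k}"

text \<open>Linear action of delta^j sigma^s on C^2; delta(z1,z2)=(xi z1, xi^-1 z2), sigma(z1,z2)=(z2,z1).\<close>
definition lin :: "nat \<Rightarrow> grp \<Rightarrow> pt \<Rightarrow> pt" where
  "lin k g z = (case g of (j, s) \<Rightarrow>
     (let (w1, w2) = (if s then (snd z, fst z) else z)
      in (xi k ^ j * w1, inverse (xi k) ^ j * w2)))"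

definition gmult :: "nat \<Rightarrow> grp \<Rightarrow> grp \<Rightarrow> grp" where
  "gmult k g h = (case g of (j, s) \<Rightarrow> case h of (j', s') \<Rightarrow>
     ((if s then j + (k - j') else j + j') mod k, s \<noteq> s'))"

definition ginv :: "nat \<Rightarrow> grp \<Rightarrow> grp" where
  "ginv k g = (case g of (j, s) \<Rightarrow> if s then (j, True) else ((k - j) mod k, False))"

definition gact :: "nat \<Rightarrow> grp \<Rightarrow> pt \<Rightarrow> pt" where
  "gact k g z = lin k (ginv k g) z"

definition matmul :: "nat \<Rightarrow> (nat \<Rightarrow> nat \<Rightarrow> complex) \<Rightarrow> (nat \<Rightarrow> nat \<Rightarrow> complex) \<Rightarrow> nat \<Rightarrow> nat \<Rightarrow> complex" where
  "matmul d A B i j = (\<Sum>l<d. A i l * B l j)"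

definition vecs :: "nat \<Rightarrow> (nat \<Rightarrow> complex) set" where
  "vecs d = {v. \<forall>i\<ge>d. v i = 0}"

definition matvec :: "nat \<Rightarrow> (nat \<Rightarrow> nat \<Rightarrow> complex) \<Rightarrow> (nat \<Rightarrow> complex) \<Rightarrow> nat \<Rightarrow> complex" where
  "matvec d A v i = (if i < d then (\<Sum>l<d. A i l * v l) else 0)"

definition unitary_rep :: "nat \<Rightarrow> nat \<Rightarrow> (grp \<Rightarrow> nat \<Rightarrow> nat \<Rightarrow> complex) \<Rightarrow> bool" where
  "unitary_rep k d \<pi> \<longleftrightarrow>
     (\<forall>g\<in>Dgrp k. \<forall>h\<in>Dgrp k. \<forall>i<d. \<forall>j<d. \<pi> (gmult k g h) i j = matmul d (\<pi> g) (\<pi> h) i j) \<and>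
     (\<forall>g\<in>Dgrp k. \<forall>i<d. \<forall>j<d. (\<Sum>l<d. cnj (\<pi> g l i) * \<pi> g l j) = (if i = j then 1 else 0))"

definition irreducible_rep :: "nat \<Rightarrow> nat \<Rightarrow> (grp \<Rightarrow> nat \<Rightarrow> nat \<Rightarrow> complex) \<Rightarrow> bool" where
  "irreducible_rep k d \<pi> \<longleftrightarrow> unitary_rep k d \<pi> \<and> d \<ge> 1 \<and>
     (\<forall>V. V \<subseteq> vecs d \<and> (\<lambda>_. 0) \<in> V \<and> (\<forall>v\<in>V. \<forall>w\<in>V. (\<lambda>i. v i + w i) \<in> V)
          \<and> (\<forall>c. \<forall>v\<in>V. (\<lambda>i. c * v i) \<in> V)
          \<and> (\<forall>g\<in>Dgrp k. \<forall>v\<in>V. matvec d (\<pi> g) v \<in> V)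
        \<longrightarrow> V = {\<lambda>_. 0} \<or> V = vecs d)"

definition equiv_rep :: "nat \<Rightarrow> nat \<Rightarrow> (grp \<Rightarrow> nat \<Rightarrow> nat \<Rightarrow> complex) \<Rightarrow> nat \<Rightarrow> (grp \<Rightarrow> nat \<Rightarrow> nat \<Rightarrow> complex) \<Rightarrow> bool" where
  "equiv_rep k d \<pi> d' \<pi>' \<longleftrightarrow> d = d' \<and>
     (\<exists>A B. (\<forall>i<d. \<forall>j<d. matmul d A B i j = (if i = j then 1 else 0)
                        \<and> matmul d B A i j = (if i = j then 1 else 0)) \<and>
            (\<forall>g\<in>Dgrp k. \<forall>i<d. \<forall>j<d. matmul d A (\<pi> g) i j = matmul d (\<pi>' g) A i j))"

definition bidisc :: "pt set" where
  "bidisc = {z. norm (fst z) < 1 \<and> norm (snd z) < 1}"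

definition cbidisc :: "pt set" where
  "cbidisc = {z. norm (fst z) \<le> 1 \<and> norm (snd z) \<le> 1}"

text \<open>Taylor coefficients of (1-t)^(-lambda): (lambda)_m / m!. The kernel
  prod_i (1 - z_i conj w_i)^(-lambda) = sum c_m c_n z^(m,n) conj(w)^(m,n), so the monomials
  form an orthogonal basis with norm^2 of z1^m z2^n equal to 1/(c_m c_n).\<close>
definition wcoef :: "real \<Rightarrow> nat \<Rightarrow> real" where
  "wcoef lam m = pochhammer lam m / fact m"

definition coef_ok :: "real \<Rightarrow> (pt \<Rightarrow> complex) \<Rightarrow> (nat \<times> nat \<Rightarrow> complex) \<Rightarrow> bool" where
  "coef_ok lam f a \<longleftrightarrow>
     (\<lambda>(m, n). (cmod (a (m, n)))\<^sup>2 / (wcoef lam m * wcoef lam n)) summable_on UNIV \<and>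
     (\<forall>z. f z = (if z \<in> bidisc then (\<Sum>\<^sub>\<infinity>(m, n). a (m, n) * fst z ^ m * snd z ^ n) else 0))"

text \<open>Elements are functions on the bidisc, extended by 0 outside.\<close>
definition Aspace :: "real \<Rightarrow> (pt \<Rightarrow> complex) set" where
  "Aspace lam = {f. \<exists>a. coef_ok lam f a}"

definition coef :: "real \<Rightarrow> (pt \<Rightarrow> complex) \<Rightarrow> nat \<times> nat \<Rightarrow> complex" where
  "coef lam f = (SOME a. coef_ok lam f a)"

definition Anorm :: "real \<Rightarrow> (pt \<Rightarrow> complex) \<Rightarrow> real" where
  "Anorm lam f = sqrt (\<Sum>\<^sub>\<infinity>(m, n). (cmod (coef lam f (m, n)))\<^sup>2 / (wcoef lam m * wcoef lam n))"

definition phi1 :: "nat \<Rightarrow> pt \<Rightarrow> complex" where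
  "phi1 k z = fst z ^ k + snd z ^ k"

definition phi2 :: "pt \<Rightarrow> complex" where
  "phi2 z = fst z * snd z"

definition phi :: "nat \<Rightarrow> pt \<Rightarrow> pt" where
  "phi k z = (phi1 k z, phi2 z)"

definition Mmult :: "(pt \<Rightarrow> complex) \<Rightarrow> (pt \<Rightarrow> complex) \<Rightarrow> pt \<Rightarrow> complex" where
  "Mmult g f = (\<lambda>z. g z * f z)"

text \<open>(P^{ij}_mu f)(z) = deg/(2k) sum_tau pi^{ji}(tau^-1) f(tau^-1 . z); indices start at 0,
  so P^{11} uses entry (0,0).\<close>
definition Pproj :: "nat \<Rightarrow> nat \<Rightarrow> (grp \<Rightarrow> nat \<Rightarrow> nat \<Rightarrow> complex) \<Rightarrow> nat \<Rightarrow> nat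
                     \<Rightarrow> (pt \<Rightarrow> complex) \<Rightarrow> pt \<Rightarrow> complex" where
  "Pproj k d \<pi> i j f z = of_nat d / (2 * of_nat k) *
     (\<Sum>\<tau>\<in>Dgrp k. \<pi> (ginv k \<tau>) j i * f (gact k (ginv k \<tau>) z))"

definition Psub :: "nat \<Rightarrow> real \<Rightarrow> nat \<Rightarrow> (grp \<Rightarrow> nat \<Rightarrow> nat \<Rightarrow> complex) \<Rightarrow> (pt \<Rightarrow> complex) set" where
  "Psub k lam d \<pi> = Pproj k d \<pi> 0 0 ` Aspace lam"

definition poly_op :: "(nat \<times> nat) set \<Rightarrow> (nat \<times> nat \<Rightarrow> complex) \<Rightarrow> ((pt \<Rightarrow> complex) \<Rightarrow> pt \<Rightarrow> complex)
                      \<Rightarrow> ((pt \<Rightarrow> complex) \<Rightarrow> pt \<Rightarrow> complex) \<Rightarrow> (pt \<Rightarrow> complex) \<Rightarrow> pt \<Rightarrow> complex" where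
  "poly_op Q c T1 T2 f z = (\<Sum>(i, j)\<in>Q. c (i, j) * (T1 ^^ i) ((T2 ^^ j) f) z)"

definition poly_eval :: "(nat \<times> nat) set \<Rightarrow> (nat \<times> nat \<Rightarrow> complex) \<Rightarrow> pt \<Rightarrow> complex" where
  "poly_eval Q c w = (\<Sum>(i, j)\<in>Q. c (i, j) * fst w ^ i * snd w ^ j)"

definition Dcontraction :: "nat \<Rightarrow> real \<Rightarrow> (pt \<Rightarrow> complex) set
     \<Rightarrow> ((pt \<Rightarrow> complex) \<Rightarrow> pt \<Rightarrow> complex) \<Rightarrow> ((pt \<Rightarrow> complex) \<Rightarrow> pt \<Rightarrow> complex) \<Rightarrow> bool" where
  "Dcontraction k lam S T1 T2 \<longleftrightarrow>
     (\<forall>f\<in>S. T1 f \<in> S \<and> T2 f \<in> S) \<and>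
     (\<forall>f\<in>S. T1 (T2 f) = T2 (T1 f)) \<and>
     (\<forall>Q c. finite Q \<longrightarrow> (\<forall>f\<in>S.
        Anorm lam (poly_op Q c T1 T2 f)
          \<le> (SUP w\<in>phi k ` cbidisc. cmod (poly_eval Q c w)) * Anorm lam f))"

definition unit_equiv :: "real \<Rightarrow> (pt \<Rightarrow> complex) set \<Rightarrow> (pt \<Rightarrow> complex) set
     \<Rightarrow> ((pt \<Rightarrow> complex) \<Rightarrow> pt \<Rightarrow> complex) \<Rightarrow> ((pt \<Rightarrow> complex) \<Rightarrow> pt \<Rightarrow> complex) \<Rightarrow> bool" where
  "unit_equiv lam S S' T1 T2 \<longleftrightarrow>
     (\<exists>U. bij_betw U S S' \<and>
          (\<forall>f\<in>S. \<forall>g\<in>S. \<forall>a b. U (\<lambda>z. a * f z + b * g z) = (\<lambda>z. a * U f z + b * U g z)) \<and>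
          (\<forall>f\<in>S. Anorm lam (U f) = Anorm lam f) \<and>
          (\<forall>f\<in>S. U (T1 f) = T1 (U f) \<and> U (T2 f) = T2 (U f)))"

end

(*
  Identify an element of the weighted Bergman space with its Taylor coefficients; multiplication by
  phi_1 and phi_2 becomes a sum of shifts.

  Contractivity is von Neumann's inequality for the bidisc: the squared norm of z^m in one variable
  is the m-th moment of a probability measure on [0,1], so the norm is an average of L^2 norms over
  tori of radius at most 1, and there multiplication by p(phi) is bounded by sup |p o phi|.

  An irreducible representation is determined by a residue r with 0 <= 2r <= k and, if 2r is 0 or k
  (the characters), by a sign.  The range of P_mu consists of the series supported on z1^m z2^n with
  m - n = +-r mod k whose coefficients at (m,n) and (n,m) are in a fixed ratio.  The data (r, sign)
  are recovered from the wandering vectors J, i.e. those orthogonal to the ranges of M_1 and M_2.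
  All monomials occurring in J lie on the axes and have degree r or k - r (for r = 0: degree 0, or k
  for the sign -1).  So
  <M_1 f, M_2^b g> with f, g in J is nonzero for some f, g only if 0 < r and b is r or k - r, and for
  r > 0 it does occur for b = r.  For 2r = k one has <M_1 f, M_2^r f> = +-|M_2^r f|^2, and for r = 0
  one has <M_1^2 f, M_2^k f> = c |M_2^k f|^2 with c = 2 for the trivial character, c = 1 for the
  other one.
*)
theory Submission
  imports Defs "HOL-Library.Real_Mod"
begin

section \<open>Coefficient sequences\<close>

text \<open>\<open>P^11\<close> depends on the chosen matrix realization: when
  \<open>0 < 2 * r < k\<close> the space involves an arbitrary unit vector \<open>(x, y)\<close>,
  one entry of which may vanish, so whatever identifies \<open>r\<close> must be blind to it.
  Wandering vectors serve this purpose: \<open>J\<close> is defined by the two operators and the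
  inner product alone, hence every unitary equivalence respects it, and its elements live in very
  few degrees. Whether pairings vanish already determines \<open>r\<close>, but the sign of a
  character needs an actual value. For \<open>r = 0\<close> all pairings of M_1 f with M_2^b g
  vanish, which is why M_1^2 appears there. The values come out as multiples of the squared norm of
  M_2^b f, so any nonzero f in \<open>J\<close> can be used.

  On the analytic side, elements of the space are functions on the open bidisc while the supremum
  and the tori of radius 1 belong to the closed one. The norm estimate is therefore proved for
  polynomials and extended by truncating the coefficient sequence.\<close>

abbreviation mon :: "nat \<times> nat \<Rightarrow> pt \<Rightarrow> complex" where
  "mon p z \<equiv> fst z ^ fst p * snd z ^ snd p"

definition wt :: "real \<Rightarrow> nat \<times> nat \<Rightarrow> real" where
  "wt lam p = 1 / (wcoef lam (fst p) * wcoef lam (snd p))"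

definition H2 :: "real \<Rightarrow> (nat \<times> nat \<Rightarrow> complex) set" where
  "H2 lam = {a. (\<lambda>p. (cmod (a p))\<^sup>2 * wt lam p) summable_on UNIV}"

definition nrm2 :: "real \<Rightarrow> (nat \<times> nat \<Rightarrow> complex) \<Rightarrow> real" where
  "nrm2 lam a = (\<Sum>\<^sub>\<infinity>p. (cmod (a p))\<^sup>2 * wt lam p)"

definition psum :: "(nat \<times> nat \<Rightarrow> complex) \<Rightarrow> pt \<Rightarrow> complex" where
  "psum a z = (\<Sum>\<^sub>\<infinity>p. a p * mon p z)"

definition fn :: "(nat \<times> nat \<Rightarrow> complex) \<Rightarrow> pt \<Rightarrow> complex" where
  "fn a z = (if z \<in> bidisc then psum a z else 0)"

lemma wcoef_Suc: "wcoef lam (Suc m) = wcoef lam m * ((lam + real m) / real (Suc m))"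
  by (simp add: wcoef_def pochhammer_Suc del: of_nat_Suc)

lemma wcoef_0 [simp]: "wcoef lam 0 = 1"
  by (simp add: wcoef_def)

lemma coef_ok_iff: "coef_ok lam f a \<longleftrightarrow> a \<in> H2 lam \<and> f = fn a"
proof -
  have 1: "(\<lambda>(m, n). (cmod (a (m, n)))\<^sup>2 / (wcoef lam m * wcoef lam n)) = (\<lambda>p. (cmod (a p))\<^sup>2 * wt lam p)"
    by (auto simp: wt_def)
  have 2: "(\<lambda>(m, n). a (m, n) * fst z ^ m * snd z ^ n) = (\<lambda>p. a p * mon p z)" for z
    by (auto simp: mult.assoc)
  show ?thesis
    unfolding coef_ok_def H2_def 1 2 by (auto simp: fn_def psum_def fun_eq_iff)
qed

lemma Aspace_eq: "Aspace lam = fn ` H2 lam"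
  by (auto simp: Aspace_def coef_ok_iff)

lemma Anorm_eq: "Anorm lam f = sqrt (nrm2 lam (coef lam f))"
proof -
  have "(\<lambda>(m, n). (cmod (coef lam f (m, n)))\<^sup>2 / (wcoef lam m * wcoef lam n))
      = (\<lambda>p. (cmod (coef lam f p))\<^sup>2 * wt lam p)"
    by (auto simp: wt_def)
  thus ?thesis by (simp add: Anorm_def nrm2_def)
qed

text \<open>With \<open>m\<close> the least index of a nonzero coefficient, division by
  \<open>z ^ m\<close> leaves a series that sums to 0 away from 0 but tends to \<open>a m\<close> at
  0.\<close>

lemma powser_zero_unique:
  fixes a :: "nat \<Rightarrow> complex"
  assumes "\<And>z. cmod z < 1 \<Longrightarrow> (\<lambda>n. a n * z ^ n) sums 0"
  shows "a n = 0"
proof (rule ccontr)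
  assume "a n \<noteq> 0"
  define m where "m = (LEAST n. a n \<noteq> 0)"
  have am: "a m \<noteq> 0" unfolding m_def by (rule LeastI) fact
  have lt: "a i = 0" if "i < m" for i using not_less_Least[of i "\<lambda>n. a n \<noteq> 0"] that by (auto simp: m_def)
  have s: "(\<lambda>i. a (i + m) * z ^ i) sums 0" if "cmod z < 1" "z \<noteq> 0" for z
  proof -
    have "(\<lambda>i. a (i + m) * z ^ (i + m)) sums (0 - (\<Sum>i<m. a i * z ^ i))"
      using assms[OF that(1)] by (rule sums_split_initial_segment)
    hence "(\<lambda>i. a (i + m) * z ^ (i + m)) sums 0" using lt by simp
    hence "(\<lambda>i. a (i + m) * z ^ (i + m) / z ^ m) sums (0 / z ^ m)" by (rule sums_divide)
    thus ?thesis using that by (simp add: power_add)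
  qed
  have "((\<lambda>z::complex. 0) \<longlongrightarrow> a (0 + m)) (at 0)"
    by (rule powser_limit_0_strong[where s = 1]) (use s in auto)
  hence "a m = 0" by (simp add: tendsto_const_iff)
  with am show False by simp
qed

section \<open>Weights, convergence and uniqueness of Taylor coefficients\<close>

locale bergman =
  fixes lam :: real
  assumes lam1: "1 \<le> lam"
begin

lemma wcoef_ge1: "1 \<le> wcoef lam m"
proof (induction m)
  case (Suc m)
  have "1 * 1 \<le> wcoef lam m * ((lam + real m) / real (Suc m))"
    by (rule mult_mono) (use Suc lam1 in \<open>auto simp: field_simps\<close>)
  thus ?case by (simp add: wcoef_Suc)
qed simp

lemma wcoef_pos: "0 < wcoef lam m"
  using wcoef_ge1[of m] by simp

text \<open>The ratio \<open>(lam + n) / (n + 1)\<close> of successive coefficients is at least 1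
  because \<open>lam \<ge> 1\<close>. Consequently shifts do not increase norms.\<close>

lemma wcoef_mono: "m \<le> n \<Longrightarrow> wcoef lam m \<le> wcoef lam n"
proof (rule lift_Suc_mono_le)
  show "wcoef lam n \<le> wcoef lam (Suc n)" for n
    using mult_left_mono[of 1 "(lam + real n) / real (Suc n)" "wcoef lam n"] lam1 wcoef_pos[of n]
    by (auto simp: wcoef_Suc field_simps)
qed

lemma wt_pos: "0 < wt lam p"
  by (simp add: wt_def wcoef_pos)

lemma wt_nonneg: "0 \<le> wt lam p"
  using wt_pos[of p] by simp

lemma wt_antimono: "fst p \<le> fst q \<Longrightarrow> snd p \<le> snd q \<Longrightarrow> wt lam q \<le> wt lam p"
  unfolding wt_def
  by (intro divide_left_mono mult_mono wcoef_mono mult_pos_pos wcoef_pos) (auto simp: wcoef_pos less_imp_le)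

text \<open>This is the binomial series of (1 - t)^(-lam); the signs of the generalized binomial
  coefficients cancel those of \<open>(-t) ^ m\<close>.\<close>

lemma summable_wcoef:
  assumes "0 \<le> t" "t < 1"
  shows "(\<lambda>m. wcoef lam m * t ^ m) summable_on UNIV"
proof -
  have "(\<lambda>m. ((-lam) gchoose m) * (-t) ^ m) sums (1 + (-t)) powr (-lam)"
    by (rule gen_binomial_real) (use assms in auto)
  moreover have "((-lam) gchoose m) * (-t) ^ m = wcoef lam m * t ^ m" for m
  proof -
    have "(-t) ^ m = (-1) ^ m * t ^ m" by (rule power_minus)
    moreover have "(-1 :: real) ^ m * (-1) ^ m = 1" by (simp flip: power_add)
    ultimately show ?thesis by (simp add: gbinomial_pochhammer wcoef_def)
  qed
  ultimately have "summable (\<lambda>m. wcoef lam m * t ^ m)" by (simp add: sums_iff)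
  thus ?thesis
    using assms wcoef_pos by (intro summable_nonneg_imp_summable_on) (auto simp: less_imp_le)
qed

text \<open>The inequality 2 |a| |z^p| \<le> |a|^2 wt + |z^p|^2 / wt takes the place of
  Cauchy-Schwarz. The second terms are those of the kernel on the diagonal, a product of two
  one-variable series \<open>f\<close>.\<close>

lemma abs_summable_psum:
  assumes "a \<in> H2 lam" "z \<in> bidisc"
  shows "(\<lambda>p. norm (a p * mon p z)) summable_on UNIV"
proof -
  define f where "f w m = wcoef lam m * ((cmod w)\<^sup>2) ^ m" for w m
  have f0: "0 \<le> f w m" for w m
    using wcoef_pos[of m] by (simp add: f_def)
  have 1: "f w summable_on UNIV" if "cmod w < 1" for w
    unfolding f_def using that by (intro summable_wcoef) (simp_all add: power_less_one_iff)
  have 2: "(\<lambda>p. f (fst z) (fst p) * f (snd z) (snd p)) summable_on UNIV \<times> UNIV"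
  proof (rule summable_on_SigmaI[where g = "\<lambda>m. f (fst z) m * infsum (f (snd z)) UNIV"])
    show "((\<lambda>n. f (fst z) (fst (m, n)) * f (snd z) (snd (m, n))) has_sum f (fst z) m * infsum (f (snd z)) UNIV) UNIV" for m
      unfolding fst_conv snd_conv
      by (intro has_sum_cmult_right has_sum_infsum 1) (use assms in \<open>simp add: bidisc_def\<close>)
    show "(\<lambda>m. f (fst z) m * infsum (f (snd z)) UNIV) summable_on UNIV"
      by (intro summable_on_cmult_left 1) (use assms in \<open>simp add: bidisc_def\<close>)
  qed (intro mult_nonneg_nonneg f0)
  show ?thesis
  proof (rule summable_on_comparison_test)
    show "(\<lambda>p. (cmod (a p))\<^sup>2 * wt lam p + f (fst z) (fst p) * f (snd z) (snd p)) summable_on UNIV"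
      using assms(1) 2 unfolding H2_def mem_Collect_eq UNIV_Times_UNIV by (rule summable_on_add)
  next
    fix p :: "nat \<times> nat"
    define w where "w = wcoef lam (fst p) * wcoef lam (snd p)"
    have w: "w > 0" unfolding w_def by (intro mult_pos_pos wcoef_pos)
    have wt: "wt lam p = 1 / w" by (simp add: wt_def w_def)
    define x where "x = cmod (a p)"
    define y where "y = cmod (mon p z)"
    have "f (fst z) (fst p) * f (snd z) (snd p) = w * ((cmod (fst z) ^ fst p)\<^sup>2 * (cmod (snd z) ^ snd p)\<^sup>2)"
      by (simp only: f_def w_def power2_eq_square power_mult_distrib mult_ac)
    also have "\<dots> = w * y\<^sup>2"
      by (simp add: y_def norm_mult norm_power power_mult_distrib)
    finally have fy: "f (fst z) (fst p) * f (snd z) (snd p) = w * y\<^sup>2" .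
    have "0 \<le> (x - w * y)\<^sup>2 / w" using w by simp
    also have "(x - w * y)\<^sup>2 / w = x\<^sup>2 / w + w * y\<^sup>2 - 2 * (x * y)"
      using w by (simp add: power2_eq_square field_simps)
    finally have "2 * (x * y) \<le> x\<^sup>2 / w + w * y\<^sup>2" by simp
    moreover have "0 \<le> x * y" by (simp add: x_def y_def)
    ultimately have "x * y \<le> x\<^sup>2 / w + w * y\<^sup>2" by linarith
    thus "norm (a p * mon p z) \<le> (cmod (a p))\<^sup>2 * wt lam p + f (fst z) (fst p) * f (snd z) (snd p)"
      unfolding fy wt by (simp add: x_def y_def norm_mult)
  qed simp
qed

lemma has_sum_psum:
  assumes "a \<in> H2 lam" "z \<in> bidisc"
  shows "((\<lambda>p. a p * mon p z) has_sum psum a z) UNIV"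
  unfolding psum_def using abs_summable_psum[OF assms] by (intro has_sum_infsum) (rule abs_summable_summable)

text \<open>One-variable uniqueness is used twice: for fixed \<open>w\<close> the inner sums are the
  coefficients of a vanishing power series in \<open>u\<close>, and each inner sum is then a
  vanishing power series in \<open>w\<close>.\<close>

lemma psum_zero_imp_zero:
  assumes a: "a \<in> H2 lam" and z: "\<And>z. z \<in> bidisc \<Longrightarrow> psum a z = 0"
  shows "a = (\<lambda>_. 0)"
proof -
  have 1: "(\<lambda>n. a (m, n) * w ^ n) summable_on UNIV \<and> (\<Sum>\<^sub>\<infinity>n. a (m, n) * w ^ n) = 0" if w: "cmod w < 1" for m w
  proof -
    have su: "(\<lambda>n. a (m, n) * w ^ n) summable_on UNIV" for m
    proof -
      \<comment> \<open>Any nonzero first coordinate in the disc would do: the factor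
        \<open>(1/2) ^ m\<close> is cancelled afterwards.\<close>
      have "(\<lambda>p. a p * mon p (1/2, w)) summable_on (UNIV \<times> UNIV)"
        using abs_summable_psum[OF a, of "(1/2,w)"] w by (auto simp: bidisc_def intro: abs_summable_summable)
      hence "(\<lambda>n. a (m, n) * mon (m, n) (1/2, w)) summable_on UNIV"
        by (rule summable_on_SigmaD1[where f = "\<lambda>x y. a (x,y) * mon (x,y) (1/2,w)", simplified case_prod_unfold prod.collapse]) auto
      hence "(\<lambda>n. a (m, n) * mon (m, n) (1/2, w) * 2 ^ m) summable_on UNIV" by (rule summable_on_cmult_left)
      thus ?thesis by (simp add: power_divide field_simps)
    qed
    have "(\<Sum>\<^sub>\<infinity>n. a (m, n) * w ^ n) = 0"
    proof (rule powser_zero_unique[of "\<lambda>m. \<Sum>\<^sub>\<infinity>n. a (m, n) * w ^ n"])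
      fix u :: complex assume u: "cmod u < 1"
      have "(\<lambda>p. a p * mon p (u, w)) summable_on (UNIV \<times> UNIV)"
        using abs_summable_psum[OF a, of "(u,w)"] w u by (auto simp: bidisc_def intro: abs_summable_summable)
      hence "((\<lambda>p. a p * mon p (u, w)) has_sum 0) (UNIV \<times> UNIV)"
        using z[of "(u,w)"] u w by (auto simp: bidisc_def psum_def has_sum_iff)
      moreover have "((\<lambda>n. a (m, n) * mon (m,n) (u, w)) has_sum (\<Sum>\<^sub>\<infinity>n. a (m, n) * w ^ n) * u ^ m) UNIV" for m
        using has_sum_cmult_left[OF has_sum_infsum[OF su[of m]], of "u^m"] by (simp add: mult_ac)
      ultimately have "((\<lambda>m. (\<Sum>\<^sub>\<infinity>n. a (m, n) * w ^ n) * u ^ m) has_sum 0) UNIV"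
        by (rule has_sum_SigmaD)
      thus "(\<lambda>m. (\<Sum>\<^sub>\<infinity>n. a (m, n) * w ^ n) * u ^ m) sums 0" by (rule has_sum_imp_sums)
    qed
    with su show ?thesis by blast
  qed
  have "a (m, n) = 0" for m n
    by (rule powser_zero_unique[of "\<lambda>n. a (m, n)"], rule has_sum_imp_sums) (use 1[of _ m] in \<open>auto simp: has_sum_iff\<close>)
  thus ?thesis by auto
qed

lemma weighted_norm_add_le: "(cmod (a + b))\<^sup>2 * wt lam p \<le> 2 * ((cmod a)\<^sup>2 * wt lam p) + 2 * ((cmod b)\<^sup>2 * wt lam p)"
proof -
  have "(cmod (a + b))\<^sup>2 \<le> (cmod a + cmod b)\<^sup>2" by (intro power_mono norm_triangle_ineq) auto
  also have "\<dots> \<le> 2 * (cmod a)\<^sup>2 + 2 * (cmod b)\<^sup>2"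
    using sum_squares_bound[of "cmod a" "cmod b"] by (simp add: power2_sum)
  finally have "(cmod (a + b))\<^sup>2 * wt lam p \<le> (2 * (cmod a)\<^sup>2 + 2 * (cmod b)\<^sup>2) * wt lam p"
    by (intro mult_right_mono wt_nonneg)
  thus ?thesis by (simp add: algebra_simps)
qed

lemma H2_add: "a \<in> H2 lam \<Longrightarrow> b \<in> H2 lam \<Longrightarrow> (\<lambda>p. a p + b p) \<in> H2 lam"
  unfolding H2_def mem_Collect_eq
  by (rule summable_on_comparison_test[where f = "\<lambda>p. 2 * ((cmod (a p))\<^sup>2 * wt lam p) + 2 * ((cmod (b p))\<^sup>2 * wt lam p)"])
     (auto intro!: summable_on_add summable_on_cmult_right weighted_norm_add_le mult_nonneg_nonneg wt_nonneg)

lemma H2_scale: "a \<in> H2 lam \<Longrightarrow> (\<lambda>p. c * a p) \<in> H2 lam"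
  unfolding H2_def mem_Collect_eq
  by (auto simp: norm_mult power_mult_distrib mult.assoc intro: summable_on_cmult_right)

lemma psum_add: "a \<in> H2 lam \<Longrightarrow> b \<in> H2 lam \<Longrightarrow> z \<in> bidisc \<Longrightarrow> psum (\<lambda>p. a p + b p) z = psum a z + psum b z"
  by (subst psum_def, rule infsumI)
     (simp add: distrib_right has_sum_add has_sum_psum)

lemma psum_scale: "a \<in> H2 lam \<Longrightarrow> z \<in> bidisc \<Longrightarrow> psum (\<lambda>p. c * a p) z = c * psum a z"
  by (subst psum_def, rule infsumI)
     (simp add: mult.assoc has_sum_cmult_right has_sum_psum)

lemma fn_lincomb:
  "a \<in> H2 lam \<Longrightarrow> b \<in> H2 lam \<Longrightarrow> fn (\<lambda>p. c * a p + d * b p) = (\<lambda>z. c * fn a z + d * fn b z)"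
proof (rule ext)
  fix z assume ab: "a \<in> H2 lam" "b \<in> H2 lam"
  show "fn (\<lambda>p. c * a p + d * b p) z = c * fn a z + d * fn b z"
    using psum_add[OF H2_scale[OF ab(1), of c] H2_scale[OF ab(2), of d], of z]
      psum_scale[OF ab(1), of z c] psum_scale[OF ab(2), of z d] by (simp add: fn_def)
qed

text \<open>Injectivity makes the choice in \<open>coef\<close> unique, so \<open>Anorm\<close> can
  be computed from any known coefficient sequence.\<close>

lemma fn_inj: "inj_on fn (H2 lam)"
proof (rule inj_onI)
  fix a b assume ab: "a \<in> H2 lam" "b \<in> H2 lam" "fn a = fn b"
  have "(\<lambda>p. 1 * a p + (-1) * b p) = (\<lambda>_. 0)"
  proof (rule psum_zero_imp_zero)
    show "(\<lambda>p. 1 * a p + (-1) * b p) \<in> H2 lam" by (rule H2_add[OF H2_scale[OF ab(1)] H2_scale[OF ab(2)]])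
    fix z assume "z \<in> bidisc"
    thus "psum (\<lambda>p. 1 * a p + (-1) * b p) z = 0"
      using fun_cong[OF fn_lincomb[OF ab(1,2), of 1 "-1"], of z] fun_cong[OF ab(3), of z] by (simp add: fn_def)
  qed
  thus "a = b" by (auto simp: fun_eq_iff)
qed

lemma coef_fn [simp]: "a \<in> H2 lam \<Longrightarrow> coef lam (fn a) = a"
  unfolding coef_def coef_ok_iff
  by (rule some_equality) (auto dest: inj_onD[OF fn_inj])

lemma Anorm_fn: "a \<in> H2 lam \<Longrightarrow> Anorm lam (fn a) = sqrt (nrm2 lam a)"
  by (simp add: Anorm_eq)

end

section \<open>Multiplication operators as shifts of coefficients\<close>

definition shift :: "nat \<Rightarrow> nat \<Rightarrow> (nat \<times> nat \<Rightarrow> complex) \<Rightarrow> nat \<times> nat \<Rightarrow> complex" where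
  "shift i j a p = (if i \<le> fst p \<and> j \<le> snd p then a (fst p - i, snd p - j) else 0)"

definition T1 :: "nat \<Rightarrow> (nat \<times> nat \<Rightarrow> complex) \<Rightarrow> nat \<times> nat \<Rightarrow> complex" where
  "T1 k a p = shift k 0 a p + shift 0 k a p"

abbreviation T2 :: "(nat \<times> nat \<Rightarrow> complex) \<Rightarrow> nat \<times> nat \<Rightarrow> complex" where
  "T2 \<equiv> shift 1 1"

text \<open>The function \<open>f\<close> is kept general so that one reindexing serves both the
  power series and the weighted norms; indices outside the image carry the coefficient 0.\<close>

lemma has_sum_shift:
  "((\<lambda>p. f (shift i j a p) p) has_sum s) UNIV \<longleftrightarrow> ((\<lambda>p. f (a p) (fst p + i, snd p + j)) has_sum s) UNIV"
  if "\<And>p. f 0 p = 0" for f :: "complex \<Rightarrow> nat \<times> nat \<Rightarrow> 'a :: {comm_monoid_add,t2_space}"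
proof -
  let ?h = "\<lambda>p::nat\<times>nat. (fst p + i, snd p + j)"
  have "inj ?h" by (auto simp: inj_on_def)
  hence "((\<lambda>p. f (a p) (?h p)) has_sum s) UNIV \<longleftrightarrow> ((\<lambda>p. f (shift i j a p) p) has_sum s) (range ?h)"
    by (subst has_sum_reindex) (auto simp: o_def shift_def)
  also have "\<dots> \<longleftrightarrow> ((\<lambda>p. f (shift i j a p) p) has_sum s) UNIV"
  proof (rule has_sum_cong_neutral)
    fix p :: "nat \<times> nat" assume "p \<in> UNIV - range ?h"
    hence "\<not> (i \<le> fst p \<and> j \<le> snd p)"
      by (metis (no_types, lifting) DiffE le_add_diff_inverse2 prod.collapse rangeI fst_conv snd_conv)
    thus "f (shift i j a p) p = 0" using that[of p] unfolding shift_def by (simp only: if_False)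
  qed auto
  finally show ?thesis ..
qed

lemma has_sum_mon_shift:
  assumes "((\<lambda>p. a p * mon p z) has_sum s) UNIV"
  shows "((\<lambda>p. shift i j a p * mon p z) has_sum (mon (i, j) z * s)) UNIV"
proof -
  have "((\<lambda>p. mon (i, j) z * (a p * mon p z)) has_sum (mon (i, j) z * s)) UNIV"
    by (rule has_sum_cmult_right[OF assms])
  thus ?thesis
    by (subst has_sum_shift[where f = "\<lambda>x p. x * mon p z"]) (simp_all add: power_add mult_ac)
qed

context bergman
begin

lemma H2_shift: "a \<in> H2 lam \<Longrightarrow> shift i j a \<in> H2 lam"
proof -
  assume a: "a \<in> H2 lam"
  have "(\<lambda>p. (cmod (a p))\<^sup>2 * wt lam (fst p + i, snd p + j)) summable_on UNIV"
    by (rule summable_on_comparison_test[where f = "\<lambda>p. (cmod (a p))\<^sup>2 * wt lam p"])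
       (use a in \<open>auto simp: H2_def wt_nonneg intro!: mult_left_mono wt_antimono\<close>)
  thus ?thesis
    unfolding H2_def mem_Collect_eq summable_on_def
    using has_sum_shift[where f = "\<lambda>x p. (cmod x)\<^sup>2 * wt lam p" and a = a and i = i and j = j] by auto
qed

lemma psum_shift: "a \<in> H2 lam \<Longrightarrow> z \<in> bidisc \<Longrightarrow> psum (shift i j a) z = mon (i, j) z * psum a z"
  by (subst psum_def) (intro infsumI has_sum_mon_shift has_sum_psum)

lemma H2_T1: "a \<in> H2 lam \<Longrightarrow> T1 k a \<in> H2 lam"
  unfolding T1_def[abs_def] by (rule H2_add[OF H2_shift H2_shift])

lemma Mmult_phi1: "a \<in> H2 lam \<Longrightarrow> Mmult (phi1 k) (fn a) = fn (T1 k a)"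
  using psum_add[OF H2_shift[of a k 0] H2_shift[of a 0 k]]
  by (auto simp: Mmult_def fn_def fun_eq_iff T1_def[abs_def] psum_shift phi1_def algebra_simps)

lemma Mmult_phi2: "a \<in> H2 lam \<Longrightarrow> Mmult phi2 (fn a) = fn (T2 a)"
  by (auto simp: Mmult_def fn_def fun_eq_iff psum_shift phi2_def)

lemma nrm2_nonneg: "0 \<le> nrm2 lam a"
  unfolding nrm2_def by (intro infsum_nonneg mult_nonneg_nonneg wt_nonneg) auto

end

section \<open>The von Neumann inequality\<close>

lemma cis_eq_1_int: "cis (2 * pi * of_int t / of_nat k) = 1 \<longleftrightarrow> int k dvd t" if "k > 0"
proof -
  have "cis (2 * pi * of_int t / of_nat k) = 1 \<longleftrightarrow> (\<exists>n. 2 * pi * of_int t / of_nat k = of_int n * (2 * pi))"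
    by (auto simp: cis_eq_1_iff)
  also have "\<dots> \<longleftrightarrow> (\<exists>n. real_of_int t = of_int (int k * n))"
    using that by (simp add: field_simps)
  also have "\<dots> \<longleftrightarrow> int k dvd t"
    by (simp only: of_int_eq_iff dvd_def)
  finally show ?thesis .
qed

lemma xi_powi: "xi k powi t = cis (2 * pi * of_int t / of_nat k)"
  by (simp add: xi_def cis_power_int mult_ac)

lemma xi_nonzero [simp]: "xi k \<noteq> 0"
  by (simp add: xi_def)

lemma cnj_xi: "cnj (xi k) = inverse (xi k)"
  by (simp add: xi_def cis_cnj)

lemma xi_powi_eq_1: "k > 0 \<Longrightarrow> xi k powi t = 1 \<longleftrightarrow> int k dvd t"
  by (simp add: xi_powi cis_eq_1_int)

lemma xi_power_k: "k > 0 \<Longrightarrow> xi k ^ k = 1"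
  using xi_powi_eq_1[of k "int k"] by simp

text \<open>A geometric sum whose ratio is a \<open>k\<close>-th root of unity. It is used both for
  Parseval and for averaging over the rotations of the group.\<close>

lemma xi_sum:
  assumes "k > 0"
  shows "(\<Sum>j<k. (xi k powi t) ^ j) = (if int k dvd t then of_nat k else 0)"
proof (cases "int k dvd t")
  case True
  thus ?thesis using xi_powi_eq_1[OF assms, of t] by simp
next
  case False
  hence ne: "xi k powi t \<noteq> 1" using xi_powi_eq_1[OF assms, of t] by simp
  have "(xi k powi t) ^ k = xi k powi (t * int k)"
    by (simp add: power_int_mult)
  also have "\<dots> = 1" using xi_powi_eq_1[OF assms] by simp
  finally show ?thesis using False ne by (simp add: sum_gp_strict)
qed

text \<open>Distinct exponents below \<open>N\<close> are incongruent mod \<open>N\<close>, so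
  sampling at the \<open>N\<close>-th roots of unity keeps the monomials orthogonal, and a finite
  sum replaces the integral over the circle.\<close>

lemma parseval1:
  fixes b :: "nat \<Rightarrow> complex"
  assumes "N > 0"
  shows "(\<Sum>j<N. (cmod (\<Sum>m<N. b m * (xi N ^ j) ^ m))\<^sup>2) = N * (\<Sum>m<N. (cmod (b m))\<^sup>2)"
proof -
  have "complex_of_real (\<Sum>j<N. (cmod (\<Sum>m<N. b m * (xi N ^ j) ^ m))\<^sup>2)
      = (\<Sum>j<N. (\<Sum>m<N. b m * (xi N ^ j) ^ m) * cnj (\<Sum>m<N. b m * (xi N ^ j) ^ m))"
    by (simp add: complex_norm_square del: of_real_power cnj_sum)
  also have "\<dots> = (\<Sum>j<N. \<Sum>m<N. \<Sum>n<N. b m * cnj (b n) * (xi N powi (int m - int n)) ^ j)"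
    unfolding cnj_sum sum_product
  proof (intro sum.cong refl)
    fix j m n
    have "(xi N ^ j) ^ m * cnj ((xi N ^ j) ^ n) = (xi N powi (int m - int n)) ^ j"
      by (simp add: cnj_xi power_int_diff divide_inverse power_mult_distrib power_inverse mult.commute flip: power_mult)
    thus "b m * (xi N ^ j) ^ m * cnj (b n * (xi N ^ j) ^ n) = b m * cnj (b n) * (xi N powi (int m - int n)) ^ j"
      by (simp add: mult_ac)
  qed
  also have "\<dots> = (\<Sum>m<N. \<Sum>n<N. b m * cnj (b n) * (\<Sum>j<N. (xi N powi (int m - int n)) ^ j))"
    by (subst sum.swap, rule sum.cong[OF refl], subst sum.swap) (simp add: sum_distrib_left)
  also have "\<dots> = (\<Sum>m<N. \<Sum>n<N. if n = m then b m * cnj (b m) * of_nat N else 0)"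
  proof (intro sum.cong refl)
    fix m n assume mn: "m \<in> {..<N}" "n \<in> {..<N}"
    have "int N dvd int m - int n \<longleftrightarrow> n = m"
    proof
      assume "int N dvd int m - int n"
      thus "n = m" using mn zdvd_imp_le[of "int N" "int m - int n"] zdvd_imp_le[of "int N" "int n - int m"]
        by (cases "int m - int n" "0::int" rule: linorder_cases) (auto simp: dvd_diff_commute)
    qed simp
    thus "b m * cnj (b n) * (\<Sum>j<N. (xi N powi (int m - int n)) ^ j) = (if n = m then b m * cnj (b m) * of_nat N else 0)"
      using assms by (simp add: xi_sum)
  qed
  also have "\<dots> = complex_of_real (N * (\<Sum>m<N. (cmod (b m))\<^sup>2))"
    by (simp add: sum_distrib_left complex_norm_square mult_ac del: of_real_power)
  finally show ?thesis by (simp only: of_real_eq_iff)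
qed

lemma parseval2:
  fixes b :: "nat \<times> nat \<Rightarrow> complex"
  assumes "N > 0"
  shows "(\<Sum>i<N. \<Sum>j<N. (cmod (\<Sum>m<N. \<Sum>n<N. b (m,n) * ((xi N ^ i) ^ m * (xi N ^ j) ^ n)))\<^sup>2)
       = (real N)\<^sup>2 * (\<Sum>m<N. \<Sum>n<N. (cmod (b (m,n)))\<^sup>2)"
proof -
  have "(\<Sum>i<N. \<Sum>j<N. (cmod (\<Sum>m<N. \<Sum>n<N. b (m,n) * ((xi N ^ i) ^ m * (xi N ^ j) ^ n)))\<^sup>2)
      = (\<Sum>i<N. \<Sum>j<N. (cmod (\<Sum>n<N. (\<Sum>m<N. b (m,n) * (xi N ^ i) ^ m) * (xi N ^ j) ^ n))\<^sup>2)"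
    by (subst sum.swap) (simp add: sum_distrib_right mult.assoc)
  also have "\<dots> = (\<Sum>i<N. real N * (\<Sum>n<N. (cmod (\<Sum>m<N. b (m,n) * (xi N ^ i) ^ m))\<^sup>2))"
    using parseval1[OF assms] by simp
  also have "\<dots> = real N * (\<Sum>n<N. \<Sum>i<N. (cmod (\<Sum>m<N. b (m,n) * (xi N ^ i) ^ m))\<^sup>2)"
    by (simp only: sum_distrib_left) (rule sum.swap)
  also have "\<dots> = real N * (\<Sum>n<N. real N * (\<Sum>m<N. (cmod (b (m,n)))\<^sup>2))"
    using parseval1[OF assms] by simp
  also have "\<dots> = (real N)\<^sup>2 * (\<Sum>n<N. \<Sum>m<N. (cmod (b (m,n)))\<^sup>2)"
    by (simp add: sum_distrib_left power2_eq_square mult.assoc)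
  also have "(\<Sum>n<N. \<Sum>m<N. (cmod (b (m,n)))\<^sup>2) = (\<Sum>m<N. \<Sum>n<N. (cmod (b (m,n)))\<^sup>2)"
    by (rule sum.swap)
  finally show ?thesis .
qed

text \<open>Sequences of polynomials of degree below \<open>N\<close> in each variable; their sums
  make sense on the closed bidisc, and \<open>N\<close> is also the number of sample points per
  circle.\<close>

definition fsupp :: "nat \<Rightarrow> (nat \<times> nat \<Rightarrow> complex) \<Rightarrow> bool" where
  "fsupp N a \<longleftrightarrow> (\<forall>p. a p \<noteq> 0 \<longrightarrow> fst p < N \<and> snd p < N)"

lemma fsupp_has_sum:
  assumes "fsupp N a"
  shows "((\<lambda>p. a p * mon p z) has_sum (\<Sum>m<N. \<Sum>n<N. a (m,n) * mon (m,n) z)) UNIV"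
proof -
  have "((\<lambda>p. a p * mon p z) has_sum (\<Sum>p\<in>{..<N}\<times>{..<N}. a p * mon p z)) UNIV"
    by (rule has_sum_finite_neutralI) (use assms in \<open>auto simp: fsupp_def\<close>)
  thus ?thesis by (simp add: sum.cartesian_product case_prod_unfold)
qed

lemma psum_fsupp: "fsupp N a \<Longrightarrow> psum a z = (\<Sum>m<N. \<Sum>n<N. a (m,n) * mon (m,n) z)"
  unfolding psum_def by (rule infsumI) (rule fsupp_has_sum)

section \<open>Norms as moments and the estimate for polynomials\<close>

context bergman
begin

text \<open>In the variable t = |z|^2 the normalized weighted area measure of the disc has density
  (lam - 1) (1 - t)^(lam - 2) on [0,1]; the right-hand side is its \<open>m\<close>-th
  moment.\<close>

lemma moment_Beta:
  assumes "lam > 1"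
  shows "1 / wcoef lam m = (lam - 1) * Beta (real m + 1) (lam - 1)"
proof -
  have "pochhammer lam m = Gamma (lam + m) / Gamma lam"
    using assms by (intro pochhammer_Gamma) (auto elim!: nonpos_Ints_cases)
  moreover have "Gamma lam = (lam - 1) * Gamma (lam - 1)"
    using Gamma_plus1[of "lam - 1"] nonpos_Ints_nonpos[of "lam - 1"] assms by force
  moreover have "Gamma (lam + real m) > 0" using assms by (intro Gamma_real_pos) auto
  moreover have "Gamma lam > 0" using assms by (intro Gamma_real_pos) auto
  ultimately show ?thesis
    using Gamma_fact[of m, where 'a = real] by (simp add: wcoef_def Beta_def field_simps add.commute)
qed

text \<open>Only the positivity of the functional sending t^m to \<open>1 / wcoef lam m\<close> is
  recorded. For \<open>lam = 1\<close>, where the density degenerates, it is evaluation at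
  1.\<close>

lemma moment_pos:
  assumes "\<And>t. 0 \<le> t \<Longrightarrow> t \<le> 1 \<Longrightarrow> 0 \<le> (\<Sum>m<N. c m * t ^ m)"
  shows "0 \<le> (\<Sum>m<N. c m / wcoef lam m)"
proof (cases "lam = 1")
  case True
  have "wcoef lam m = 1" for m by (simp add: True wcoef_def pochhammer_fact[symmetric])
  thus ?thesis using assms[of 1] by simp
next
  case False
  hence lam: "lam > 1" using lam1 by simp
  let ?f = "\<lambda>m t. t powr real m * (1 - t) powr (lam - 2)"
  have "(?f m has_integral Beta (real m + 1) (lam - 1)) {0..1}" for m
    using has_integral_Beta_real[of "real m + 1" "lam - 1"] lam by simp
  hence "((\<lambda>t. \<Sum>m<N. c m * ?f m t) has_integral (\<Sum>m<N. c m * Beta (real m + 1) (lam - 1))) {0..1}"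
    by (intro has_integral_sum has_integral_mult_right) auto
  hence "0 \<le> (\<Sum>m<N. c m * Beta (real m + 1) (lam - 1))"
  proof (rule has_integral_nonneg)
    fix t :: real assume t: "t \<in> {0..1}"
    \<comment> \<open>Since \<open>0 powr 0 = 0\<close>, the power \<open>t powr real m\<close>
      differs from \<open>t ^ m\<close> at \<open>t = 0\<close>, \<open>m = 0\<close>; the whole
      integrand vanishes at that point.\<close>
    show "0 \<le> (\<Sum>m<N. c m * ?f m t)"
    proof (cases "t = 0")
      case False
      have "(\<Sum>m<N. c m * ?f m t) = (\<Sum>m<N. c m * t ^ m) * (1 - t) powr (lam - 2)"
        using t False by (simp add: sum_distrib_right powr_realpow mult.assoc)
      thus ?thesis using assms[of t] t by simp
    qed simp
  qed
  hence "0 \<le> (lam - 1) * (\<Sum>m<N. c m * Beta (real m + 1) (lam - 1))" using lam by simp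
  also have "\<dots> = (\<Sum>m<N. c m * (1 / wcoef lam m))"
    unfolding moment_Beta[OF lam] by (simp add: sum_distrib_left mult_ac)
  finally show ?thesis by simp
qed

text \<open>The product functional is positive because its two factors can be applied one variable
  at a time.\<close>

lemma moment_pos2:
  assumes "\<And>s t. 0 \<le> s \<Longrightarrow> s \<le> 1 \<Longrightarrow> 0 \<le> t \<Longrightarrow> t \<le> 1 \<Longrightarrow> 0 \<le> (\<Sum>m<N. \<Sum>n<N. c m n * (s ^ m * t ^ n))"
  shows "0 \<le> (\<Sum>m<N. \<Sum>n<N. c m n * wt lam (m, n))"
proof -
  have "0 \<le> (\<Sum>m<N. (\<Sum>n<N. c m n / wcoef lam n) / wcoef lam m)"
  proof (rule moment_pos)
    fix s :: real assume s: "0 \<le> s" "s \<le> 1"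
    have "0 \<le> (\<Sum>n<N. (\<Sum>m<N. c m n * s ^ m) / wcoef lam n)"
    proof (rule moment_pos)
      fix t :: real assume t: "0 \<le> t" "t \<le> 1"
      have "(\<Sum>n<N. (\<Sum>m<N. c m n * s ^ m) * t ^ n) = (\<Sum>m<N. \<Sum>n<N. c m n * (s ^ m * t ^ n))"
        by (subst sum.swap) (simp add: sum_distrib_right mult.assoc)
      thus "0 \<le> (\<Sum>n<N. (\<Sum>m<N. c m n * s ^ m) * t ^ n)" using assms[OF s t] by simp
    qed
    also have "\<dots> = (\<Sum>m<N. (\<Sum>n<N. c m n / wcoef lam n) * s ^ m)"
      unfolding sum_divide_distrib sum_distrib_right by (subst sum.swap) simp
    finally show "0 \<le> (\<Sum>m<N. (\<Sum>n<N. c m n / wcoef lam n) * s ^ m)" .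
  qed
  thus ?thesis by (simp add: wt_def sum_divide_distrib divide_divide_eq_left mult.commute)
qed

text \<open>Parseval on the torus of radii \<open>sqrt s\<close>, \<open>sqrt t\<close>, discretised by \<open>N\<close>-th roots of unity, gives the
  inequality with weights \<open>s ^ m * t ^ n\<close>; the positive functional of \<open>moment_pos2\<close> integrates it.\<close>

lemma fsupp_bound:
  assumes a: "fsupp N a" and b: "fsupp N b"
    and le: "\<And>z. z \<in> cbidisc \<Longrightarrow> cmod (psum b z) \<le> K * cmod (psum a z)"
  shows "(\<Sum>m<N. \<Sum>n<N. (cmod (b (m,n)))\<^sup>2 * wt lam (m,n)) \<le> K\<^sup>2 * (\<Sum>m<N. \<Sum>n<N. (cmod (a (m,n)))\<^sup>2 * wt lam (m,n))"
proof (cases "N = 0")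
  case False
  have "0 \<le> (\<Sum>m<N. \<Sum>n<N. (K\<^sup>2 * (cmod (a (m,n)))\<^sup>2 - (cmod (b (m,n)))\<^sup>2) * wt lam (m, n))"
  proof (rule moment_pos2)
    fix s t :: real assume st: "0 \<le> s" "s \<le> 1" "0 \<le> t" "t \<le> 1"
    define r where "r = complex_of_real (sqrt s)"
    define q where "q = complex_of_real (sqrt t)"
    have P: "(\<Sum>i<N. \<Sum>j<N. (cmod (psum a (r * xi N ^ i, q * xi N ^ j)))\<^sup>2)
      = (real N)\<^sup>2 * (\<Sum>m<N. \<Sum>n<N. (cmod (a (m,n)))\<^sup>2 * (s ^ m * t ^ n))" if "fsupp N a" for a
    proof -
      have "(\<Sum>i<N. \<Sum>j<N. (cmod (psum a (r * xi N ^ i, q * xi N ^ j)))\<^sup>2)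
        = (\<Sum>i<N. \<Sum>j<N. (cmod (\<Sum>m<N. \<Sum>n<N. (case (m,n) of (m,n) \<Rightarrow> a (m,n) * (r^m * q^n)) * ((xi N ^ i) ^ m * (xi N ^ j) ^ n)))\<^sup>2)"
        by (simp add: psum_fsupp[OF that] power_mult_distrib mult_ac)
      also have "\<dots> = (real N)\<^sup>2 * (\<Sum>m<N. \<Sum>n<N. (cmod (case (m,n) of (m,n) \<Rightarrow> a (m,n) * (r^m * q^n)))\<^sup>2)"
        using False by (intro parseval2) auto
      also have "(\<lambda>m n. (cmod (case (m,n) of (m,n) \<Rightarrow> a (m,n) * (r^m * q^n)))\<^sup>2) = (\<lambda>m n. (cmod (a (m,n)))\<^sup>2 * (s ^ m * t ^ n))"
      proof (intro ext)
        fix m n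
        have "(cmod r ^ m)\<^sup>2 = s ^ m" "(cmod q ^ n)\<^sup>2 = t ^ n"
          using st by (simp_all add: r_def q_def power_mult[symmetric] mult.commute[of _ 2])
             (simp_all add: power_mult)
        thus "(cmod (case (m,n) of (m,n) \<Rightarrow> a (m,n) * (r^m * q^n)))\<^sup>2 = (cmod (a (m,n)))\<^sup>2 * (s ^ m * t ^ n)"
          by (simp add: norm_mult norm_power power_mult_distrib)
      qed
      finally show ?thesis .
    qed
    have "(\<Sum>i<N. \<Sum>j<N. (cmod (psum b (r * xi N ^ i, q * xi N ^ j)))\<^sup>2)
       \<le> (\<Sum>i<N. \<Sum>j<N. K\<^sup>2 * (cmod (psum a (r * xi N ^ i, q * xi N ^ j)))\<^sup>2)"
    proof (intro sum_mono)
      fix i j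
      have "(r * xi N ^ i, q * xi N ^ j) \<in> cbidisc"
        using st by (simp add: cbidisc_def norm_mult norm_power xi_def r_def q_def)
      from power_mono[OF le[OF this], of 2]
      show "(cmod (psum b (r * xi N ^ i, q * xi N ^ j)))\<^sup>2 \<le> K\<^sup>2 * (cmod (psum a (r * xi N ^ i, q * xi N ^ j)))\<^sup>2"
        by (simp add: power_mult_distrib)
    qed
    also have "\<dots> = K\<^sup>2 * (\<Sum>i<N. \<Sum>j<N. (cmod (psum a (r * xi N ^ i, q * xi N ^ j)))\<^sup>2)"
      by (simp add: sum_distrib_left)
    finally have "(real N)\<^sup>2 * (\<Sum>m<N. \<Sum>n<N. (cmod (b (m,n)))\<^sup>2 * (s ^ m * t ^ n))
       \<le> (real N)\<^sup>2 * (K\<^sup>2 * (\<Sum>m<N. \<Sum>n<N. (cmod (a (m,n)))\<^sup>2 * (s ^ m * t ^ n)))"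
      unfolding P[OF a] P[OF b] by (simp add: mult_ac)
    hence "(\<Sum>m<N. \<Sum>n<N. (cmod (b (m,n)))\<^sup>2 * (s ^ m * t ^ n))
       \<le> K\<^sup>2 * (\<Sum>m<N. \<Sum>n<N. (cmod (a (m,n)))\<^sup>2 * (s ^ m * t ^ n))"
      using False by (subst (asm) mult_le_cancel_left_pos) auto
    thus "0 \<le> (\<Sum>m<N. \<Sum>n<N. (K\<^sup>2 * (cmod (a (m,n)))\<^sup>2 - (cmod (b (m,n)))\<^sup>2) * (s ^ m * t ^ n))"
      by (simp add: left_diff_distrib sum_subtractf sum_distrib_left mult.assoc)
  qed
  thus ?thesis by (simp add: left_diff_distrib sum_subtractf sum_distrib_left mult.assoc)
qed simp

end

section \<open>Polynomials in the two shifts, and truncation\<close>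

definition poly_shift :: "(nat \<times> nat) set \<Rightarrow> (nat \<times> nat \<Rightarrow> complex) \<Rightarrow> nat \<Rightarrow> (nat \<times> nat \<Rightarrow> complex) \<Rightarrow> nat \<times> nat \<Rightarrow> complex" where
  "poly_shift Q c k a p = (\<Sum>(i, j)\<in>Q. c (i, j) * (T1 k ^^ i) ((T2 ^^ j) a) p)"

lemma has_sum_finite_sum:
  fixes f :: "'i \<Rightarrow> 'a \<Rightarrow> 'b :: {topological_comm_monoid_add}"
  assumes "\<And>i. i \<in> I \<Longrightarrow> (f i has_sum s i) A"
  shows "((\<lambda>x. \<Sum>i\<in>I. f i x) has_sum (\<Sum>i\<in>I. s i)) A"
  using assms
proof (induction I rule: infinite_finite_induct)
  case (insert i I)
  have "((\<lambda>x. f i x + (\<Sum>i\<in>I. f i x)) has_sum (s i + (\<Sum>i\<in>I. s i))) A"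
    using insert.prems by (intro has_sum_add insert.IH) simp_all
  thus ?case using insert.hyps by simp
qed simp_all

lemma has_sum_mon_T1:
  assumes "((\<lambda>p. a p * mon p z) has_sum s) UNIV"
  shows "((\<lambda>p. T1 k a p * mon p z) has_sum (phi1 k z * s)) UNIV"
  using has_sum_add[OF has_sum_mon_shift[OF assms, of k 0] has_sum_mon_shift[OF assms, of 0 k]]
  by (simp add: T1_def phi1_def distrib_right)

lemma has_sum_mon_iterates:
  assumes "((\<lambda>p. a p * mon p z) has_sum s) UNIV"
  shows "((\<lambda>p. (T1 k ^^ i) ((T2 ^^ j) a) p * mon p z) has_sum (phi1 k z ^ i * phi2 z ^ j * s)) UNIV"
proof -
  have 2: "((\<lambda>p. (T2 ^^ j) a p * mon p z) has_sum (phi2 z ^ j * s)) UNIV"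
  proof (induction j)
    case (Suc j)
    from has_sum_mon_shift[OF this, of 1 1] show ?case by (simp add: phi2_def mult_ac)
  qed (use assms in simp)
  show ?thesis
  proof (induction i)
    case (Suc i)
    from has_sum_mon_T1[OF this, of k] show ?case by (simp add: mult_ac)
  qed (use 2 in simp)
qed

text \<open>Pointwise in \<open>z\<close> and for any convergent series, so that it covers elements
  of the space on the open bidisc as well as polynomials on the closed one.\<close>

lemma has_sum_mon_poly_shift:
  assumes "((\<lambda>p. a p * mon p z) has_sum s) UNIV"
  shows "((\<lambda>p. poly_shift Q c k a p * mon p z) has_sum (poly_eval Q c (phi k z) * s)) UNIV"
proof (cases "finite Q")
  case True
  have "((\<lambda>p. \<Sum>q\<in>Q. c q * ((T1 k ^^ fst q) ((T2 ^^ snd q) a) p * mon p z))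
     has_sum (\<Sum>q\<in>Q. c q * (phi1 k z ^ fst q * phi2 z ^ snd q * s))) UNIV"
    using has_sum_mon_iterates[OF assms] by (intro has_sum_finite_sum has_sum_cmult_right)
  thus ?thesis
    by (simp add: poly_shift_def poly_eval_def phi_def case_prod_unfold sum_distrib_right mult.assoc)
qed (simp add: poly_shift_def poly_eval_def)

definition agree :: "nat \<Rightarrow> (nat \<times> nat \<Rightarrow> complex) \<Rightarrow> (nat \<times> nat \<Rightarrow> complex) \<Rightarrow> bool" where
  "agree N a b \<longleftrightarrow> (\<forall>p. fst p < N \<longrightarrow> snd p < N \<longrightarrow> a p = b p)"

lemma agree_shift: "agree N a b \<Longrightarrow> agree N (shift i j a) (shift i j b)"
  by (simp add: agree_def shift_def)

lemma agree_T1: "agree N a b \<Longrightarrow> agree N (T1 k a) (T1 k b)"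
  using agree_shift[of N a b k 0] agree_shift[of N a b 0 k] by (simp add: agree_def T1_def)

lemma agree_funpow:
  "(\<And>a b. agree N a b \<Longrightarrow> agree N (f a) (f b)) \<Longrightarrow> agree N a b \<Longrightarrow> agree N ((f ^^ i) a) ((f ^^ i) b)"
  by (induction i) simp_all

lemma agree_poly_shift:
  assumes "agree N a b"
  shows "agree N (poly_shift Q c k a) (poly_shift Q c k b)"
proof -
  have "agree N ((T1 k ^^ i) ((T2 ^^ j) a)) ((T1 k ^^ i) ((T2 ^^ j) b))" for i j
    by (intro agree_funpow agree_T1 agree_shift assms)
  thus ?thesis by (simp add: agree_def poly_shift_def)
qed

lemma fsupp_mono: "fsupp M a \<Longrightarrow> M \<le> N \<Longrightarrow> fsupp N a"
  by (force simp: fsupp_def)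

lemma fsupp_shift: "fsupp N a \<Longrightarrow> fsupp (N + i + j) (shift i j a)"
  by (force simp: fsupp_def shift_def)

lemma fsupp_add: "fsupp N a \<Longrightarrow> fsupp N b \<Longrightarrow> fsupp N (\<lambda>p. a p + b p)"
  by (simp add: fsupp_def) (metis add_0)

lemma fsupp_T1: "fsupp N a \<Longrightarrow> fsupp (N + k) (T1 k a)"
  using fsupp_add[of "N + k" "shift k 0 a" "shift 0 k a"] fsupp_shift[of N a k 0] fsupp_shift[of N a 0 k]
  by (simp add: T1_def[abs_def])

lemma fsupp_iterates: "fsupp N a \<Longrightarrow> \<exists>N. fsupp N ((T1 k ^^ i) ((T2 ^^ j) a))"
proof (induction i)
  case 0
  thus ?case by (induction j) (auto intro: fsupp_shift)
qed (auto intro: fsupp_T1)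

lemma fsupp_sum: "finite Q \<Longrightarrow> (\<And>q. q \<in> Q \<Longrightarrow> \<exists>N. fsupp N (f q)) \<Longrightarrow> \<exists>N. fsupp N (\<lambda>p. \<Sum>q\<in>Q. c q * f q p)"
proof (induction Q rule: finite_induct)
  case empty
  thus ?case by (simp add: fsupp_def)
next
  case (insert q Q)
  obtain M where "fsupp M (f q)" using insert.prems by blast
  moreover obtain N where "fsupp N (\<lambda>p. \<Sum>q\<in>Q. c q * f q p)" using insert.IH insert.prems by blast
  ultimately
  have "fsupp (M + N) (\<lambda>p. c q * f q p)" "fsupp (M + N) (\<lambda>p. \<Sum>q\<in>Q. c q * f q p)"
    by (force simp: fsupp_def intro: fsupp_mono)+
  from fsupp_add[OF this] show ?case using insert.hyps by auto
qed

lemma fsupp_poly_shift: "finite Q \<Longrightarrow> fsupp N a \<Longrightarrow> \<exists>N. fsupp N (poly_shift Q c k a)"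
  unfolding poly_shift_def[abs_def] case_prod_unfold prod.collapse by (rule fsupp_sum) (assumption, rule fsupp_iterates)

lemma Mmult_funpow: "(Mmult g ^^ i) f = (\<lambda>z. g z ^ i * f z)"
  by (induction i) (simp_all add: Mmult_def fun_eq_iff mult_ac)

text \<open>The real \<open>SUP\<close> in \<open>Dcontraction\<close> is an upper bound only for a
  bounded set; here boundedness follows from compactness of the closed bidisc.\<close>

lemma poly_eval_bounded: "bdd_above ((\<lambda>w. cmod (poly_eval Q c w)) ` phi k ` cbidisc)"
proof -
  have "cbidisc = cball 0 1 \<times> cball 0 1" by (auto simp: cbidisc_def)
  moreover have "compact (cball (0::complex) 1 \<times> cball (0::complex) 1)" by (intro compact_Times compact_cball)
  ultimately have "compact cbidisc" by (rule ssubst)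
  moreover have "continuous_on cbidisc (\<lambda>z. cmod (poly_eval Q c (phi k z)))"
    unfolding poly_eval_def phi_def phi1_def phi2_def case_prod_unfold fst_conv snd_conv
    by (intro continuous_intros)
  ultimately have "compact ((\<lambda>z. cmod (poly_eval Q c (phi k z))) ` cbidisc)"
    by (rule compact_continuous_image[rotated])
  thus ?thesis by (simp add: image_image compact_imp_bounded bounded_imp_bdd_above)
qed

context bergman
begin

text \<open>The shifts only move coefficients up, so on a finite set of indices \<open>a\<close> may be truncated.\<close>

lemma poly_shift_finite_bound:
  assumes a: "a \<in> H2 lam" and Q: "finite Q"
    and le: "\<And>z. z \<in> cbidisc \<Longrightarrow> cmod (poly_eval Q c (phi k z)) \<le> K"
    and F: "finite F"
  shows "(\<Sum>p\<in>F. (cmod (poly_shift Q c k a p))\<^sup>2 * wt lam p) \<le> K\<^sup>2 * nrm2 lam a"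
proof -
  let ?w = "\<lambda>a p. (cmod (a p))\<^sup>2 * wt lam p"
  have w0: "0 \<le> ?w a p" for a p by (intro mult_nonneg_nonneg wt_nonneg) simp
  define M where "M = Suc (Max (fst ` F \<union> snd ` F))"
  have FM: "fst p < M" "snd p < M" if "p \<in> F" for p
    unfolding M_def less_Suc_eq_le using F that by (auto intro!: Max_ge)
  define a' where "a' = (\<lambda>p. if fst p < M \<and> snd p < M then a p else 0)"
  have fa: "fsupp M a'" by (simp add: fsupp_def a'_def)
  define b where "b = poly_shift Q c k a'"
  obtain N' where "fsupp N' b" using fsupp_poly_shift[OF Q fa] unfolding b_def by blast
  define N where "N = max M N'"
  have fN: "fsupp N a'" "fsupp N b"
    using fa \<open>fsupp N' b\<close> by (auto simp: N_def intro: fsupp_mono)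
  have psb: "psum b z = poly_eval Q c (phi k z) * psum a' z" for z
    unfolding psum_fsupp[OF fN(1)] b_def psum_def[of "poly_shift Q c k a'"]
    by (rule infsumI, rule has_sum_mon_poly_shift, rule fsupp_has_sum[OF fN(1)])
  have ag: "poly_shift Q c k a p = b p" if "p \<in> F" for p
  proof -
    have "agree M a a'" by (simp add: agree_def a'_def)
    from agree_poly_shift[OF this, of Q c k] show ?thesis using FM[OF that] unfolding b_def agree_def by blast
  qed
  have MN: "M \<le> N" by (simp add: N_def)
  have sub: "F \<subseteq> {..<N} \<times> {..<N}"
    using FM less_le_trans[OF _ MN] by (auto simp: subset_iff)
  have "(\<Sum>p\<in>F. ?w (poly_shift Q c k a) p) = (\<Sum>p\<in>F. ?w b p)" using ag by simp
  also have "\<dots> \<le> (\<Sum>p\<in>{..<N}\<times>{..<N}. ?w b p)"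
    by (rule sum_mono2) (use sub w0 in auto)
  also have "\<dots> \<le> K\<^sup>2 * (\<Sum>p\<in>{..<N}\<times>{..<N}. ?w a' p)"
    using fsupp_bound[OF fN, of K] le by (simp add: psb norm_mult mult_right_mono sum.cartesian_product case_prod_unfold)
  also have "(\<Sum>p\<in>{..<N}\<times>{..<N}. ?w a' p) \<le> (\<Sum>p\<in>{..<N}\<times>{..<N}. ?w a p)"
    by (rule sum_mono) (auto simp: a'_def wt_nonneg)
  also have "\<dots> \<le> nrm2 lam a"
    unfolding nrm2_def using a by (intro finite_sum_le_infsum w0) (auto simp: H2_def)
  finally show ?thesis by (simp add: mult_left_mono)
qed

text \<open>A bound that is uniform over finite index sets yields summability and the norm estimate
  at once.\<close>

lemma poly_shift_bound:
  assumes a: "a \<in> H2 lam" and Q: "finite Q"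
    and le: "\<And>z. z \<in> cbidisc \<Longrightarrow> cmod (poly_eval Q c (phi k z)) \<le> K"
  shows "poly_shift Q c k a \<in> H2 lam" "nrm2 lam (poly_shift Q c k a) \<le> K\<^sup>2 * nrm2 lam a"
proof -
  show "poly_shift Q c k a \<in> H2 lam"
    unfolding H2_def mem_Collect_eq
  proof (rule nonneg_bdd_above_summable_on)
    show "bdd_above (sum (\<lambda>p. (cmod (poly_shift Q c k a p))\<^sup>2 * wt lam p) ` {F. F \<subseteq> UNIV \<and> finite F})"
      by (rule bdd_aboveI2[where M = "K\<^sup>2 * nrm2 lam a"]) (use poly_shift_finite_bound[OF assms] in auto)
  qed (intro mult_nonneg_nonneg wt_nonneg, simp)
  thus "nrm2 lam (poly_shift Q c k a) \<le> K\<^sup>2 * nrm2 lam a"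
    unfolding nrm2_def[of lam "poly_shift Q c k a"] H2_def mem_Collect_eq
    by (rule infsum_le_finite_sums) (use poly_shift_finite_bound[OF assms] in auto)
qed

lemma poly_op_fn:
  assumes "a \<in> H2 lam"
  shows "poly_op Q c (Mmult (phi1 k)) (Mmult phi2) (fn a) = fn (poly_shift Q c k a)"
proof
  fix z
  have "psum (poly_shift Q c k a) z = poly_eval Q c (phi k z) * psum a z" if "z \<in> bidisc"
    unfolding psum_def[of "poly_shift Q c k a"]
    by (rule infsumI, rule has_sum_mon_poly_shift, rule has_sum_psum[OF assms that])
  thus "poly_op Q c (Mmult (phi1 k)) (Mmult phi2) (fn a) z = fn (poly_shift Q c k a) z"
    by (simp add: poly_op_def Mmult_funpow fn_def poly_eval_def phi_def sum_distrib_right case_prod_unfold mult.assoc)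
qed

text \<open>The norm inequality holds on the entire space, so a subspace contributes nothing but its
  invariance.\<close>

lemma Dcontraction_invariant_subspace:
  assumes S: "S \<subseteq> H2 lam" and T: "\<And>a. a \<in> S \<Longrightarrow> T1 k a \<in> S \<and> T2 a \<in> S"
  shows "Dcontraction k lam (fn ` S) (Mmult (phi1 k)) (Mmult phi2)"
  unfolding Dcontraction_def
proof (intro conjI ballI allI impI)
  fix f assume "f \<in> fn ` S"
  then obtain a where a: "a \<in> S" "f = fn a" by auto
  hence aH: "a \<in> H2 lam" using S by auto
  show "Mmult (phi1 k) f \<in> fn ` S" "Mmult phi2 f \<in> fn ` S"
    using T[OF a(1)] by (auto simp: a(2) Mmult_phi1[OF aH] Mmult_phi2[OF aH])
  show "Mmult (phi1 k) (Mmult phi2 f) = Mmult phi2 (Mmult (phi1 k) f)"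
    by (simp add: Mmult_def mult_ac)
  fix Q :: "(nat \<times> nat) set" and c assume Q: "finite Q"
  define K where "K = (SUP w\<in>phi k ` cbidisc. cmod (poly_eval Q c w))"
  have le: "cmod (poly_eval Q c (phi k z)) \<le> K" if "z \<in> cbidisc" for z
    unfolding K_def by (rule cSUP_upper) (use that poly_eval_bounded in auto)
  \<comment> \<open>The origin shows that the supremum is nonnegative, as required for
    \<open>sqrt (K\<^sup>2) = K\<close>.\<close>
  have "0 \<le> cmod (poly_eval Q c (phi k (0, 0)))" by simp
  also have "\<dots> \<le> K" by (rule le) (simp add: cbidisc_def)
  finally have K0: "0 \<le> K" .
  from poly_shift_bound[OF aH Q le]
  have H: "poly_shift Q c k a \<in> H2 lam" and n: "nrm2 lam (poly_shift Q c k a) \<le> K\<^sup>2 * nrm2 lam a" by auto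
  have "sqrt (nrm2 lam (poly_shift Q c k a)) \<le> K * sqrt (nrm2 lam a)"
    using real_sqrt_le_mono[OF n] K0 by (simp add: real_sqrt_mult)
  thus "Anorm lam (poly_op Q c (Mmult (phi1 k)) (Mmult phi2) f)
      \<le> (SUP w\<in>phi k ` cbidisc. cmod (poly_eval Q c w)) * Anorm lam f"
    unfolding a(2) poly_op_fn[OF aH] Anorm_fn[OF aH] Anorm_fn[OF H] K_def .
qed

end

section \<open>Isotypic subspaces and their wandering vectors\<close>

text \<open>Selects the monomials z1^m z2^n that substitution of delta z for z multiplies by xi^r.
  The condition is stated over the integers because \<open>m - n\<close> may be negative.\<close>

definition res_class :: "nat \<Rightarrow> nat \<Rightarrow> nat \<Rightarrow> nat \<Rightarrow> bool" where
  "res_class k r m n \<longleftrightarrow> int k dvd int m - int n - int r"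

lemma res_class_add_left: "res_class k r (m + k) n \<longleftrightarrow> res_class k r m n"
proof -
  have "int (m + k) - int n - int r = (int m - int n - int r) + int k" by simp
  thus ?thesis unfolding res_class_def by (simp only: dvd_add_triv_right_iff)
qed

lemma res_class_add_right: "res_class k r m (n + k) \<longleftrightarrow> res_class k r m n"
proof -
  have "int m - int n - int r = (int m - int (n + k) - int r) + int k" by simp
  thus ?thesis unfolding res_class_def by (simp only: dvd_add_triv_right_iff)
qed

text \<open>In the application \<open>x\<close> and \<open>y\<close> are the first coordinates of unit eigenvectors of \<open>\<delta>\<close> for the
  eigenvalues \<open>\<xi>\<^sup>r\<close> and \<open>\<xi>\<^sup>-\<^sup>r\<close> that are exchanged by \<open>\<sigma>\<close>; for the characters \<open>x = 1 / sqrt 2\<close>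
  and \<open>y = \<plusminus> x\<close>.\<close>

definition isotypic :: "real \<Rightarrow> nat \<Rightarrow> nat \<Rightarrow> complex \<Rightarrow> complex \<Rightarrow> (nat \<times> nat \<Rightarrow> complex) set" where
  "isotypic lam k r x y = {b \<in> H2 lam. (\<forall>m n. b (m, n) \<noteq> 0 \<longrightarrow> res_class k r m n \<or> res_class k r n m) \<and>
     (\<forall>m n. res_class k r m n \<longrightarrow> y * b (m, n) = x * b (n, m))}"

text \<open>The inner product is introduced by polarization because \<open>unit_equiv\<close> only speaks about norms.\<close>

definition ip :: "real \<Rightarrow> (nat \<times> nat \<Rightarrow> complex) \<Rightarrow> (nat \<times> nat \<Rightarrow> complex) \<Rightarrow> complex" where
  "ip lam a b = (nrm2 lam (\<lambda>p. 1 * a p + 1 * b p) - nrm2 lam (\<lambda>p. 1 * a p + (-1) * b p)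
     + \<i> * nrm2 lam (\<lambda>p. 1 * a p + \<i> * b p) - \<i> * nrm2 lam (\<lambda>p. 1 * a p + (-\<i>) * b p)) / 4"

definition wander :: "real \<Rightarrow> nat \<Rightarrow> (nat \<times> nat \<Rightarrow> complex) set \<Rightarrow> (nat \<times> nat \<Rightarrow> complex) set" where
  "wander lam k S = {f \<in> S. \<forall>g\<in>S. ip lam f (T1 k g) = 0 \<and> ip lam f (T2 g) = 0}"

text \<open>The notion \<open>unit_equiv\<close> transported to coefficient sequences.\<close>

definition intertwines :: "real \<Rightarrow> nat \<Rightarrow> ((nat \<times> nat \<Rightarrow> complex) \<Rightarrow> nat \<times> nat \<Rightarrow> complex) \<Rightarrow>
    (nat \<times> nat \<Rightarrow> complex) set \<Rightarrow> (nat \<times> nat \<Rightarrow> complex) set \<Rightarrow> bool" where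
  "intertwines lam k V S S' \<longleftrightarrow> bij_betw V S S' \<and>
     (\<forall>a\<in>S. \<forall>b\<in>S. \<forall>c d. V (\<lambda>p. c * a p + d * b p) = (\<lambda>p. c * V a p + d * V b p)) \<and>
     (\<forall>a\<in>S. nrm2 lam (V a) = nrm2 lam a) \<and>
     (\<forall>a\<in>S. V (T1 k a) = T1 k (V a) \<and> V (T2 a) = T2 (V a))"

text \<open>Coefficients of x z1^m z2^n + y z1^n z2^m. Being a sum, it gives \<open>x + y\<close>
  when \<open>m = n\<close>, hence 0 for a sign character with \<open>y = -x\<close>.\<close>

definition orbit_mon :: "complex \<Rightarrow> complex \<Rightarrow> nat \<Rightarrow> nat \<Rightarrow> nat \<times> nat \<Rightarrow> complex" where
  "orbit_mon x y m n p = (if p = (m, n) then x else 0) + (if p = (n, m) then y else 0)"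

lemma funpow_T2: "(T2 ^^ b) a = shift b b a"
  by (induction b) (auto simp: shift_def fun_eq_iff)

text \<open>The second form matches goals in which \<open>1\<close> has been rewritten to
  \<open>Suc 0\<close>.\<close>

lemmas funpow_T2' = funpow_T2 funpow_T2[unfolded One_nat_def]

lemma shift_delta: "shift i j (\<lambda>p. if p = (m, n) then x else 0) p = (if p = (m + i, n + j) then x else 0)"
proof -
  have "(i \<le> fst p \<and> j \<le> snd p \<and> (fst p - i, snd p - j) = (m, n)) = (p = (m + i, n + j))"
    by (cases p) auto
  thus ?thesis unfolding shift_def by (auto simp del: prod.inject)
qed

lemma shift_add: "shift i j (\<lambda>p. a p + b p) p = shift i j a p + shift i j b p"
  by (simp add: shift_def)

lemma shift_orbit_mon: "shift i j (orbit_mon x y m n) p = (if p = (m + i, n + j) then x else 0) + (if p = (n + i, m + j) then y else 0)"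
  unfolding orbit_mon_def[abs_def] shift_add shift_delta ..

lemma T1_orbit_mon: "T1 k (orbit_mon x y m n) p = orbit_mon x y (m + k) n p + orbit_mon x y m (n + k) p"
proof -
  have "(a + b) + (c + d) = (a + d) + (c + b)" for a b c d :: complex by simp
  thus ?thesis unfolding T1_def shift_orbit_mon orbit_mon_def add_0_right .
qed

lemma T2_orbit_mon: "T2 (orbit_mon x y m n) p = orbit_mon x y (m + 1) (n + 1) p"
  unfolding shift_orbit_mon orbit_mon_def ..

lemma has_sum_diff_complex:
  fixes f g :: "'a \<Rightarrow> complex"
  assumes "(f has_sum s) A" "(g has_sum t) A"
  shows "((\<lambda>p. f p - g p) has_sum (s - t)) A"
  using has_sum_add[OF assms(1) has_sum_uminusI[OF assms(2)]] by simp

section \<open>The inner product on coefficients and invariance of the isotypic subspaces\<close>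

context bergman
begin

lemma has_sum_nrm2: "a \<in> H2 lam \<Longrightarrow> ((\<lambda>p. (cmod (a p))\<^sup>2 * wt lam p) has_sum nrm2 lam a) UNIV"
  by (simp add: nrm2_def H2_def)

text \<open>The polarization identity, applied term by term to the four norms.\<close>

lemma ip_has_sum:
  assumes "a \<in> H2 lam" "b \<in> H2 lam"
  shows "((\<lambda>p. a p * cnj (b p) * wt lam p) has_sum ip lam a b) UNIV"
proof -
  have N: "((\<lambda>p. complex_of_real ((cmod (1 * a p + c * b p))\<^sup>2 * wt lam p)) has_sum nrm2 lam (\<lambda>p. 1 * a p + c * b p)) UNIV" for c
    by (intro has_sum_of_real has_sum_nrm2 H2_add H2_scale assms)
  have "((\<lambda>p. (complex_of_real ((cmod (1 * a p + 1 * b p))\<^sup>2 * wt lam p) - complex_of_real ((cmod (1 * a p + (-1) * b p))\<^sup>2 * wt lam p)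
     + \<i> * complex_of_real ((cmod (1 * a p + \<i> * b p))\<^sup>2 * wt lam p) - \<i> * complex_of_real ((cmod (1 * a p + (-\<i>) * b p))\<^sup>2 * wt lam p)) / 4)
     has_sum ip lam a b) UNIV"
    unfolding ip_def of_real_diff by (intro has_sum_divide_const has_sum_diff_complex has_sum_add has_sum_cmult_right N)
  also have "(\<lambda>p. (complex_of_real ((cmod (1 * a p + 1 * b p))\<^sup>2 * wt lam p) - complex_of_real ((cmod (1 * a p + (-1) * b p))\<^sup>2 * wt lam p)
     + \<i> * complex_of_real ((cmod (1 * a p + \<i> * b p))\<^sup>2 * wt lam p) - \<i> * complex_of_real ((cmod (1 * a p + (-\<i>) * b p))\<^sup>2 * wt lam p)) / 4)
     = (\<lambda>p. a p * cnj (b p) * wt lam p)"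
    by (simp add: complex_norm_square fun_eq_iff algebra_simps del: of_real_power)
  finally show ?thesis .
qed

lemma ip_eqI: "a \<in> H2 lam \<Longrightarrow> b \<in> H2 lam \<Longrightarrow> ((\<lambda>p. a p * cnj (b p) * wt lam p) has_sum s) UNIV \<Longrightarrow> ip lam a b = s"
  using ip_has_sum has_sum_unique by blast

text \<open>Disjoint supports are orthogonal; in this form a nonzero pairing yields a common
  monomial whose exponents can be compared.\<close>

lemma ip_nonzeroE:
  assumes "a \<in> H2 lam" "b \<in> H2 lam" "ip lam a b \<noteq> 0"
  obtains p where "a p \<noteq> 0" "b p \<noteq> 0"
proof (rule ccontr)
  assume "\<not> thesis"
  hence "a p * cnj (b p) * wt lam p = 0" for p using that[of p] by (cases "a p = 0"; cases "b p = 0") simp_all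
  hence "(\<lambda>p. a p * cnj (b p) * complex_of_real (wt lam p)) = (\<lambda>p. 0)" by (rule ext)
  hence "ip lam a b = 0" by (intro ip_eqI assms(1,2)) (simp only: has_sum_0_simp)
  with assms(3) show False by simp
qed

text \<open>Outside the support of \<open>b\<close> the sequence \<open>a\<close> is unrestricted.
  This lets powers of \<open>T1 k\<close> produce further monomials that the pairing
  ignores.\<close>

lemma ip_scaled:
  assumes "a \<in> H2 lam" "b \<in> H2 lam" "\<And>p. b p \<noteq> 0 \<Longrightarrow> a p = c * b p"
  shows "ip lam a b = c * nrm2 lam b"
proof (intro ip_eqI assms(1,2))
  have "((\<lambda>p. c * complex_of_real ((cmod (b p))\<^sup>2 * wt lam p)) has_sum c * nrm2 lam b) UNIV"
    by (intro has_sum_cmult_right has_sum_of_real has_sum_nrm2 assms)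
  also have "(\<lambda>p. c * complex_of_real ((cmod (b p))\<^sup>2 * wt lam p)) = (\<lambda>p. a p * cnj (b p) * wt lam p)"
  proof
    fix p
    show "c * complex_of_real ((cmod (b p))\<^sup>2 * wt lam p) = a p * cnj (b p) * wt lam p"
      using assms(3)[of p] by (cases "b p = 0") (simp_all add: complex_norm_square mult_ac del: of_real_power)
  qed
  finally show "((\<lambda>p. a p * cnj (b p) * wt lam p) has_sum c * nrm2 lam b) UNIV" .
qed

lemma nrm2_eq_0: "a \<in> H2 lam \<Longrightarrow> nrm2 lam a = 0 \<Longrightarrow> a p = 0"
  using nonneg_infsum_le_0D[of "\<lambda>p. (cmod (a p))\<^sup>2 * wt lam p" UNIV p] wt_pos[of p]
  by (auto simp: nrm2_def H2_def wt_nonneg)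

lemma isotypic_H2: "f \<in> isotypic lam k r x y \<Longrightarrow> f \<in> H2 lam"
  by (simp add: isotypic_def)

text \<open>Raising one exponent by \<open>k\<close> preserves both residue conditions, and
  \<open>T1 k\<close> is symmetric in the two exponents, so the fixed ratio survives.\<close>

lemma isotypic_T1: "f \<in> isotypic lam k r x y \<Longrightarrow> T1 k f \<in> isotypic lam k r x y"
proof -
  assume f: "f \<in> isotypic lam k r x y"
  have c1: "res_class k r (m - k) n = res_class k r m n" "res_class k r n (m - k) = res_class k r n m" if "k \<le> m" for m n
    using res_class_add_left[of k r "m - k" n] res_class_add_right[of k r n "m - k"] that by simp_all
  have s: "res_class k r m n \<or> res_class k r n m" if "T1 k f (m, n) \<noteq> 0" for m n
  proof -
    have "(k \<le> m \<and> f (m - k, n) \<noteq> 0) \<or> (k \<le> n \<and> f (m, n - k) \<noteq> 0)"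
      using that by (auto simp: T1_def shift_def split: if_splits)
    thus ?thesis
    proof
      assume "k \<le> m \<and> f (m - k, n) \<noteq> 0"
      thus ?thesis using f c1[of m n] unfolding isotypic_def by blast
    next
      assume "k \<le> n \<and> f (m, n - k) \<noteq> 0"
      thus ?thesis using f c1[of n m] unfolding isotypic_def by blast
    qed
  qed
  have "y * T1 k f (m, n) = x * T1 k f (n, m)" if c: "res_class k r m n" for m n
  proof -
    have "k \<le> m \<Longrightarrow> y * f (m - k, n) = x * f (n, m - k)" using f c c1[of m n] by (auto simp: isotypic_def)
    moreover have "k \<le> n \<Longrightarrow> y * f (m, n - k) = x * f (n - k, m)" using f c c1[of n m] by (auto simp: isotypic_def)
    ultimately show ?thesis by (auto simp: T1_def shift_def distrib_left add_ac)
  qed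
  thus ?thesis using s f H2_T1[of f k] by (auto simp: isotypic_def)
qed

lemma isotypic_T2: "f \<in> isotypic lam k r x y \<Longrightarrow> T2 f \<in> isotypic lam k r x y"
proof -
  assume f: "f \<in> isotypic lam k r x y"
  have c1: "res_class k r (m - 1) (n - 1) = res_class k r m n" if "1 \<le> m" "1 \<le> n" for m n
    using that by (simp add: res_class_def of_nat_diff)
  have s: "res_class k r m n \<or> res_class k r n m" if "T2 f (m, n) \<noteq> 0" for m n
    using that f c1[of m n] c1[of n m] unfolding shift_def isotypic_def fst_conv snd_conv mem_Collect_eq
    by (metis (no_types, lifting))
  have "y * T2 f (m, n) = x * T2 f (n, m)" if c: "res_class k r m n" for m n
    using f c c1[of m n] unfolding shift_def isotypic_def fst_conv snd_conv mem_Collect_eq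
    by (simp split: if_splits)
  thus ?thesis using s f H2_shift[of f 1 1] by (auto simp: isotypic_def)
qed

lemma H2_orbit_mon: "orbit_mon x y m n \<in> H2 lam"
proof -
  have "((\<lambda>p. (cmod (orbit_mon x y m n p))\<^sup>2 * wt lam p) has_sum (\<Sum>p\<in>{(m,n),(n,m)}. (cmod (orbit_mon x y m n p))\<^sup>2 * wt lam p)) UNIV"
  proof (rule has_sum_finite_neutralI)
    fix p assume "p \<in> UNIV - {(m, n), (n, m)}"
    hence "orbit_mon x y m n p = 0" by (simp add: orbit_mon_def)
    thus "(cmod (orbit_mon x y m n p))\<^sup>2 * wt lam p = 0" by simp
  qed (simp, simp, rule refl)
  thus ?thesis unfolding H2_def mem_Collect_eq by (rule has_sum_imp_summable)
qed

lemma ip_orbit_mon: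
  assumes "f \<in> H2 lam"
  shows "ip lam f (orbit_mon x y m n) = (f (m, n) * cnj x + f (n, m) * cnj y) * wt lam (m, n)"
proof (rule ip_eqI[OF assms H2_orbit_mon])
  have d: "((\<lambda>p. if p = q then g p else 0) has_sum g q) UNIV" for g :: "nat \<times> nat \<Rightarrow> complex" and q
    by (rule has_sum_finite_neutralI[where B = "{q}"]) auto
  have "((\<lambda>p. (if p = (m, n) then f p * cnj x * wt lam p else 0) + (if p = (n, m) then f p * cnj y * wt lam p else 0)) has_sum
    (f (m, n) * cnj x * wt lam (m, n) + f (n, m) * cnj y * wt lam (n, m))) UNIV"
    by (intro has_sum_add d)
  also have "(\<lambda>p. (if p = (m, n) then f p * cnj x * wt lam p else 0) + (if p = (n, m) then f p * cnj y * wt lam p else 0))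
     = (\<lambda>p. f p * cnj (orbit_mon x y m n p) * wt lam p)"
  proof
    fix p
    have "(if A then u * cnj x * w else 0) + (if B then u * cnj y * w else 0)
      = u * cnj ((if A then x else 0) + (if B then y else 0)) * w" for A B and u w :: complex
      by (cases A; cases B; simp add: algebra_simps)
    thus "(if p = (m, n) then f p * cnj x * wt lam p else 0) + (if p = (n, m) then f p * cnj y * wt lam p else 0)
      = f p * cnj (orbit_mon x y m n p) * wt lam p" unfolding orbit_mon_def .
  qed
  also have "wt lam (n, m) = wt lam (m, n)" by (simp add: wt_def)
  finally show "((\<lambda>p. f p * cnj (orbit_mon x y m n p) * wt lam p) has_sum (f (m, n) * cnj x + f (n, m) * cnj y) * wt lam (m, n)) UNIV"
    by (simp add: algebra_simps)
qed

lemma ip_add_right: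
  assumes "f \<in> H2 lam" "g \<in> H2 lam" "h \<in> H2 lam"
  shows "ip lam f (\<lambda>p. g p + h p) = ip lam f g + ip lam f h"
  by (rule ip_eqI[OF assms(1) H2_add[OF assms(2,3)]])
     (use has_sum_add[OF ip_has_sum[OF assms(1,2)] ip_has_sum[OF assms(1,3)]] in \<open>simp add: algebra_simps\<close>)

lemma ip_T1_orbit_mon:
  "f \<in> H2 lam \<Longrightarrow> ip lam f (T1 k (orbit_mon x y m n)) = ip lam f (orbit_mon x y (m + k) n) + ip lam f (orbit_mon x y m (n + k))"
  unfolding T1_orbit_mon[abs_def] by (intro ip_add_right H2_orbit_mon)

lemma ip_T2_orbit_mon: "ip lam f (T2 (orbit_mon x y m n)) = ip lam f (orbit_mon x y (m + 1) (n + 1))"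
  unfolding T2_orbit_mon[abs_def] ..

end

section \<open>Wandering vectors and their pairings\<close>

locale dihedral_data = bergman +
  fixes k r :: nat and x y :: complex
  assumes k2: "2 \<le> k" and r2: "2 * r \<le> k"
    and xy: "x * cnj x + y * cnj y = 1"
    and special: "r = 0 \<or> 2 * r = k \<Longrightarrow> y = x \<or> y = -x"
begin

abbreviation "S \<equiv> isotypic lam k r x y"
abbreviation "J \<equiv> wander lam k S"

text \<open>The sum of the two congruences says that \<open>k\<close> divides \<open>2 * r\<close>,
  which lies between 0 and \<open>k\<close>.\<close>

lemma res_class_both: "res_class k r m n \<Longrightarrow> res_class k r n m \<Longrightarrow> r = 0 \<or> 2 * r = k"
proof -
  assume "res_class k r m n" "res_class k r n m"
  hence "int k dvd (int m - int n - int r) + (int n - int m - int r)" unfolding res_class_def by (rule dvd_add)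
  hence "int k dvd - (2 * int r)" by (simp add: algebra_simps)
  hence "int k dvd 2 * int r" by (simp only: dvd_minus_iff)
  hence "2 * int r = 0 \<or> int k \<le> 2 * int r" using zdvd_imp_le[of "int k" "2 * int r"] by linarith
  thus ?thesis using r2 by linarith
qed

text \<open>If both (m,n) and (n,m) satisfy the congruence, the ratio condition must hold at both,
  which amounts to x^2 = y^2; by \<open>res_class_both\<close> the assumption \<open>special\<close>
  then applies.\<close>

lemma orbit_mon_in_S: "res_class k r m n \<Longrightarrow> orbit_mon x y m n \<in> S"
proof -
  assume c: "res_class k r m n"
  have yx: "y * y = x * x" if "res_class k r n m" using special[OF res_class_both[OF c that]] by auto
  have "y * orbit_mon x y m n (m', n') = x * orbit_mon x y m n (n', m')" if "res_class k r m' n'" for m' n'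
  proof -
    have sw: "(n', m') = (m, n) \<longleftrightarrow> (m', n') = (n, m)" "(n', m') = (n, m) \<longleftrightarrow> (m', n') = (m, n)" by auto
    have "(m', n') = (n, m) \<longrightarrow> y * y = x * x" using that yx by auto
    thus ?thesis unfolding orbit_mon_def sw
      by (cases "(m', n') = (n, m)"; cases "(m', n') = (m, n)"; simp only: if_True if_False distrib_left mult.commute add_ac simp_thms add_0_left add_0_right mult_zero_right mult_zero_left)
  qed
  moreover have "res_class k r m' n' \<or> res_class k r n' m'" if "orbit_mon x y m n (m', n') \<noteq> 0" for m' n'
  proof -
    have "(m', n') = (m, n) \<or> (m', n') = (n, m)"
      by (rule ccontr) (use that in \<open>simp add: orbit_mon_def split: if_splits\<close>)
    thus ?thesis using c by auto
  qed
  ultimately show ?thesis using H2_orbit_mon[of x y m n] unfolding isotypic_def by blast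
qed

text \<open>The ratio condition makes \<open>(f (m, n), f (n, m))\<close> a multiple of the unit
  vector \<open>(x, y)\<close>, and \<open>z\<close> says that it is orthogonal to that
  vector.\<close>

lemma S_zero:
  assumes f: "f \<in> S" and c: "res_class k r m n" and z: "f (m, n) * cnj x + f (n, m) * cnj y = 0"
  shows "f (m, n) = 0" "f (n, m) = 0"
proof -
  have e: "y * f (m, n) = x * f (n, m)" using f c by (auto simp: isotypic_def)
  have "f (m, n) = f (m, n) * (x * cnj x + y * cnj y)" by (simp add: xy)
  also have "\<dots> = x * (f (m, n) * cnj x) + cnj y * (y * f (m, n))" by (simp add: algebra_simps)
  also have "\<dots> = x * (f (m, n) * cnj x + f (n, m) * cnj y)" unfolding e by (simp add: algebra_simps)
  finally show "f (m, n) = 0" unfolding z by simp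
  have "f (n, m) = f (n, m) * (x * cnj x + y * cnj y)" by (simp add: xy)
  also have "\<dots> = cnj x * (x * f (n, m)) + y * (f (n, m) * cnj y)" by (simp add: algebra_simps)
  also have "\<dots> = y * (f (m, n) * cnj x + f (n, m) * cnj y)" unfolding e[symmetric] by (simp add: algebra_simps)
  finally show "f (n, m) = 0" unfolding z by simp
qed

lemma S_ip_orbit_mon_zero:
  assumes "f \<in> S" "res_class k r m n" "ip lam f (orbit_mon x y m n) = 0"
  shows "f (m, n) = 0" "f (n, m) = 0"
  using S_zero[OF assms(1,2)] assms(3) wt_pos[of "(m,n)"] unfolding ip_orbit_mon[OF isotypic_H2[OF assms(1)]] by auto

text \<open>\<open>T2\<close> carries the orbit vector at (m,n) to the one at (m+1,n+1), so
  orthogonality to the range of \<open>T2\<close> removes all monomials off the axes.\<close>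

lemma wander_diag:
  assumes f: "f \<in> J"
  shows "f (Suc m, Suc n) = 0"
proof (rule ccontr)
  assume ne: "f (Suc m, Suc n) \<noteq> 0"
  have fS: "f \<in> S" using f by (simp add: wander_def)
  have "f (Suc m, Suc n) = 0 \<and> f (Suc n, Suc m) = 0" if c: "res_class k r m n" for m n
  proof -
    have "ip lam f (T2 (orbit_mon x y m n)) = 0" using f orbit_mon_in_S[OF c] by (simp add: wander_def)
    hence "ip lam f (orbit_mon x y (Suc m) (Suc n)) = 0" unfolding ip_T2_orbit_mon by simp
    moreover have "res_class k r (Suc m) (Suc n)" using c by (simp add: res_class_def)
    ultimately show ?thesis using S_ip_orbit_mon_zero[OF fS] by blast
  qed
  moreover have "res_class k r (Suc m) (Suc n) \<or> res_class k r (Suc n) (Suc m)"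
    using ne fS unfolding isotypic_def by blast
  hence "res_class k r m n \<or> res_class k r n m" by (simp add: res_class_def)
  ultimately show False using ne by blast
qed

text \<open>Applied to the orbit vector at (q-k,0), \<open>T1\<close> gives those at (q,0) and
  (q-k,k). The latter is off the axes because \<open>q > k\<close>, and there \<open>f\<close>
  vanishes already.\<close>

lemma wander_far:
  assumes f: "f \<in> J" and q: "k < q"
  shows "f (q, 0) = 0" "f (0, q) = 0"
proof -
  have fS: "f \<in> S" using f by (simp add: wander_def)
  have fH: "f \<in> H2 lam" using fS by (rule isotypic_H2)
  define m where "m = q - k"
  have m: "q = m + k" "0 < m" using q by (auto simp: m_def)
  have d: "f (m, k) = 0" "f (k, m) = 0"
    using wander_diag[OF f, of "m - 1" "k - 1"] wander_diag[OF f, of "k - 1" "m - 1"] m k2 by auto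
  have "f (q, 0) = 0 \<and> f (0, q) = 0"
  proof (cases "res_class k r q 0")
    case True
    hence c: "res_class k r m 0" by (simp add: m res_class_add_left)
    have "ip lam f (T1 k (orbit_mon x y m 0)) = 0" using f orbit_mon_in_S[OF c] by (simp add: wander_def)
    hence "ip lam f (orbit_mon x y q 0) = 0" unfolding ip_T1_orbit_mon[OF fH] using d by (simp add: ip_orbit_mon[OF fH] m)
    thus ?thesis using S_ip_orbit_mon_zero[OF fS True] by blast
  next
    case F: False
    show ?thesis
    proof (cases "res_class k r 0 q")
      case True
      hence c: "res_class k r 0 m" by (simp add: m res_class_add_right)
      have "ip lam f (T1 k (orbit_mon x y 0 m)) = 0" using f orbit_mon_in_S[OF c] by (simp add: wander_def)
      hence "ip lam f (orbit_mon x y 0 q) = 0" unfolding ip_T1_orbit_mon[OF fH] using d by (simp add: ip_orbit_mon[OF fH] m)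
      thus ?thesis using S_ip_orbit_mon_zero[OF fS True] by blast
    next
      case False
      thus ?thesis using F fS by (auto simp: isotypic_def)
    qed
  qed
  thus "f (q, 0) = 0" "f (0, q) = 0" by auto
qed

lemma res_class_axis_left: "q \<le> k \<Longrightarrow> res_class k r q 0 \<Longrightarrow> q = r \<or> r = 0 \<and> q = k"
proof (rule ccontr)
  assume q: "q \<le> k" "res_class k r q 0" and n: "\<not> (q = r \<or> r = 0 \<and> q = k)"
  have "int k \<le> \<bar>int q - int r\<bar>"
    using dvd_imp_le_int[of "int q - int r" "int k"] q n by (simp add: res_class_def)
  thus False using q(1) n r2 k2 by linarith
qed

lemma res_class_axis_right: "q \<le> k \<Longrightarrow> res_class k r 0 q \<Longrightarrow> q = k - r \<or> r = 0 \<and> q = 0"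
proof (rule ccontr)
  assume q: "q \<le> k" "res_class k r 0 q" and n: "\<not> (q = k - r \<or> r = 0 \<and> q = 0)"
  have "int k dvd - (int q + int r)" using q(2) by (simp add: res_class_def algebra_simps)
  hence d: "int k dvd int q + int r" by (simp only: dvd_minus_iff)
  hence "int k dvd int q + int r - int k" by simp
  hence "int k \<le> \<bar>int q + int r - int k\<bar>"
    using dvd_imp_le_int[of "int q + int r - int k" "int k"] n q(1) r2 by linarith
  thus False using q(1) n r2 k2 by linarith
qed

lemma x_nonzero: "r = 0 \<or> 2 * r = k \<Longrightarrow> x \<noteq> 0"
  using special xy by auto

text \<open>Monomials on the axes of degree at most \<open>k\<close> remain, and the congruence
  fixes their degree. For \<open>r = 0\<close> the degrees 0 and \<open>k\<close> compete: if
  \<open>y = x\<close>, orthogonality to \<open>T1\<close> of the constant removes degree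
  \<open>k\<close>; if \<open>y = -x\<close>, antisymmetry removes the constant.\<close>

lemma wander_support:
  assumes f: "f \<in> J" and ne: "f (m, n) \<noteq> 0"
  shows "m = 0 \<or> n = 0"
    and "if r = 0 then m + n = (if y = x then 0 else k) else m + n = r \<or> m + n = k - r"
proof -
  show a: "m = 0 \<or> n = 0" using wander_diag[OF f, of "m - 1" "n - 1"] ne by (cases m; cases n) auto
  have fS: "f \<in> S" using f by (simp add: wander_def)
  have fH: "f \<in> H2 lam" using fS by (rule isotypic_H2)
  have sym: "y * f (m, n) = x * f (n, m)" if "res_class k r m n" for m n using that fS by (auto simp: isotypic_def)
  have ax: "q \<le> k \<and> (res_class k r q 0 \<or> res_class k r 0 q)" if "f (q, 0) \<noteq> 0 \<or> f (0, q) \<noteq> 0" for q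
  proof
    show "q \<le> k" by (rule ccontr) (use that wander_far[OF f, of q] in \<open>auto simp: not_le\<close>)
    show "res_class k r q 0 \<or> res_class k r 0 q" using that fS unfolding isotypic_def by blast
  qed
  have ax2: "if r = 0 then q = 0 \<or> q = k else q = r \<or> q = k - r" if "f (q, 0) \<noteq> 0 \<or> f (0, q) \<noteq> 0" for q
    using ax[OF that] res_class_axis_left[of q] res_class_axis_right[of q] by auto
  define q where "q = m + n"
  have q: "f (q, 0) \<noteq> 0 \<or> f (0, q) \<noteq> 0" using a ne by (auto simp: q_def)
  show "if r = 0 then m + n = (if y = x then 0 else k) else m + n = r \<or> m + n = k - r"
  proof (cases "r = 0")
    case True
    have x0: "x \<noteq> 0" using x_nonzero True by simp
    have c00: "res_class k r 0 0" and ck0: "res_class k r k 0" using True by (auto simp: res_class_def)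
    show ?thesis
    proof (cases "y = x")
      case yx: True
      have "ip lam f (T1 k (orbit_mon x y 0 0)) = 0" using f orbit_mon_in_S[OF c00] by (simp add: wander_def)
      moreover have e: "f (k, 0) = f (0, k)" using sym[OF ck0] yx x0 by simp
      ultimately have "f (k, 0) = 0"
        unfolding ip_T1_orbit_mon[OF fH] using x0 wt_pos[of "(k,0)"] yx
        by (simp add: ip_orbit_mon[OF fH] wt_def)
      with e ax2[OF q] q True yx show ?thesis by (auto simp: q_def)
    next
      case False
      hence "y = - x" using special True by simp
      hence "f (0, 0) = 0" using sym[OF c00] x0 by simp
      with ax2[OF q] q True False show ?thesis by (auto simp: q_def)
    qed
  next
    case False
    thus ?thesis using ax2[OF q] by (simp add: q_def)
  qed
qed

text \<open>Both orthogonality relations are obtained from disjoint supports: everything in the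
  range of \<open>T2\<close> is off the axes.\<close>

lemma wanderI:
  assumes f: "f \<in> S"
    and ax: "\<And>m n. f (m, n) \<noteq> 0 \<Longrightarrow> m = 0 \<or> n = 0"
    and T: "\<And>g m n. g \<in> S \<Longrightarrow> f (m, n) \<noteq> 0 \<Longrightarrow> T1 k g (m, n) = 0"
  shows "f \<in> J"
  unfolding wander_def
proof (safe intro!: f)
  fix g assume g: "g \<in> S"
  show "ip lam f (T1 k g) = 0"
  proof (rule ccontr)
    assume ne: "ip lam f (T1 k g) \<noteq> 0"
    obtain p where "f p \<noteq> 0" "T1 k g p \<noteq> 0"
      by (rule ip_nonzeroE[OF isotypic_H2[OF f] isotypic_H2[OF isotypic_T1[OF g]] ne])
    thus False using T[OF g, of "fst p" "snd p"] by simp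
  qed
  show "ip lam f (T2 g) = 0"
  proof (rule ccontr)
    assume ne: "ip lam f (T2 g) \<noteq> 0"
    obtain p where "f p \<noteq> 0" "T2 g p \<noteq> 0"
      by (rule ip_nonzeroE[OF isotypic_H2[OF f] isotypic_H2[OF isotypic_T2[OF g]] ne])
    thus False using ax[of "fst p" "snd p"] by (auto simp: shift_def split: if_splits)
  qed
qed

lemma orbit_mon_nonzero: "orbit_mon x y m n (m', n') \<noteq> 0 \<Longrightarrow> m' = m \<and> n' = n \<or> m' = n \<and> n' = m"
  by (auto simp: orbit_mon_def split: if_splits)

text \<open>\<open>T1 k\<close> raises one exponent by \<open>k\<close>, so its range has no
  monomial with both exponents below \<open>k\<close>.\<close>

lemma orbit_mon_wander:
  assumes c: "res_class k r m n" and a: "m = 0 \<or> n = 0" and lt: "m < k" "n < k"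
  shows "orbit_mon x y m n \<in> J"
proof (rule wanderI[OF orbit_mon_in_S[OF c]])
  fix m' n' assume "orbit_mon x y m n (m', n') \<noteq> 0"
  from orbit_mon_nonzero[OF this] show "m' = 0 \<or> n' = 0" using a by auto
next
  fix g m' n' assume "orbit_mon x y m n (m', n') \<noteq> 0"
  from orbit_mon_nonzero[OF this] show "T1 k g (m', n') = 0" using lt by (auto simp: T1_def shift_def)
qed

lemma orbit_mon_wander_r: "orbit_mon x y r 0 \<in> J"
  by (rule orbit_mon_wander) (use r2 k2 in \<open>auto simp: res_class_def\<close>)

lemma orbit_mon_wander_kr: "r > 0 \<Longrightarrow> orbit_mon x y 0 (k - r) \<in> J"
proof (rule orbit_mon_wander)
  assume "r > 0"
  have "int 0 - int (k - r) - int r = - int k" using r2 k2 by linarith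
  thus "res_class k r 0 (k - r)" unfolding res_class_def by (simp only: dvd_minus_iff dvd_refl)
qed (use r2 k2 in auto)

text \<open>The range of \<open>T1 k\<close> reaches z1^k and z2^k only from the constant term,
  which is 0 for antisymmetric sequences.\<close>

lemma orbit_mon_wander_neg:
  assumes r: "r = 0" and yx: "y = - x"
  shows "orbit_mon x y k 0 \<in> J"
proof (rule wanderI[OF orbit_mon_in_S])
  show "res_class k r k 0" by (simp add: res_class_def r)
next
  fix m' n' assume "orbit_mon x y k 0 (m', n') \<noteq> 0"
  from orbit_mon_nonzero[OF this] show "m' = 0 \<or> n' = 0" by auto
next
  fix g m' n' assume g: "g \<in> S" and "orbit_mon x y k 0 (m', n') \<noteq> 0"
  hence mn: "m' = k \<and> n' = 0 \<or> m' = 0 \<and> n' = k" using orbit_mon_nonzero by blast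
  have "y * g (0, 0) = x * g (0, 0)" using g r by (auto simp: isotypic_def res_class_def)
  hence "g (0, 0) = 0" using x_nonzero r yx by simp
  thus "T1 k g (m', n') = 0" using mn k2 by (auto simp: T1_def shift_def)
qed

lemma wander_pairing_degree:
  assumes f: "f \<in> J" and g: "g \<in> J" and ne: "ip lam (T1 k f) ((T2 ^^ b) g) \<noteq> 0"
  shows "r > 0 \<and> (b = r \<or> b = k - r)"
proof -
  have H: "f \<in> H2 lam" "g \<in> H2 lam" using f g by (auto simp: wander_def intro: isotypic_H2)
  obtain p where p: "T1 k f p \<noteq> 0" "(T2 ^^ b) g p \<noteq> 0"
    by (rule ip_nonzeroE[OF H2_T1[OF H(1)] _ ne]) (use H2_shift[OF H(2)] in \<open>auto simp: funpow_T2'\<close>)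
  obtain m n where mn: "p = (m, n)" by force
  have b: "b \<le> m" "b \<le> n" "g (m - b, n - b) \<noteq> 0" using p(2) by (auto simp: funpow_T2' shift_def mn split: if_splits)
  note g' = wander_support[OF g b(3)]
  have "(k \<le> m \<and> f (m - k, n) \<noteq> 0) \<or> (k \<le> n \<and> f (m, n - k) \<noteq> 0)"
    using p(1) by (auto simp: T1_def shift_def mn split: if_splits)
  thus ?thesis
  proof
    assume "k \<le> m \<and> f (m - k, n) \<noteq> 0"
    with wander_support[OF f, of "m - k" n] g' b(1,2) r2 k2 show ?thesis
      by (auto split: if_splits)
  next
    assume "k \<le> n \<and> f (m, n - k) \<noteq> 0"
    with wander_support[OF f, of m "n - k"] g' b(1,2) r2 k2 show ?thesis
      by (auto split: if_splits)
  qed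
qed

text \<open>The wandering vectors at (r,0) and (0,k-r) both reach the orbit of z1^r z2^k, one under
  \<open>T1 k\<close>, the other under the \<open>r\<close>-th power of \<open>T2\<close>. The
  pairing is |x|^2 + |y|^2 = 1 times a weight, hence independent of \<open>(x, y)\<close>.\<close>

lemma wander_pairing_exists:
  assumes r: "r > 0"
  shows "\<exists>f\<in>J. \<exists>g\<in>J. ip lam (T1 k f) ((T2 ^^ r) g) \<noteq> 0"
proof (intro bexI)
  have "shift r r (orbit_mon x y 0 (k - r)) = orbit_mon x y r k"
    using r2 k2 by (simp add: fun_eq_iff shift_orbit_mon orbit_mon_def)
  moreover have "T1 k (orbit_mon x y r 0) (r, k) = x" "T1 k (orbit_mon x y r 0) (k, r) = y"
    using r r2 k2 by (auto simp: T1_orbit_mon orbit_mon_def)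
  ultimately have "ip lam (T1 k (orbit_mon x y r 0)) ((T2 ^^ r) (orbit_mon x y 0 (k - r))) = wt lam (r, k)"
    by (simp add: funpow_T2' ip_orbit_mon H2_T1 H2_orbit_mon xy)
  thus "ip lam (T1 k (orbit_mon x y r 0)) ((T2 ^^ r) (orbit_mon x y 0 (k - r))) \<noteq> 0"
    using wt_pos[of "(r,k)"] by simp
qed (use orbit_mon_wander_r orbit_mon_wander_kr r in auto)

lemma wander_nonzero: "\<exists>f\<in>J. \<exists>p. f p \<noteq> 0" if "r = 0 \<or> 2 * r = k"
proof (cases "r = 0 \<and> y = -x")
  case True
  hence "orbit_mon x y k 0 (k, 0) \<noteq> 0" using x_nonzero k2 by (auto simp: orbit_mon_def)
  thus ?thesis using orbit_mon_wander_neg True by blast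
next
  case False
  hence "orbit_mon x y r 0 (r, 0) \<noteq> 0" using x_nonzero that k2 special by (auto simp: orbit_mon_def)
  thus ?thesis using orbit_mon_wander_r by blast
qed

text \<open>At (k,r) the operator \<open>T1 k\<close> places \<open>f (0, r)\<close> and the power
  of \<open>T2\<close> places \<open>f (r, 0)\<close>; the ratio of these coefficients is the sign
  of the character.\<close>

lemma wander_half:
  assumes f: "f \<in> J" and r: "2 * r = k"
  shows "ip lam (T1 k f) ((T2 ^^ r) f) = (if y = x then 1 else -1) * complex_of_real (nrm2 lam ((T2 ^^ r) f))"
proof (rule ip_scaled)
  have fS: "f \<in> S" using f by (simp add: wander_def)
  have H: "f \<in> H2 lam" using fS by (rule isotypic_H2)
  show "T1 k f \<in> H2 lam" "(T2 ^^ r) f \<in> H2 lam" using H by (auto simp: funpow_T2' intro: H2_T1 H2_shift)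
  fix p assume p: "(T2 ^^ r) f p \<noteq> 0"
  obtain m n where mn: "p = (m, n)" by force
  have r0: "r > 0" using r k2 by simp
  have b: "r \<le> m" "r \<le> n" "f (m - r, n - r) \<noteq> 0" using p by (auto simp: funpow_T2' shift_def mn split: if_splits)
  have "y * f (r, 0) = x * f (0, r)" using fS by (auto simp: isotypic_def res_class_def)
  moreover have "y = (if y = x then 1 else -1) * x" using special r by auto
  ultimately have "x * f (0, r) = x * ((if y = x then 1 else -1) * f (r, 0))"
    by (metis mult.assoc mult.commute)
  hence e: "f (0, r) = (if y = x then 1 else -1) * f (r, 0)" using x_nonzero r by (subst (asm) mult_left_cancel) auto
  have "(m = k \<and> n = r) \<or> (m = r \<and> n = k)"
    using wander_support[OF f b(3)] b(1,2) r0 r by (auto split: if_splits)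
  thus "T1 k f p = (if y = x then 1 else -1) * (T2 ^^ r) f p"
    using e r0 r by (auto simp: mn funpow_T2' T1_def shift_def)
qed

text \<open>The factor 2 is the coefficient of z1^k z2^k in the square of phi_1. For
  \<open>y = -x\<close> the coefficient at (2k,k) is \<open>2 * f (k, 0) + f (0, k)\<close>, and
  antisymmetry reduces it to \<open>f (k, 0)\<close>.\<close>

lemma wander_zero:
  assumes f: "f \<in> J" and r: "r = 0"
  shows "ip lam (T1 k (T1 k f)) ((T2 ^^ k) f) = (if y = x then 2 else 1) * complex_of_real (nrm2 lam ((T2 ^^ k) f))"
proof (rule ip_scaled)
  have fS: "f \<in> S" using f by (simp add: wander_def)
  have H: "f \<in> H2 lam" using fS by (rule isotypic_H2)
  show "T1 k (T1 k f) \<in> H2 lam" "(T2 ^^ k) f \<in> H2 lam" using H by (auto simp: funpow_T2' intro: H2_T1 H2_shift)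
  fix p assume p: "(T2 ^^ k) f p \<noteq> 0"
  obtain m n where mn: "p = (m, n)" by force
  have b: "k \<le> m" "k \<le> n" "f (m - k, n - k) \<noteq> 0" using p by (auto simp: funpow_T2' shift_def mn split: if_splits)
  show "T1 k (T1 k f) p = (if y = x then 2 else 1) * (T2 ^^ k) f p"
  proof (cases "y = x")
    case True
    hence "m = k \<and> n = k" using wander_support(2)[OF f b(3)] b r by auto
    thus ?thesis using True k2 by (simp add: mn funpow_T2' T1_def shift_def)
  next
    case False
    hence yx: "y = - x" using special r by simp
    have "y * f (k, 0) = x * f (0, k)" using fS r by (auto simp: isotypic_def res_class_def)
    hence "x * f (0, k) = x * (- f (k, 0))" using yx by simp
    hence e: "f (0, k) = - f (k, 0)" using x_nonzero r by (subst (asm) mult_left_cancel) auto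
    have "(m = 2 * k \<and> n = k) \<or> (m = k \<and> n = 2 * k)"
      using wander_support[OF f b(3)] b(1,2) r False by auto
    thus ?thesis using False e k2 by (auto simp: mn funpow_T2' T1_def shift_def)
  qed
qed

end

section \<open>Recovering the residue and the sign from a unitary intertwiner\<close>

context bergman
begin

lemma intertwines_linear:
  assumes "intertwines lam k V S S'" "a \<in> S" "b \<in> S"
  shows "V (\<lambda>p. c * a p + d * b p) = (\<lambda>p. c * V a p + d * V b p)"
proof -
  have "\<forall>a\<in>S. \<forall>b\<in>S. \<forall>c d. V (\<lambda>p. c * a p + d * b p) = (\<lambda>p. c * V a p + d * V b p)"
    using assms(1) unfolding intertwines_def by (elim conjE)
  from this[rule_format, OF assms(2,3)] show ?thesis .
qed

text \<open>The literal factors \<open>1\<close> and \<open>c\<close> in the definition of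
  \<open>ip\<close> make each of its four terms the norm of a combination to which linearity of
  \<open>V\<close> applies verbatim.\<close>

lemma intertwines_ip:
  assumes V: "intertwines lam k V S S'" and a: "a \<in> S" "b \<in> S"
    and lin: "\<And>c. (\<lambda>p. 1 * a p + c * b p) \<in> S"
  shows "ip lam (V a) (V b) = ip lam a b"
proof -
  have "nrm2 lam (\<lambda>p. 1 * V a p + c * V b p) = nrm2 lam (\<lambda>p. 1 * a p + c * b p)" for c
  proof -
    have "(\<lambda>p. 1 * V a p + c * V b p) = V (\<lambda>p. 1 * a p + c * b p)"
      by (rule intertwines_linear[OF V a, symmetric])
    thus ?thesis using V lin[of c] unfolding intertwines_def by simp
  qed
  thus ?thesis unfolding ip_def by presburger
qed

lemma isotypic_lincomb: "a \<in> isotypic lam k r x y \<Longrightarrow> b \<in> isotypic lam k r x y \<Longrightarrow> (\<lambda>p. c * a p + d * b p) \<in> isotypic lam k r x y"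
proof -
  assume a: "a \<in> isotypic lam k r x y" and b: "b \<in> isotypic lam k r x y"
  have "res_class k r m n \<or> res_class k r n m" if "c * a (m, n) + d * b (m, n) \<noteq> 0" for m n
  proof -
    have "a (m, n) \<noteq> 0 \<or> b (m, n) \<noteq> 0" using that by auto
    thus ?thesis using a b unfolding isotypic_def by blast
  qed
  moreover have "y * (c * a (m, n) + d * b (m, n)) = x * (c * a (n, m) + d * b (n, m))" if "res_class k r m n" for m n
  proof -
    have "y * a (m, n) = x * a (n, m)" "y * b (m, n) = x * b (n, m)" using that a b by (auto simp: isotypic_def)
    thus ?thesis by (simp add: distrib_left mult.left_commute[of y] mult.left_commute[of x])
  qed
  ultimately show ?thesis using a b H2_add[OF H2_scale[of a c] H2_scale[of b d]] by (simp add: isotypic_def)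
qed

text \<open>\<open>intertwines_pairing\<close> passes from \<open>r > 0\<close> to
  \<open>r' > 0\<close> only; the inverse intertwiner supplies the converse.\<close>

lemma intertwines_sym:
  assumes V: "intertwines lam k V S S'"
    and lin: "\<And>a b c d. a \<in> S \<Longrightarrow> b \<in> S \<Longrightarrow> (\<lambda>p. c * a p + d * b p) \<in> S"
    and T: "\<And>a. a \<in> S \<Longrightarrow> T1 k a \<in> S \<and> T2 a \<in> S"
  shows "intertwines lam k (inv_into S V) S' S"
proof -
  let ?W = "inv_into S V"
  have bij: "bij_betw V S S'" using V by (simp add: intertwines_def)
  have W: "?W a \<in> S" "V (?W a) = a" if "a \<in> S'" for a
    using that bij by (auto simp: bij_betw_def f_inv_into_f inv_into_into)
  have WV: "?W (V a) = a" if "a \<in> S" for a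
    using that bij by (simp add: bij_betw_def)
  have 1: "?W (\<lambda>p. c * a p + d * b p) = (\<lambda>p. c * ?W a p + d * ?W b p)" if "a \<in> S'" "b \<in> S'" for a b c d
  proof -
    have "V (\<lambda>p. c * ?W a p + d * ?W b p) = (\<lambda>p. c * V (?W a) p + d * V (?W b) p)"
      by (rule intertwines_linear[OF V W(1)[OF that(1)] W(1)[OF that(2)]])
    also have "\<dots> = (\<lambda>p. c * a p + d * b p)" by (simp add: W(2)[OF that(1)] W(2)[OF that(2)])
    finally have e: "V (\<lambda>p. c * ?W a p + d * ?W b p) = (\<lambda>p. c * a p + d * b p)" .
    show ?thesis using WV[OF lin[OF W(1)[OF that(1)] W(1)[OF that(2)], of c d]] unfolding e .
  qed
  have 2: "nrm2 lam (?W a) = nrm2 lam a" "?W (T1 k a) = T1 k (?W a)" "?W (T2 a) = T2 (?W a)" if "a \<in> S'" for a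
  proof -
    note w = W[OF that]
    have v: "nrm2 lam (V (?W a)) = nrm2 lam (?W a)" "V (T1 k (?W a)) = T1 k (V (?W a))" "V (T2 (?W a)) = T2 (V (?W a))"
      using V w(1) unfolding intertwines_def by blast+
    show "nrm2 lam (?W a) = nrm2 lam a" using v(1) w(2) by simp
    show "?W (T1 k a) = T1 k (?W a)"
      using WV[of "T1 k (?W a)"] T[OF w(1)] unfolding v(2) w(2) by (elim conjE)
    show "?W (T2 a) = T2 (?W a)"
      using WV[of "T2 (?W a)"] T[OF w(1)] unfolding v(3) w(2) by (elim conjE)
  qed
  show ?thesis
    unfolding intertwines_def using bij_betw_inv_into[OF bij] 1 2 by blast
qed

lemma intertwines_wander:
  assumes V: "intertwines lam k V S S'" and W: "\<And>a b. a \<in> S \<Longrightarrow> b \<in> S \<Longrightarrow> ip lam (V a) (V b) = ip lam a b"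
    and T: "\<And>a. a \<in> S \<Longrightarrow> T1 k a \<in> S \<and> T2 a \<in> S"
    and f: "f \<in> wander lam k S"
  shows "V f \<in> wander lam k S'"
proof -
  have fS: "f \<in> S" using f by (simp add: wander_def)
  have bij: "bij_betw V S S'" using V by (simp add: intertwines_def)
  have "ip lam (V f) (T1 k g') = 0 \<and> ip lam (V f) (T2 g') = 0" if g': "g' \<in> S'" for g'
  proof -
    obtain g where g: "g \<in> S" "g' = V g" using bij g' unfolding bij_betw_def by blast
    have v: "V (T1 k g) = T1 k g'" "V (T2 g) = T2 g'" using V g unfolding intertwines_def by blast+
    show ?thesis using W[OF fS, of "T1 k g"] W[OF fS, of "T2 g"] T[OF g(1)] f g(1) v by (simp add: wander_def)
  qed
  thus ?thesis using bij fS by (auto simp: wander_def bij_betw_def)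
qed

lemma intertwines_funpow:
  assumes V: "intertwines lam k V S S'" and T: "\<And>a. a \<in> S \<Longrightarrow> T1 k a \<in> S \<and> T2 a \<in> S" and a: "a \<in> S"
  shows "(T2 ^^ b) a \<in> S \<and> V ((T2 ^^ b) a) = (T2 ^^ b) (V a)"
proof (induction b)
  case (Suc b)
  have "V (T2 ((T2 ^^ b) a)) = T2 (V ((T2 ^^ b) a))" using V Suc unfolding intertwines_def by blast
  thus ?case using Suc T[of "(T2 ^^ b) a"] unfolding funpow.simps comp_def by (elim conjE) simp
qed (use a in simp)

lemma intertwines_pairing:
  assumes D: "dihedral_data lam k r x y" and D': "dihedral_data lam k r' x' y'"
    and V: "intertwines lam k V (isotypic lam k r x y) (isotypic lam k r' x' y')" and r: "r > 0"
  shows "r' > 0 \<and> (r = r' \<or> r = k - r')"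
proof -
  interpret A: dihedral_data lam k r x y by fact
  interpret B: dihedral_data lam k r' x' y' by fact
  have T: "a \<in> A.S \<Longrightarrow> T1 k a \<in> A.S \<and> T2 a \<in> A.S" for a using isotypic_T1 isotypic_T2 by blast
  have P: "ip lam (V a) (V b) = ip lam a b" if "a \<in> A.S" "b \<in> A.S" for a b
    by (rule intertwines_ip[OF V that isotypic_lincomb[OF that]])
  obtain f g where fg: "f \<in> A.J" "g \<in> A.J" "ip lam (T1 k f) ((T2 ^^ r) g) \<noteq> 0"
    using A.wander_pairing_exists[OF r] by blast
  have S: "f \<in> A.S" "g \<in> A.S" using fg by (auto simp: wander_def)
  have V1: "V (T1 k f) = T1 k (V f)" using V S(1) unfolding intertwines_def by blast
  note V2 = intertwines_funpow[OF V T S(2), of r]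
  have "ip lam (T1 k (V f)) ((T2 ^^ r) (V g)) = ip lam (T1 k f) ((T2 ^^ r) g)"
    using P[of "T1 k f" "(T2 ^^ r) g"] V1 V2 T[OF S(1)] by (elim conjE) (simp del: One_nat_def)
  hence "ip lam (T1 k (V f)) ((T2 ^^ r) (V g)) \<noteq> 0" using fg(3) by simp
  from B.wander_pairing_degree[OF _ _ this] show ?thesis
    using intertwines_wander[OF V P T] fg(1,2) by blast
qed

lemma intertwines_data_eq:
  assumes D: "dihedral_data lam k r x y" and D': "dihedral_data lam k r' x' y'"
    and V: "intertwines lam k V (isotypic lam k r x y) (isotypic lam k r' x' y')"
  shows "r = r'" and "r = 0 \<or> 2 * r = k \<Longrightarrow> y = x \<longleftrightarrow> y' = x'"
proof -
  interpret A: dihedral_data lam k r x y by fact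
  interpret B: dihedral_data lam k r' x' y' by fact
  have T: "a \<in> A.S \<Longrightarrow> T1 k a \<in> A.S \<and> T2 a \<in> A.S" for a using isotypic_T1 isotypic_T2 by blast
  have P: "ip lam (V a) (V b) = ip lam a b" if "a \<in> A.S" "b \<in> A.S" for a b
    by (rule intertwines_ip[OF V that isotypic_lincomb[OF that]])
  have W: "intertwines lam k (inv_into A.S V) B.S A.S"
    using intertwines_sym[OF V isotypic_lincomb T] .
  \<comment> \<open>If \<open>r = k - r'\<close>, the bounds \<open>2 * r \<le> k\<close> and
    \<open>2 * r' \<le> k\<close> force both to be half of \<open>k\<close>. If one of them is 0, so
    is the other, by one of the two directions.\<close>
  show rr: "r = r'"
    using intertwines_pairing[OF D D' V] intertwines_pairing[OF D' D W] A.r2 B.r2 by linarith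
  assume r: "r = 0 \<or> 2 * r = k"
  obtain f p where f: "f \<in> A.J" "f p \<noteq> 0" using A.wander_nonzero[OF r] by blast
  have S: "f \<in> A.S" using f by (simp add: wander_def)
  have VJ: "V f \<in> B.J" by (rule intertwines_wander[OF V P T f(1)])
  have V1: "V (T1 k f) = T1 k (V f)" "V (T1 k (T1 k f)) = T1 k (T1 k (V f))"
    using V S T[OF S] unfolding intertwines_def by simp_all
  have N: "nrm2 lam (V ((T2 ^^ b) f)) = nrm2 lam ((T2 ^^ b) f)" for b
    using V intertwines_funpow[OF V T S, of b] unfolding intertwines_def by blast
  \<comment> \<open>Powers of \<open>T2\<close> are injective shifts, so this common factor can be
    cancelled when the two pairings are compared.\<close>
  have N0: "nrm2 lam ((T2 ^^ b) f) \<noteq> 0" for b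
  proof
    assume "nrm2 lam ((T2 ^^ b) f) = 0"
    hence "(T2 ^^ b) f (fst p + b, snd p + b) = 0"
      using intertwines_funpow[OF V T S, of b] by (intro nrm2_eq_0 isotypic_H2[of _ k r x y]) blast+
    thus False using f(2) by (simp add: funpow_T2' shift_def)
  qed
  note V2 = intertwines_funpow[OF V T S]
  show "y = x \<longleftrightarrow> y' = x'"
  proof (cases "r = 0")
    case True
    have "ip lam (T1 k (T1 k (V f))) ((T2 ^^ k) (V f)) = ip lam (T1 k (T1 k f)) ((T2 ^^ k) f)"
      using P[of "T1 k (T1 k f)" "(T2 ^^ k) f"] V1(2) V2[of k] T[OF conjunct1[OF T[OF S]]]
      by (elim conjE) (simp del: One_nat_def)
    hence "(if y' = x' then 2 else 1) * complex_of_real (nrm2 lam ((T2 ^^ k) f))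
       = (if y = x then 2 else 1) * complex_of_real (nrm2 lam ((T2 ^^ k) f))"
      using A.wander_zero[OF f(1) True] B.wander_zero[OF VJ] True rr N[of k] V2[of k] by (simp del: One_nat_def)
    hence "(if y' = x' then 2 else 1) = (if y = x then 2 else (1 :: complex))"
      using N0[of k] by (simp only: mult_right_cancel of_real_eq_0_iff not_False_eq_True)
    thus ?thesis by (simp split: if_splits)
  next
    case False
    hence k: "2 * r = k" using r by simp
    have "ip lam (T1 k (V f)) ((T2 ^^ r) (V f)) = ip lam (T1 k f) ((T2 ^^ r) f)"
      using P[of "T1 k f" "(T2 ^^ r) f"] V1(1) V2[of r] T[OF S]
      by (elim conjE) (simp del: One_nat_def)
    hence "(if y' = x' then 1 else -1) * complex_of_real (nrm2 lam ((T2 ^^ r) f))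
       = (if y = x then 1 else -1) * complex_of_real (nrm2 lam ((T2 ^^ r) f))"
      using A.wander_half[OF f(1) k] B.wander_half[OF VJ] k rr N[of r] V2[of r] by (simp del: One_nat_def)
    hence "(if y' = x' then 1 else -1) = (if y = x then 1 else (-1 :: complex))"
      using N0[of r] by (simp only: mult_right_cancel of_real_eq_0_iff not_False_eq_True)
    thus ?thesis by (simp split: if_splits)
  qed
qed

end

section \<open>Irreducible unitary representations of the dihedral group\<close>

definition herm :: "nat \<Rightarrow> (nat \<Rightarrow> complex) \<Rightarrow> (nat \<Rightarrow> complex) \<Rightarrow> complex" where
  "herm d u v = (\<Sum>l<d. u l * cnj (v l))"

lemma herm_self_eq_0:
  assumes "herm d v v = 0" "l < d"
  shows "v l = 0"
proof -
  have "complex_of_real (\<Sum>l<d. (cmod (v l))\<^sup>2) = 0"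
    using assms(1) by (simp add: herm_def complex_norm_square del: of_real_power)
  hence "(\<Sum>l<d. (cmod (v l))\<^sup>2) = 0" by (simp only: of_real_eq_0_iff)
  hence "\<forall>l\<in>{..<d}. (cmod (v l))\<^sup>2 = 0" by (subst (asm) sum_nonneg_eq_0_iff) auto
  thus ?thesis using assms(2) by auto
qed

lemma vecs_nonzero: "v \<in> vecs d \<Longrightarrow> v \<noteq> (\<lambda>_. 0) \<Longrightarrow> \<exists>l<d. v l \<noteq> 0"
  by (auto simp: vecs_def fun_eq_iff) (metis not_le)

lemma matvec_vecs: "matvec d A v \<in> vecs d"
  by (simp add: matvec_def vecs_def)

lemma matvec_scale: "matvec d A (\<lambda>i. c * v i) = (\<lambda>i. c * matvec d A v i)"
  by (simp add: matvec_def fun_eq_iff sum_distrib_left mult.left_commute)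

lemma matvec_add: "matvec d A (\<lambda>i. u i + v i) = (\<lambda>i. matvec d A u i + matvec d A v i)"
  by (simp add: matvec_def fun_eq_iff distrib_left sum.distrib)

lemma matvec_lincomb:
  "matvec d A (\<lambda>i. a * u i + b * v i) = (\<lambda>i. a * matvec d A u i + b * matvec d A v i)"
  by (simp only: matvec_add matvec_scale)

lemma matvec_sum: "matvec d A (\<lambda>i. \<Sum>j\<in>I. c j * v j i) = (\<lambda>i. \<Sum>j\<in>I. c j * matvec d A (v j) i)"
proof -
  have "(\<Sum>l<d. A i l * (\<Sum>j\<in>I. c j * v j l)) = (\<Sum>j\<in>I. c j * (\<Sum>l<d. A i l * v j l))" for i
    by (simp add: sum_distrib_left mult.left_commute) (rule sum.swap)
  thus ?thesis by (simp add: matvec_def fun_eq_iff)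
qed

lemma matvec_matmul:
  assumes "\<forall>i<d. \<forall>j<d. C i j = matmul d A B i j"
  shows "matvec d C v = matvec d A (matvec d B v)"
proof
  fix i
  show "matvec d C v i = matvec d A (matvec d B v) i"
  proof (cases "i < d")
    case True
    have "(\<Sum>l<d. C i l * v l) = (\<Sum>l<d. \<Sum>m<d. A i m * B m l * v l)"
      using assms True by (simp add: matmul_def sum_distrib_right)
    also have "\<dots> = (\<Sum>m<d. \<Sum>l<d. A i m * B m l * v l)" by (rule sum.swap)
    finally show ?thesis using True by (simp add: matvec_def sum_distrib_left mult.assoc)
  qed (simp add: matvec_def)
qed

locale irrep =
  fixes k d :: nat and \<pi> :: "grp \<Rightarrow> nat \<Rightarrow> nat \<Rightarrow> complex"
  assumes k2: "2 \<le> k" and irr: "irreducible_rep k d \<pi>"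
begin

abbreviation act :: "grp \<Rightarrow> (nat \<Rightarrow> complex) \<Rightarrow> nat \<Rightarrow> complex" where
  "act g \<equiv> matvec d (\<pi> g)"

definition unit_vec :: "nat \<Rightarrow> nat \<Rightarrow> complex" where
  "unit_vec i l = (if l = i then 1 else 0)"

lemma unit_vec_vecs: "i < d \<Longrightarrow> unit_vec i \<in> vecs d"
  by (simp add: unit_vec_def vecs_def)

lemma d1: "1 \<le> d" and urep: "unitary_rep k d \<pi>"
  using irr by (auto simp: irreducible_rep_def)

lemma act_unit_vec: "i < d \<Longrightarrow> l < d \<Longrightarrow> act g (unit_vec i) l = \<pi> g l i"
  by (simp add: matvec_def unit_vec_def if_distrib[of "\<lambda>x. _ * x"] cong: if_cong)

lemma act_gmult: "g \<in> Dgrp k \<Longrightarrow> h \<in> Dgrp k \<Longrightarrow> act (gmult k g h) v = act g (act h v)"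
  using urep by (intro matvec_matmul) (auto simp: unitary_rep_def)

lemma herm_act:
  assumes "g \<in> Dgrp k"
  shows "herm d (act g u) (act g v) = herm d u v"
proof -
  have U: "(\<Sum>l<d. cnj (\<pi> g l i) * \<pi> g l j) = (if i = j then 1 else 0)" if "i < d" "j < d" for i j
    using urep assms that unfolding unitary_rep_def by blast
  have "herm d (act g u) (act g v) = (\<Sum>l<d. \<Sum>j<d. \<Sum>i<d. u j * cnj (v i) * (cnj (\<pi> g l i) * \<pi> g l j))"
    unfolding herm_def by (rule sum.cong) (simp_all add: matvec_def sum_product mult_ac)
  also have "\<dots> = (\<Sum>j<d. \<Sum>i<d. u j * cnj (v i) * (\<Sum>l<d. cnj (\<pi> g l i) * \<pi> g l j))"
    unfolding sum_distrib_left by (subst sum.swap, rule sum.cong[OF refl], rule sum.swap)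
  also have "\<dots> = (\<Sum>j<d. \<Sum>i<d. if i = j then u j * cnj (v j) else 0)"
    by (intro sum.cong refl) (simp add: U)
  also have "\<dots> = herm d u v" by (simp add: herm_def)
  finally show ?thesis .
qed

text \<open>\<open>unitary_rep\<close> does not list that the identity acts trivially. Its action is
  idempotent, so it kills \<open>act (0, False) v - v\<close>, and being isometric it has no
  kernel.\<close>

lemma act_one:
  assumes v: "v \<in> vecs d"
  shows "act (0, False) v = v"
proof -
  let ?e = "(0, False) :: grp"
  have e: "?e \<in> Dgrp k" using k2 by (simp add: Dgrp_def)
  have "gmult k ?e ?e = ?e" using k2 by (simp add: gmult_def)
  hence ee: "act ?e (act ?e v) = act ?e v" using act_gmult[OF e e, of v] by simp
  let ?u = "\<lambda>i. 1 * act ?e v i + (-1) * v i"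
  have "act ?e ?u = (\<lambda>_. 0)" unfolding matvec_lincomb ee by simp
  hence "herm d ?u ?u = 0" using herm_act[OF e, of ?u ?u] by (simp add: herm_def)
  hence "?u l = 0" if "l < d" for l using herm_self_eq_0[of d ?u l] that by simp
  moreover have "?u l = 0" if "\<not> l < d" for l using v that by (simp add: vecs_def matvec_def)
  ultimately have "?u l = 0" for l by blast
  thus ?thesis by (auto simp: fun_eq_iff)
qed

lemma act_rot: "i < k \<Longrightarrow> j < k \<Longrightarrow> act (i, False) (act (j, False) v) = act ((i + j) mod k, False) v"
  using act_gmult[of "(i, False)" "(j, False)" v] by (simp add: Dgrp_def gmult_def)

lemma act_refl: "j < k \<Longrightarrow> act (j, True) v = act (j, False) (act (0, True) v)"
  using act_gmult[of "(j, False)" "(0, True)" v] k2 by (simp add: Dgrp_def gmult_def)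

text \<open>The relation delta^j sigma = sigma delta^(-j), with \<open>(k - j) mod k\<close> as the
  representative of -j.\<close>

lemma act_refl': "j < k \<Longrightarrow> act (j, True) v = act (0, True) (act ((k - j) mod k, False) v)"
proof -
  assume j: "j < k"
  have "(0 + (k - (k - j) mod k)) mod k = j" using j k2 by (cases "j = 0") auto
  thus ?thesis using act_gmult[of "(0, True)" "((k - j) mod k, False)" v] k2 by (simp add: Dgrp_def gmult_def)
qed

lemma act_refl_twice: "v \<in> vecs d \<Longrightarrow> act (0, True) (act (0, True) v) = v"
  using act_gmult[of "(0, True)" "(0, True)" v] act_one[of v] k2 by (simp add: Dgrp_def gmult_def)

lemma xi_pow_k: "(xi k ^ r) ^ k = 1"
proof -
  have "xi k ^ k = 1" using xi_power_k[of k] k2 by simp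
  thus ?thesis by (metis power_commutes power_mult mult.commute power_one)
qed

text \<open>The sums \<open>v t\<close> are \<open>k\<close> times the projections of a fixed nonzero vector to the eigenspaces of
  \<open>\<delta>\<close>; they cannot all vanish because they add up to a multiple of it.\<close>

lemma eigenvector_exists:
  "\<exists>t v. t < k \<and> v \<in> vecs d \<and> v \<noteq> (\<lambda>_. 0) \<and> (\<forall>j<k. act (j, False) v = (\<lambda>i. (xi k ^ t) ^ j * v i))"
proof -
  define h where "h t j = (\<lambda>i. inverse (xi k ^ t) ^ j * act (j mod k, False) (unit_vec 0) i)" for t j
  define v where "v t = (\<lambda>i. \<Sum>j<k. inverse (xi k ^ t) ^ j * act (j mod k, False) (unit_vec 0) i)" for t
  have v1: "act (1, False) (v t) = (\<lambda>i. xi k ^ t * v t i)" for t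
  proof
    fix i
    have "act (1, False) (v t) i = (\<Sum>j<k. inverse (xi k ^ t) ^ j * act (1, False) (act (j mod k, False) (unit_vec 0)) i)"
      unfolding v_def matvec_sum ..
    also have "\<dots> = (\<Sum>j<k. xi k ^ t * h t (Suc j) i)"
    proof (rule sum.cong[OF refl])
      fix j assume "j \<in> {..<k}"
      thus "inverse (xi k ^ t) ^ j * act (1, False) (act (j mod k, False) (unit_vec 0)) i = xi k ^ t * h t (Suc j) i"
        using act_rot[of 1 j] k2 by (simp add: h_def)
    qed
    also have "\<dots> = xi k ^ t * (\<Sum>j<k. h t (Suc j) i)" by (simp add: sum_distrib_left)
    \<comment> \<open>The index shift is cyclic: the terms for \<open>k\<close> and 0 coincide
      because xi^(t k) = 1.\<close>
    also have "(\<Sum>j<k. h t (Suc j) i) = (\<Sum>j<k. h t j i) + h t k i - h t 0 i"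
      using sum.lessThan_Suc_shift[of "\<lambda>j. h t j i" k] by simp
    also have "h t k i = h t 0 i" using xi_pow_k[of t] by (simp add: h_def power_inverse)
    finally show "act (1, False) (v t) i = xi k ^ t * v t i" by (simp add: v_def h_def)
  qed
  have vv: "v t \<in> vecs d" for t by (simp add: v_def vecs_def matvec_def)
  have vj: "act (j, False) (v t) = (\<lambda>i. (xi k ^ t) ^ j * v t i)" if "j < k" for j t
    using that
  proof (induction j)
    case 0
    thus ?case using act_one[OF vv] by simp
  next
    case (Suc j)
    have "act (Suc j, False) (v t) = act (1, False) (act (j, False) (v t))"
      using act_rot[of 1 j "v t"] Suc.prems k2 by simp
    also have "\<dots> = (\<lambda>i. (xi k ^ t) ^ j * (xi k ^ t * v t i))"
      using Suc by (simp add: matvec_scale v1[unfolded One_nat_def])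
    finally show ?case by (simp add: mult_ac)
  qed
  have "(\<Sum>t<k. v t 0) = (\<Sum>j<k. (\<Sum>t<k. (xi k powi (- int j)) ^ t) * act (j mod k, False) (unit_vec 0) 0)"
  proof -
    have "inverse (xi k ^ t) ^ j = (xi k powi (- int j)) ^ t" for t j
      by (simp add: power_int_minus power_inverse power_mult[symmetric] mult.commute)
    thus ?thesis unfolding v_def by (subst sum.swap) (simp add: sum_distrib_right)
  qed
  also have "\<dots> = (\<Sum>j<k. if j = 0 then of_nat k * act (0, False) (unit_vec 0) 0 else 0)"
  proof (rule sum.cong[OF refl])
    fix j assume j: "j \<in> {..<k}"
    have "int k dvd - int j \<longleftrightarrow> j = 0" using j by (auto dest: nat_dvd_not_less)
    thus "(\<Sum>t<k. (xi k powi (- int j)) ^ t) * act (j mod k, False) (unit_vec 0) 0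
       = (if j = 0 then of_nat k * act (0, False) (unit_vec 0) 0 else 0)"
      using xi_sum[of k "- int j"] k2 by simp
  qed
  also have "\<dots> = of_nat k" using k2 act_one[OF unit_vec_vecs[of 0]] d1 by (simp add: unit_vec_def)
  finally have "(\<Sum>t<k. v t 0) \<noteq> 0" using k2 by simp
  then obtain t where "t < k" "v t 0 \<noteq> 0" by (meson lessThan_iff sum.neutral)
  thus ?thesis using vv vj by (intro exI[of _ t] exI[of _ "v t"]) auto
qed

text \<open>Since sigma inverts delta, it maps an eigenvector for xi^t to one for xi^(-t) =
  xi^(k-t). Exchanging the two vectors if necessary achieves \<open>2 * r \<le> k\<close>.\<close>

lemma eigenpair_exists:
  "\<exists>r v w. 2 * r \<le> k \<and> v \<in> vecs d \<and> w \<in> vecs d \<and> v \<noteq> (\<lambda>_. 0) \<and>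
     act (0, True) v = w \<and> act (0, True) w = v \<and>
     (\<forall>j<k. act (j, False) v = (\<lambda>i. (xi k ^ r) ^ j * v i)) \<and>
     (\<forall>j<k. act (j, False) w = (\<lambda>i. inverse (xi k ^ r) ^ j * w i))"
proof -
  obtain t v where t: "t < k" and v: "v \<in> vecs d" "v \<noteq> (\<lambda>_. 0)"
    and vj: "\<And>j. j < k \<Longrightarrow> act (j, False) v = (\<lambda>i. (xi k ^ t) ^ j * v i)"
    using eigenvector_exists by blast
  define w where "w = act (0, True) v"
  have w: "w \<in> vecs d" unfolding w_def by (rule matvec_vecs)
  have wv: "act (0, True) w = v" unfolding w_def by (rule act_refl_twice[OF v(1)])
  have wj: "act (j, False) w = (\<lambda>i. inverse (xi k ^ t) ^ j * w i)" if j: "j < k" for j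
  proof -
    have "(xi k ^ t) ^ ((k - j) mod k) = inverse (xi k ^ t) ^ j"
    proof (cases "j = 0")
      case False
      have "(xi k ^ t) ^ j * (xi k ^ t) ^ (k - j) = 1" using j xi_pow_k[of t] by (simp flip: power_add)
      hence "inverse ((xi k ^ t) ^ j) = (xi k ^ t) ^ (k - j)" by (rule inverse_unique)
      thus ?thesis using False j by (simp add: power_inverse)
    qed simp
    moreover have "act (j, False) w = act (0, True) (act ((k - j) mod k, False) v)"
      unfolding w_def using act_refl[OF j, of v] act_refl'[OF j, of v] by simp
    ultimately show ?thesis using vj[of "(k - j) mod k"] k2 by (simp add: matvec_scale w_def)
  qed
  show ?thesis
  proof (cases "2 * t \<le> k")
    case True
    thus ?thesis using v w w_def wv vj wj by blast
  next
    case False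
    have "xi k ^ (k - t) * xi k ^ t = 1" using t xi_pow_k[of 1] by (simp flip: power_add)
    hence e: "xi k ^ (k - t) = inverse (xi k ^ t)" by (simp add: inverse_eq_divide eq_divide_eq)
    have "w \<noteq> (\<lambda>_. 0)" using wv v(2) by (auto simp: matvec_def)
    hence "2 * (k - t) \<le> k \<and> w \<in> vecs d \<and> v \<in> vecs d \<and> w \<noteq> (\<lambda>_. 0) \<and>
     act (0, True) w = v \<and> act (0, True) v = w \<and>
     (\<forall>j<k. act (j, False) w = (\<lambda>i. (xi k ^ (k - t)) ^ j * w i)) \<and>
     (\<forall>j<k. act (j, False) v = (\<lambda>i. inverse (xi k ^ (k - t)) ^ j * v i))"
      using False v w w_def wv vj wj unfolding e by simp
    thus ?thesis by blast
  qed
qed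

lemma invariant_subspace:
  assumes "V \<subseteq> vecs d" "(\<lambda>_. 0) \<in> V" "\<And>v w. v \<in> V \<Longrightarrow> w \<in> V \<Longrightarrow> (\<lambda>i. v i + w i) \<in> V"
    "\<And>c v. v \<in> V \<Longrightarrow> (\<lambda>i. c * v i) \<in> V" "\<And>g v. g \<in> Dgrp k \<Longrightarrow> v \<in> V \<Longrightarrow> act g v \<in> V"
    "v \<in> V" "v \<noteq> (\<lambda>_. 0)"
  shows "V = vecs d"
proof -
  from irr have H: "\<forall>V. V \<subseteq> vecs d \<and> (\<lambda>_. 0) \<in> V \<and> (\<forall>v\<in>V. \<forall>w\<in>V. (\<lambda>i. v i + w i) \<in> V)
          \<and> (\<forall>c. \<forall>v\<in>V. (\<lambda>i. c * v i) \<in> V) \<and> (\<forall>g\<in>Dgrp k. \<forall>v\<in>V. act g v \<in> V)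
        \<longrightarrow> V = {\<lambda>_. 0} \<or> V = vecs d"
    unfolding irreducible_rep_def by (elim conjE)
  have "V = {\<lambda>_. 0} \<or> V = vecs d"
    by (rule H[THEN spec[where x = V], THEN mp]) (intro conjI ballI allI assms)
  thus ?thesis using assms(6,7) by auto
qed

text \<open>The vector \<open>w\<close> is allowed to be zero, so that the one-dimensional case is
  covered too.\<close>

lemma span_invariant:
  assumes v: "v \<in> vecs d" "v \<noteq> (\<lambda>_. 0)" and w: "w \<in> vecs d"
    and g: "\<And>g. g \<in> Dgrp k \<Longrightarrow> \<exists>a b. act g v = (\<lambda>i. a * v i + b * w i)"
           "\<And>g. g \<in> Dgrp k \<Longrightarrow> \<exists>a b. act g w = (\<lambda>i. a * v i + b * w i)"
    and u: "u \<in> vecs d"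
  shows "\<exists>a b. u = (\<lambda>i. a * v i + b * w i)"
proof -
  define V where "V = {u. \<exists>a b. u = (\<lambda>i. a * v i + b * w i)}"
  have I: "(\<lambda>i. a * v i + b * w i) \<in> V" for a b unfolding V_def by blast
  have "V = vecs d"
  proof (rule invariant_subspace)
    show "V \<subseteq> vecs d" using v(1) w by (auto simp: V_def vecs_def)
    show "(\<lambda>_. 0) \<in> V" using I[of 0 0] by simp
    show "v \<in> V" using I[of 1 0] by simp
    show "v \<noteq> (\<lambda>_. 0)" by (rule v(2))
  next
    fix p q assume "p \<in> V" "q \<in> V"
    then obtain a b a' b' where "p = (\<lambda>i. a * v i + b * w i)" "q = (\<lambda>i. a' * v i + b' * w i)" unfolding V_def by blast
    thus "(\<lambda>i. p i + q i) \<in> V" using I[of "a + a'" "b + b'"] by (simp add: algebra_simps)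
  next
    fix c p assume "p \<in> V"
    then obtain a b where "p = (\<lambda>i. a * v i + b * w i)" unfolding V_def by blast
    thus "(\<lambda>i. c * p i) \<in> V" using I[of "c * a" "c * b"] by (simp add: algebra_simps)
  next
    fix h p assume h: "h \<in> Dgrp k" and "p \<in> V"
    then obtain a b where p: "p = (\<lambda>i. a * v i + b * w i)" unfolding V_def by blast
    obtain a1 b1 a2 b2 where "act h v = (\<lambda>i. a1 * v i + b1 * w i)" "act h w = (\<lambda>i. a2 * v i + b2 * w i)"
      using g[OF h] by blast
    hence "act h p = (\<lambda>i. (a * a1 + b * a2) * v i + (a * b1 + b * b2) * w i)"
      unfolding p matvec_lincomb by (simp add: algebra_simps)
    thus "act h p \<in> V" using I by simp
  qed
  thus ?thesis using u unfolding V_def by blast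
qed

text \<open>If xi^r is its own inverse, the group has a common eigenvector, which spans everything.
  Otherwise the eigenpair is orthogonal and spans; with \<open>v*\<close> for the conjugate row, the
  matrices are then xi^(rj) v v* + xi^(-rj) w w* for rotations and xi^(-rj) w v* + xi^(rj) v w* for
  reflections.\<close>

lemma classification:
  "(d = 1 \<and> (\<exists>r s. (r = 0 \<or> 2 * r = k) \<and> (s = 1 \<or> s = -1) \<and>
      (\<forall>j<k. \<pi> (j, False) 0 0 = (xi k ^ r) ^ j \<and> \<pi> (j, True) 0 0 = s * (xi k ^ r) ^ j))) \<or>
   (d = 2 \<and> (\<exists>r v w. 0 < r \<and> 2 * r < k \<and> herm 2 v v = 1 \<and> herm 2 w w = 1 \<and> herm 2 v w = 0 \<and>
      (\<forall>l<2. \<forall>i<2. v l * cnj (v i) + w l * cnj (w i) = (if l = i then 1 else 0)) \<and>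
      (\<forall>j<k. \<forall>l<2. \<forall>i<2.
         \<pi> (j, False) l i = (xi k ^ r) ^ j * v l * cnj (v i) + inverse (xi k ^ r) ^ j * w l * cnj (w i) \<and>
         \<pi> (j, True) l i = inverse (xi k ^ r) ^ j * w l * cnj (v i) + (xi k ^ r) ^ j * v l * cnj (w i))))"
proof -
  obtain r v w where r: "2 * r \<le> k" and v: "v \<in> vecs d" "v \<noteq> (\<lambda>_. 0)" and w: "w \<in> vecs d"
    and vw: "act (0, True) v = w" "act (0, True) w = v"
    and vj: "\<And>j. j < k \<Longrightarrow> act (j, False) v = (\<lambda>i. (xi k ^ r) ^ j * v i)"
    and wj: "\<And>j. j < k \<Longrightarrow> act (j, False) w = (\<lambda>i. inverse (xi k ^ r) ^ j * w i)"
    using eigenpair_exists by blast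
  show ?thesis
  proof (cases "r = 0 \<or> 2 * r = k")
    case True
    have "(xi k ^ r) * (xi k ^ r) = 1" using True xi_pow_k[of 1] by (auto simp flip: power_add mult_2)
    hence inv: "inverse (xi k ^ r) = xi k ^ r" by (rule inverse_unique)
    \<comment> \<open>Either \<open>v + w\<close> is nonzero and fixed by sigma, or
      \<open>w = -v\<close> and \<open>v\<close> itself is an eigenvector with sign -1.\<close>
    obtain u s where u: "u \<in> vecs d" "u \<noteq> (\<lambda>_. 0)" and s: "s = 1 \<or> s = (-1 :: complex)"
      and uj: "\<And>j. j < k \<Longrightarrow> act (j, False) u = (\<lambda>i. (xi k ^ r) ^ j * u i)" and us: "act (0, True) u = (\<lambda>i. s * u i)"
    proof (cases "(\<lambda>i. v i + w i) = (\<lambda>_. 0)")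
      case F: False
      show ?thesis
      proof (rule that[of "\<lambda>i. v i + w i" 1])
        show "(\<lambda>i. v i + w i) \<in> vecs d" using v w by (simp add: vecs_def)
      qed (use F in \<open>auto simp: matvec_add vj wj vw inv algebra_simps\<close>)
    next
      case T: True
      hence "w = (\<lambda>i. -1 * v i)" by (auto simp: fun_eq_iff add_eq_0_iff)
      thus ?thesis using that[of v "-1"] v vj vw by simp
    qed
    have gj: "act (j, True) u = (\<lambda>i. s * (xi k ^ r) ^ j * u i)" if "j < k" for j
      unfolding act_refl[OF that] us matvec_scale uj[OF that] by (simp add: mult_ac)
    have span: "\<exists>a. x = (\<lambda>i. a * u i)" if x: "x \<in> vecs d" for x
    proof -
      have 1: "\<exists>a b. act g u = (\<lambda>i. a * u i + b * 0)" if gD: "g \<in> Dgrp k" for g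
      proof -
        obtain j b where g: "g = (j, b)" "j < k" using gD unfolding Dgrp_def by auto
        show ?thesis using uj[OF g(2)] gj[OF g(2)] unfolding g(1) by (cases b) auto
      qed
      have 2: "\<exists>a b. act g (\<lambda>_. 0) = (\<lambda>i. a * u i + b * 0)" for g
        by (rule exI[of _ 0], rule exI[of _ 0]) (simp add: matvec_def fun_eq_iff)
      have 3: "(\<lambda>_. 0) \<in> vecs d" by (simp add: vecs_def)
      have "\<exists>a b. x = (\<lambda>i. a * u i + b * 0)"
        by (rule span_invariant[of u "\<lambda>_. 0" x, OF u 3 1 2 x])
      thus ?thesis by auto
    qed
    have d: "d = 1"
    proof (rule ccontr)
      assume "d \<noteq> 1"
      hence d2: "0 < d" "1 < d" using d1 by auto
      obtain a b where "unit_vec 0 = (\<lambda>i. a * u i)" "unit_vec 1 = (\<lambda>i. b * u i)"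
        using span[OF unit_vec_vecs[OF d2(1)]] span[OF unit_vec_vecs[OF d2(2)]] by blast
      hence "1 = a * u 0" "0 = a * u 1" "1 = b * u 1" by (auto simp: unit_vec_def fun_eq_iff split: if_splits)
      thus False by auto
    qed
    have u0: "u 0 \<noteq> 0" using vecs_nonzero[OF u] d by auto
    have p: "\<pi> g 0 0 * u 0 = act g u 0" for g using d by (simp add: matvec_def)
    have "\<pi> (j, False) 0 0 = (xi k ^ r) ^ j \<and> \<pi> (j, True) 0 0 = s * (xi k ^ r) ^ j" if "j < k" for j
      using p[of "(j, False)"] p[of "(j, True)"] u0 unfolding uj[OF that] gj[OF that] by simp
    thus ?thesis using d True s by blast
  next
    case False
    hence r': "0 < r" "2 * r < k" using r by auto
    have span: "\<exists>a b. x = (\<lambda>i. a * v i + b * w i)" if "x \<in> vecs d" for x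
    proof (rule span_invariant[OF v w _ _ that])
      fix g assume "g \<in> Dgrp k"
      then obtain j b where g: "g = (j, b)" "j < k" unfolding Dgrp_def by auto
      have "\<exists>a b. (\<lambda>i. c * v i) = (\<lambda>i. a * v i + b * w i)" "\<exists>a b. (\<lambda>i. c * w i) = (\<lambda>i. a * v i + b * w i)" for c
        by (rule exI[of _ c], rule exI[of _ 0], simp) (rule exI[of _ 0], rule exI[of _ c], simp)
      thus "\<exists>a b. act g v = (\<lambda>i. a * v i + b * w i)" "\<exists>a b. act g w = (\<lambda>i. a * v i + b * w i)"
        unfolding g(1) using act_refl[OF g(2)] vj[OF g(2)] wj[OF g(2)] vw by (cases b; simp)+
    qed
    \<comment> \<open>Applying the isometry delta multiplies this inner product by xi^(2r), which
      differs from 1 as 0 < 2r < k.\<close>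
    have orth: "herm d v w = 0"
    proof -
      have "herm d v w = herm d (act (1, False) v) (act (1, False) w)"
        using k2 by (intro herm_act[symmetric]) (simp add: Dgrp_def)
      also have "\<dots> = xi k powi (2 * int r) * herm d v w"
      proof -
        have "cnj (inverse (xi k ^ r)) = xi k ^ r" by (simp add: cnj_xi power_inverse)
        moreover have "xi k powi (2 * int r) = xi k ^ (2 * r)" using power_int_of_nat[of "xi k" "2 * r"] by simp
        hence "xi k powi (2 * int r) = xi k ^ r * xi k ^ r" by (simp only: mult_2 power_add)
        moreover have "(\<Sum>l<d. (c * v l) * cnj (e * w l)) = (c * cnj e) * (\<Sum>l<d. v l * cnj (w l))" for c e
          by (simp add: sum_distrib_left mult_ac)
        moreover have "act (1, False) v = (\<lambda>i. xi k ^ r * v i)" "act (1, False) w = (\<lambda>i. inverse (xi k ^ r) * w i)"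
          using vj[of 1] wj[of 1] k2 by simp_all
        ultimately show ?thesis unfolding herm_def by (simp only:)
      qed
      finally have "(xi k powi (2 * int r) - 1) * herm d v w = 0" by (simp add: algebra_simps)
      moreover have "\<not> int k dvd 2 * int r" using r' zdvd_imp_le[of "int k" "2 * int r"] by auto
      hence "xi k powi (2 * int r) \<noteq> 1" using xi_powi_eq_1[of k] k2 by simp
      ultimately show ?thesis by simp
    qed
    have vn: "herm d v v \<noteq> 0" using vecs_nonzero[OF v] herm_self_eq_0[of d v] by auto
    have wn: "herm d w w = herm d v v" using herm_act[of "(0, True)" v v] k2 vw by (simp add: Dgrp_def)
    have "d \<noteq> 1"
    proof
      assume "d = 1"
      hence "v 0 \<noteq> 0" "w 0 \<noteq> 0" "v 0 * cnj (w 0) = 0" using vn wn orth by (auto simp: herm_def)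
      thus False by simp
    qed
    \<comment> \<open>A 3 x 3 determinant with rows in the span of two vectors vanishes, whereas
      three unit vectors give 1.\<close>
    moreover have "\<not> 3 \<le> d"
    proof
      assume "3 \<le> d"
      hence "0 < d" "1 < d" "2 < d" by auto
      then obtain a b a' b' a'' b'' where e: "unit_vec 0 = (\<lambda>i. a * v i + b * w i)"
        "unit_vec 1 = (\<lambda>i. a' * v i + b' * w i)" "unit_vec 2 = (\<lambda>i. a'' * v i + b'' * w i)"
        using span[OF unit_vec_vecs] by meson
      have det3: "(a * v 0 + b * w 0) * ((a' * v 1 + b' * w 1) * (a'' * v 2 + b'' * w 2) - (a' * v 2 + b' * w 2) * (a'' * v 1 + b'' * w 1))
        - (a * v 1 + b * w 1) * ((a' * v 0 + b' * w 0) * (a'' * v 2 + b'' * w 2) - (a' * v 2 + b' * w 2) * (a'' * v 0 + b'' * w 0))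
        + (a * v 2 + b * w 2) * ((a' * v 0 + b' * w 0) * (a'' * v 1 + b'' * w 1) - (a' * v 1 + b' * w 1) * (a'' * v 0 + b'' * w 0)) = 0"
        by (simp add: algebra_simps)
      have "unit_vec 0 0 * (unit_vec 1 1 * unit_vec 2 2 - unit_vec 1 2 * unit_vec 2 1)
        - unit_vec 0 1 * (unit_vec 1 0 * unit_vec 2 2 - unit_vec 1 2 * unit_vec 2 0)
        + unit_vec 0 2 * (unit_vec 1 0 * unit_vec 2 1 - unit_vec 1 1 * unit_vec 2 0) = 0"
        using det3 unfolding e .
      thus False by (simp add: unit_vec_def)
    qed
    ultimately have d: "d = 2" using d1 by auto
    \<comment> \<open>The reciprocal length of \<open>v\<close>; it normalizes \<open>w\<close> as
      well, because sigma is isometric.\<close>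
    define c where "c = complex_of_real (1 / sqrt (\<Sum>l<d. (cmod (v l))\<^sup>2))"
    have hv: "herm d v v = complex_of_real (\<Sum>l<d. (cmod (v l))\<^sup>2)"
      by (simp add: herm_def complex_norm_square del: of_real_power)
    have "0 \<le> (\<Sum>l<d. (cmod (v l))\<^sup>2)" by (intro sum_nonneg) auto
    moreover have "(\<Sum>l<d. (cmod (v l))\<^sup>2) \<noteq> 0" using vn unfolding hv by (simp only: of_real_eq_0_iff not_False_eq_True)
    ultimately have cc: "c * cnj c * herm d v v = 1"
      unfolding hv c_def by (simp flip: of_real_mult of_real_sum add: real_sqrt_mult_self)
    define v' where "v' = (\<lambda>i. c * v i)"
    define w' where "w' = (\<lambda>i. c * w i)"
    have hs: "herm d (\<lambda>i. c * p i) (\<lambda>i. c * q i) = c * cnj c * herm d p q" for p q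
      by (simp add: herm_def sum_distrib_left mult_ac)
    have on: "herm 2 v' v' = 1" "herm 2 w' w' = 1" "herm 2 v' w' = 0"
      unfolding v'_def w'_def using hs[of v v] hs[of w w] hs[of v w] cc wn orth d by simp_all
    hence on': "herm 2 w' v' = 0"
      unfolding herm_def by (metis (no_types, lifting) cnj_sum complex_cnj_cnj complex_cnj_mult complex_cnj_zero mult.commute sum.cong)
    have c0: "c \<noteq> 0" using cc by auto
    \<comment> \<open>Expansion in the orthonormal basis \<open>v'\<close>, \<open>w'\<close>:
      pairing with each basis vector identifies the coefficients. Read entrywise it is the
      completeness relation \<open>id\<close>.\<close>
    have ex: "unit_vec i = (\<lambda>l. cnj (v' i) * v' l + cnj (w' i) * w' l)" if i: "i < 2" for i
    proof -
      obtain a b where "unit_vec i = (\<lambda>l. a * v l + b * w l)" using span[OF unit_vec_vecs] i d by blast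
      hence e: "unit_vec i = (\<lambda>l. (a / c) * v' l + (b / c) * w' l)" using c0 by (simp add: v'_def w'_def)
      have U: "herm 2 (unit_vec i) p = cnj (p i)" for p using i by (auto simp: herm_def unit_vec_def if_distrib[of "\<lambda>x. x * _"] cong: if_cong)
      have L: "herm 2 (\<lambda>l. x * v' l + y * w' l) p = x * herm 2 v' p + y * herm 2 w' p" for x y p
        by (simp add: herm_def distrib_right sum.distrib sum_distrib_left mult.assoc)
      have "cnj (v' i) = a / c" "cnj (w' i) = b / c"
        using U[of v'] U[of w'] unfolding e L on on' by simp_all
      thus ?thesis using e by simp
    qed
    have pi: "\<pi> g l i = cnj (v' i) * act g v' l + cnj (w' i) * act g w' l" if "l < 2" "i < 2" for g l i
      using act_unit_vec[of i l g] that d unfolding ex[OF that(2)] matvec_lincomb by simp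
    have v'j: "act (j, False) v' = (\<lambda>i. (xi k ^ r) ^ j * v' i)" if "j < k" for j
      unfolding v'_def matvec_scale vj[OF that] by (simp add: mult_ac)
    have w'j: "act (j, False) w' = (\<lambda>i. inverse (xi k ^ r) ^ j * w' i)" if "j < k" for j
      unfolding w'_def matvec_scale wj[OF that] by (simp add: mult_ac)
    have vw': "act (0, True) v' = w'" "act (0, True) w' = v'"
      unfolding v'_def w'_def matvec_scale vw by simp_all
    have id: "v' l * cnj (v' i) + w' l * cnj (w' i) = (if l = i then 1 else 0)" if "l < 2" "i < 2" for l i
      using fun_cong[OF ex[OF that(2)], of l] by (simp add: unit_vec_def mult.commute)
    have pi': "\<pi> (j, False) l i = (xi k ^ r) ^ j * v' l * cnj (v' i) + inverse (xi k ^ r) ^ j * w' l * cnj (w' i) \<and>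
         \<pi> (j, True) l i = inverse (xi k ^ r) ^ j * w' l * cnj (v' i) + (xi k ^ r) ^ j * v' l * cnj (w' i)"
      if "j < k" "l < 2" "i < 2" for j l i
      unfolding pi[OF that(2,3)] act_refl[OF that(1)] vw' v'j[OF that(1)] w'j[OF that(1)] by (simp add: mult_ac)
    show ?thesis
      by (rule disjI2, rule conjI[OF d], rule exI[of _ r], rule exI[of _ v'], rule exI[of _ w'])
        (intro conjI allI impI r' on id pi'[THEN conjunct1] pi'[THEN conjunct2])
  qed
qed

end

lemma matmul_orthonormal:
  assumes "herm 2 v v = 1" "herm 2 w w = 1" "herm 2 v w = 0"
  shows "matmul 2 (\<lambda>i l. a i * cnj (v l) + b i * cnj (w l)) (\<lambda>l j. v l * p j + w l * q j) i j = a i * p j + b i * q j"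
proof -
  have wv: "herm 2 w v = 0"
    using assms(3) unfolding herm_def by (metis (no_types, lifting) cnj_sum complex_cnj_cnj complex_cnj_mult complex_cnj_zero mult.commute sum.cong)
  have "matmul 2 (\<lambda>i l. a i * cnj (v l) + b i * cnj (w l)) (\<lambda>l j. v l * p j + w l * q j) i j
      = a i * p j * herm 2 v v + a i * q j * herm 2 w v + b i * p j * herm 2 v w + b i * q j * herm 2 w w"
    by (simp add: matmul_def herm_def numeral_2_eq_2 algebra_simps)
  thus ?thesis using assms wv by simp
qed

lemma matmul_cong: "(\<And>l. l < d \<Longrightarrow> A i l = A' i l) \<Longrightarrow> (\<And>l. l < d \<Longrightarrow> B l j = B' l j) \<Longrightarrow> matmul d A B i j = matmul d A' B' i j"
  by (simp add: matmul_def)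

text \<open>The intertwiner is v' v* + w' w*, the change of basis that sends \<open>v\<close> to
  \<open>v'\<close> and \<open>w\<close> to \<open>w'\<close>; its adjoint is the inverse.\<close>

lemma equiv_rep_two:
  fixes z :: "nat \<Rightarrow> complex" and u :: "nat \<Rightarrow> complex"
  assumes on: "herm 2 v v = 1" "herm 2 w w = 1" "herm 2 v w = 0"
    and on': "herm 2 v' v' = 1" "herm 2 w' w' = 1" "herm 2 v' w' = 0"
    and id: "\<And>l i. l < 2 \<Longrightarrow> i < 2 \<Longrightarrow> v l * cnj (v i) + w l * cnj (w i) = (if l = i then 1 else 0)"
    and id': "\<And>l i. l < 2 \<Longrightarrow> i < 2 \<Longrightarrow> v' l * cnj (v' i) + w' l * cnj (w' i) = (if l = i then 1 else 0)"
    and pi: "\<And>j l i. j < k \<Longrightarrow> l < 2 \<Longrightarrow> i < 2 \<Longrightarrow> \<pi> (j, False) l i = z j * v l * cnj (v i) + u j * w l * cnj (w i) \<and>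
         \<pi> (j, True) l i = u j * w l * cnj (v i) + z j * v l * cnj (w i)"
    and pi': "\<And>j l i. j < k \<Longrightarrow> l < 2 \<Longrightarrow> i < 2 \<Longrightarrow> \<pi>' (j, False) l i = z j * v' l * cnj (v' i) + u j * w' l * cnj (w' i) \<and>
         \<pi>' (j, True) l i = u j * w' l * cnj (v' i) + z j * v' l * cnj (w' i)"
  shows "equiv_rep k 2 \<pi> 2 \<pi>'"
proof -
  define A where "A = (\<lambda>i l. v' i * cnj (v l) + w' i * cnj (w l))"
  define B where "B = (\<lambda>i l. v i * cnj (v' l) + w i * cnj (w' l))"
  have AB: "matmul 2 A B i j = (if i = j then 1 else 0)" "matmul 2 B A i j = (if i = j then 1 else 0)" if "i < 2" "j < 2" for i j
    unfolding A_def B_def matmul_orthonormal[OF on] matmul_orthonormal[OF on'] using id id' that by auto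
  have "matmul 2 A (\<pi> g) i l = matmul 2 (\<pi>' g) A i l" if gD: "g \<in> Dgrp k" and that: "i < 2" "l < 2" for g i l
  proof -
    obtain j b where g: "g = (j, b)" "j < k" using gD unfolding Dgrp_def by auto
    show ?thesis
    proof (cases b)
      case False
      have "matmul 2 A (\<pi> g) i l = matmul 2 A (\<lambda>m l. v m * (z j * cnj (v l)) + w m * (u j * cnj (w l))) i l"
        using pi[OF g(2)] that False g by (intro matmul_cong) (auto simp: mult_ac)
      also have "\<dots> = v' i * (z j * cnj (v l)) + w' i * (u j * cnj (w l))"
        unfolding A_def matmul_orthonormal[OF on] ..
      also have "\<dots> = matmul 2 (\<lambda>i m. (z j * v' i) * cnj (v' m) + (u j * w' i) * cnj (w' m)) A i l"
        unfolding A_def matmul_orthonormal[OF on'] by (simp add: mult_ac)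
      also have "\<dots> = matmul 2 (\<pi>' g) A i l"
        using pi'[OF g(2)] that False g by (intro matmul_cong) (auto simp: mult_ac)
      finally show ?thesis .
    next
      case True
      have "matmul 2 A (\<pi> g) i l = matmul 2 A (\<lambda>m l. v m * (z j * cnj (w l)) + w m * (u j * cnj (v l))) i l"
        using pi[OF g(2)] that True g by (intro matmul_cong) (auto simp: mult_ac)
      also have "\<dots> = v' i * (z j * cnj (w l)) + w' i * (u j * cnj (v l))"
        unfolding A_def matmul_orthonormal[OF on] ..
      also have "\<dots> = matmul 2 (\<lambda>i m. (u j * w' i) * cnj (v' m) + (z j * v' i) * cnj (w' m)) A i l"
        unfolding A_def matmul_orthonormal[OF on'] by (simp add: mult_ac)
      also have "\<dots> = matmul 2 (\<pi>' g) A i l"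
        using pi'[OF g(2)] that True g by (intro matmul_cong) (auto simp: mult_ac)
      finally show ?thesis .
    qed
  qed
  thus ?thesis unfolding equiv_rep_def using AB by blast
qed

lemma equiv_rep_one:
  assumes "\<And>g. g \<in> Dgrp k \<Longrightarrow> \<pi> g 0 0 = \<pi>' g 0 0"
  shows "equiv_rep k 1 \<pi> 1 \<pi>'"
  unfolding equiv_rep_def
  by (intro conjI refl exI[of _ "\<lambda>_ _. 1"]) (use assms in \<open>auto simp: matmul_def\<close>)

section \<open>The ranges of the projections\<close>

context bergman
begin

lemma H2_mult_bounded:
  assumes "a \<in> H2 lam" "\<And>p. cmod (c p) \<le> M"
  shows "(\<lambda>p. c p * a p) \<in> H2 lam"
  unfolding H2_def mem_Collect_eq
proof (rule summable_on_comparison_test)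
  show "(\<lambda>p. M\<^sup>2 * ((cmod (a p))\<^sup>2 * wt lam p)) summable_on UNIV"
    using assms(1) by (intro summable_on_cmult_right) (simp add: H2_def)
  fix p
  have "(cmod (c p))\<^sup>2 \<le> M\<^sup>2" using assms(2)[of p] by (intro power_mono) auto
  hence "(cmod (c p))\<^sup>2 * ((cmod (a p))\<^sup>2 * wt lam p) \<le> M\<^sup>2 * ((cmod (a p))\<^sup>2 * wt lam p)"
    by (rule mult_right_mono) (simp add: wt_nonneg)
  thus "(cmod (c p * a p))\<^sup>2 * wt lam p \<le> M\<^sup>2 * ((cmod (a p))\<^sup>2 * wt lam p)"
    by (simp add: norm_mult power_mult_distrib mult.assoc)
qed (simp add: wt_nonneg)

lemma H2_swap: "a \<in> H2 lam \<Longrightarrow> (\<lambda>p. a (prod.swap p)) \<in> H2 lam"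
proof -
  assume "a \<in> H2 lam"
  moreover have "bij_betw prod.swap (UNIV :: (nat \<times> nat) set) UNIV" by (simp add: bij_betw_def)
  ultimately have "(\<lambda>p. (cmod (a (prod.swap p)))\<^sup>2 * wt lam (prod.swap p)) summable_on UNIV"
    by (subst summable_on_reindex_bij_betw[where f = "\<lambda>p. (cmod (a p))\<^sup>2 * wt lam p"]) (simp_all add: H2_def)
  thus ?thesis by (simp add: H2_def wt_def mult.commute)
qed

end

lemma cmod_xi_power [simp]: "cmod (xi k ^ j) = 1" "cmod (inverse (xi k) ^ j) = 1"
  by (simp_all add: xi_def norm_power norm_inverse)

lemma has_sum_mon_swap:
  assumes "((\<lambda>p. a p * mon p z) has_sum s) UNIV"
  shows "((\<lambda>p. a (prod.swap p) * mon p (prod.swap z)) has_sum s) UNIV"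
proof -
  have "bij_betw prod.swap (UNIV :: (nat \<times> nat) set) UNIV" by (simp add: bij_betw_def)
  from has_sum_reindex_bij_betw[OF this, of "\<lambda>p. a p * mon p z" s] assms
  have "((\<lambda>p. a (prod.swap p) * mon (prod.swap p) z) has_sum s) UNIV" by simp
  thus ?thesis by (simp add: mult_ac)
qed

lemma mon_rot: "mon p (inverse (xi k) ^ j * u, xi k ^ j * v) = (xi k powi (int (snd p) - int (fst p))) ^ j * mon p (u, v)"
  by (simp add: power_int_diff power_divide power_mult_distrib power_inverse divide_inverse mult_ac flip: power_mult)

lemma xi_power_mod: "k > 0 \<Longrightarrow> j < k \<Longrightarrow> xi k ^ ((k - j) mod k) = inverse (xi k) ^ j"
proof -
  assume k: "k > 0" "j < k"
  have "xi k ^ k = 1" using xi_power_k[of k] k by simp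
  hence "xi k ^ j * xi k ^ (k - j) = 1" using k by (simp flip: power_add)
  hence "inverse (xi k ^ j) = xi k ^ (k - j)" by (rule inverse_unique)
  thus ?thesis using k by (cases "j = 0") (simp_all add: power_inverse)
qed

text \<open>\<open>gact\<close> acts through the inverse element, hence the inverse root on the
  first coordinate; reflections are their own inverses.\<close>

lemma gact_rot: "j < k \<Longrightarrow> gact k (j, False) z = (inverse (xi k) ^ j * fst z, xi k ^ j * snd z)"
  using xi_power_mod[of k j] by (simp add: gact_def ginv_def lin_def case_prod_unfold power_inverse)

lemma gact_refl: "gact k (j, True) z = (xi k ^ j * snd z, inverse (xi k) ^ j * fst z)"
  by (simp add: gact_def ginv_def lin_def)

lemma ginv_ginv: "g \<in> Dgrp k \<Longrightarrow> ginv k (ginv k g) = g"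
  by (cases "fst g = 0") (auto simp: Dgrp_def ginv_def)

lemma ginv_Dgrp: "g \<in> Dgrp k \<Longrightarrow> ginv k g \<in> Dgrp k"
  by (auto simp: Dgrp_def ginv_def split: if_splits)

text \<open>Summing over inverses turns the terms into \<open>\<pi> g 0 0 * f (gact k g z)\<close>;
  rotations and reflections are then listed separately.\<close>

lemma Pproj_eq:
  "Pproj k d \<pi> 0 0 f z = of_nat d / (2 * of_nat k) *
     (\<Sum>j<k. \<pi> (j, False) 0 0 * f (inverse (xi k) ^ j * fst z, xi k ^ j * snd z)
           + \<pi> (j, True) 0 0 * f (xi k ^ j * snd z, inverse (xi k) ^ j * fst z))"
proof -
  have "(\<Sum>\<tau>\<in>Dgrp k. \<pi> (ginv k \<tau>) 0 0 * f (gact k (ginv k \<tau>) z)) = (\<Sum>g\<in>Dgrp k. \<pi> g 0 0 * f (gact k g z))"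
    by (rule sum.reindex_bij_witness[where i = "ginv k" and j = "ginv k"]) (auto simp: ginv_ginv ginv_Dgrp)
  also have "\<dots> = (\<Sum>g\<in>{..<k} \<times> {False, True}. \<pi> g 0 0 * f (gact k g z))"
    by (rule sum.cong) (auto simp: Dgrp_def)
  also have "(\<Sum>g\<in>{..<k} \<times> {False, True}. \<pi> g 0 0 * f (gact k g z))
     = (\<Sum>j<k. \<pi> (j, False) 0 0 * f (gact k (j, False) z) + \<pi> (j, True) 0 0 * f (gact k (j, True) z))"
  proof -
    have "(\<Sum>g\<in>{..<k} \<times> {False, True}. \<pi> g 0 0 * f (gact k g z))
       = (\<Sum>(j, b)\<in>{..<k} \<times> {False, True}. \<pi> (j, b) 0 0 * f (gact k (j, b) z))"
      by (simp add: case_prod_unfold)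
    also have "\<dots> = (\<Sum>j<k. \<Sum>b\<in>{False, True}. \<pi> (j, b) 0 0 * f (gact k (j, b) z))"
      by (rule sum.cartesian_product[symmetric])
    finally show ?thesis by simp
  qed
  finally show ?thesis by (simp add: Pproj_def gact_rot gact_refl)
qed

section \<open>The projection on Taylor coefficients and its range\<close>

context dihedral_data
begin

text \<open>What \<open>Pproj k d \<pi> 0 0\<close> does to coefficients: the sum over rotations
  yields a factor \<open>k\<close> on each residue class, so d/(2k) becomes d/2.\<close>

definition proj_coef :: "nat \<Rightarrow> (nat \<times> nat \<Rightarrow> complex) \<Rightarrow> nat \<times> nat \<Rightarrow> complex" where
  "proj_coef d a p = of_nat d / 2 *
     ((if res_class k r (fst p) (snd p) then x * (cnj x * a p + cnj y * a (prod.swap p)) else 0) +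
      (if res_class k r (snd p) (fst p) then y * (cnj y * a p + cnj x * a (prod.swap p)) else 0))"

lemma proj_coef_H2: "a \<in> H2 lam \<Longrightarrow> proj_coef d a \<in> H2 lam"
proof -
  assume a: "a \<in> H2 lam"
  define c where "c u v = (\<lambda>p. of_nat d / 2 * ((if res_class k r (fst p) (snd p) then u else 0) + (if res_class k r (snd p) (fst p) then v else 0)))" for u v :: complex
  have b: "cmod (c u v p) \<le> real d / 2 * (cmod u + cmod v)" for u v p
    by (auto simp: c_def norm_mult intro!: mult_left_mono norm_triangle_ineq)
  have "(\<lambda>p. c (x * cnj x) (y * cnj y) p * a p + c (x * cnj y) (y * cnj x) p * a (prod.swap p)) \<in> H2 lam"
    by (rule H2_add[OF H2_mult_bounded[OF a b] H2_mult_bounded[OF H2_swap[OF a] b]])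
  also have "(\<lambda>p. c (x * cnj x) (y * cnj y) p * a p + c (x * cnj y) (y * cnj x) p * a (prod.swap p)) = proj_coef d a"
    by (rule ext) (simp add: c_def proj_coef_def field_simps)
  finally show ?thesis .
qed

text \<open>The finite group sum is moved inside the power series. At each monomial it becomes a sum
  of powers of roots of unity, which \<open>xi_sum\<close> evaluates to a residue condition.\<close>

lemma Pproj_fn:
  assumes pi: "\<And>j. j < k \<Longrightarrow> \<pi> (j, False) 0 0 = x * cnj x * (xi k ^ r) ^ j + y * cnj y * inverse (xi k ^ r) ^ j"
             "\<And>j. j < k \<Longrightarrow> \<pi> (j, True) 0 0 = cnj x * y * inverse (xi k ^ r) ^ j + x * cnj y * (xi k ^ r) ^ j"
    and a: "a \<in> H2 lam"
  shows "Pproj k d \<pi> 0 0 (fn a) = fn (proj_coef d a)"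
proof
  fix z
  let ?rot = "\<lambda>j. (inverse (xi k) ^ j * fst z, xi k ^ j * snd z)"
  let ?ref = "\<lambda>j. (xi k ^ j * snd z, inverse (xi k) ^ j * fst z)"
  have in_bidisc: "?rot j \<in> bidisc \<longleftrightarrow> z \<in> bidisc" "?ref j \<in> bidisc \<longleftrightarrow> z \<in> bidisc" for j
    by (auto simp: bidisc_def norm_mult)
  show "Pproj k d \<pi> 0 0 (fn a) z = fn (proj_coef d a) z"
  proof (cases "z \<in> bidisc")
    case False
    thus ?thesis by (simp add: Pproj_eq fn_def in_bidisc)
  next
    case True
    let ?e = "\<lambda>p. xi k powi (int (snd p) - int (fst p))"
    have 1: "((\<lambda>p. a p * ?e p ^ j * mon p z) has_sum fn a (?rot j)) UNIV" for j
      using has_sum_psum[OF a, of "?rot j"] True unfolding fn_def in_bidisc mon_rot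
      by (simp add: in_bidisc mult.assoc)
    have 2: "((\<lambda>p. a (prod.swap p) * ?e p ^ j * mon p z) has_sum fn a (?ref j)) UNIV" for j
      using has_sum_mon_swap[OF has_sum_psum[OF a, of "?ref j"]] True unfolding fn_def in_bidisc swap_simp mon_rot
      by (simp add: in_bidisc mult.assoc)
    have "((\<lambda>p. of_nat d / (2 * of_nat k) * (\<Sum>j<k. \<pi> (j, False) 0 0 * (a p * ?e p ^ j * mon p z)
           + \<pi> (j, True) 0 0 * (a (prod.swap p) * ?e p ^ j * mon p z))) has_sum Pproj k d \<pi> 0 0 (fn a) z) UNIV"
      unfolding Pproj_eq by (intro has_sum_cmult_right has_sum_finite_sum has_sum_add 1 2)
    also have "(\<lambda>p. of_nat d / (2 * of_nat k) * (\<Sum>j<k. \<pi> (j, False) 0 0 * (a p * ?e p ^ j * mon p z)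
           + \<pi> (j, True) 0 0 * (a (prod.swap p) * ?e p ^ j * mon p z))) = (\<lambda>p. proj_coef d a p * mon p z)"
    proof
      fix p :: "nat \<times> nat"
      define m n where "m = fst p" and "n = snd p"
      have s1: "(\<Sum>j<k. (xi k ^ r) ^ j * ?e p ^ j) = (if res_class k r m n then of_nat k else 0)"
      proof -
        have "xi k ^ r * ?e p = xi k powi (- (int m - int n - int r))"
          using power_int_add[of "xi k" "int r" "int n - int m"] by (simp add: m_def n_def algebra_simps)
        hence "(\<Sum>j<k. (xi k ^ r) ^ j * ?e p ^ j) = (\<Sum>j<k. (xi k powi (- (int m - int n - int r))) ^ j)"
          by (simp only: power_mult_distrib[symmetric])
        thus ?thesis using xi_sum[of k "- (int m - int n - int r)"] k2 by (simp only: res_class_def dvd_minus_iff)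
      qed
      have s2: "(\<Sum>j<k. inverse (xi k ^ r) ^ j * ?e p ^ j) = (if res_class k r n m then of_nat k else 0)"
      proof -
        have "inverse (xi k ^ r) * ?e p = xi k powi (int n - int m - int r)"
          using power_int_diff[of "xi k" "int n - int m" "int r"]
          by (simp only: m_def n_def power_int_of_nat divide_inverse mult.commute xi_nonzero not_False_eq_True simp_thms)
        hence "(\<Sum>j<k. inverse (xi k ^ r) ^ j * ?e p ^ j) = (\<Sum>j<k. (xi k powi (int n - int m - int r)) ^ j)"
          by (simp only: power_mult_distrib[symmetric])
        thus ?thesis using xi_sum[of k "int n - int m - int r"] k2 by (simp only: res_class_def)
      qed
      have "(\<Sum>j<k. \<pi> (j, False) 0 0 * (a p * ?e p ^ j * mon p z) + \<pi> (j, True) 0 0 * (a (prod.swap p) * ?e p ^ j * mon p z))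
        = (\<Sum>j<k. ((xi k ^ r) ^ j * ?e p ^ j) * ((x * cnj x * a p + x * cnj y * a (prod.swap p)) * mon p z)
          + (inverse (xi k ^ r) ^ j * ?e p ^ j) * ((y * cnj y * a p + cnj x * y * a (prod.swap p)) * mon p z))"
        by (rule sum.cong[OF refl]) (simp only: pi lessThan_iff, simp only: algebra_simps)
      also have "\<dots> = (if res_class k r m n then of_nat k else 0) * ((x * cnj x * a p + x * cnj y * a (prod.swap p)) * mon p z)
          + (if res_class k r n m then of_nat k else 0) * ((y * cnj y * a p + cnj x * y * a (prod.swap p)) * mon p z)"
        unfolding sum.distrib sum_distrib_right[symmetric] s1 s2 ..
      also have "of_nat d / (2 * of_nat k) * \<dots> = proj_coef d a p * mon p z"
        using k2 unfolding proj_coef_def m_def[symmetric] n_def[symmetric]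
        by (cases "res_class k r m n"; cases "res_class k r n m"; simp only: if_True if_False; simp add: field_simps)
      finally show "of_nat d / (2 * of_nat k) * (\<Sum>j<k. \<pi> (j, False) 0 0 * (a p * ?e p ^ j * mon p z)
           + \<pi> (j, True) 0 0 * (a (prod.swap p) * ?e p ^ j * mon p z)) = proj_coef d a p * mon p z" .
    qed
    finally have "Pproj k d \<pi> 0 0 (fn a) z = psum (proj_coef d a) z"
      using has_sum_psum[OF proj_coef_H2[OF a] True] by (rule has_sum_unique)
    thus ?thesis using True by (simp add: fn_def[of "proj_coef d a"])
  qed
qed

lemma res_class_commute: "r = 0 \<or> 2 * r = k \<Longrightarrow> res_class k r m n \<longleftrightarrow> res_class k r n m"
proof -
  assume "r = 0 \<or> 2 * r = k"
  hence r: "int k dvd 2 * int r" by auto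
  have "int k dvd int m - int n - int r \<longleftrightarrow> int k dvd - (int m - int n - int r)" by (simp only: dvd_minus_iff)
  also have "- (int m - int n - int r) = (int n - int m - int r) + 2 * int r" by simp
  also have "int k dvd \<dots> \<longleftrightarrow> int k dvd int n - int m - int r" using r by (rule dvd_add_left_iff)
  finally show ?thesis by (simp add: res_class_def)
qed

lemma proj_coef_in_S:
  assumes a: "a \<in> H2 lam"
  shows "proj_coef d a \<in> S"
proof -
  have "res_class k r m n \<or> res_class k r n m" if "proj_coef d a (m, n) \<noteq> 0" for m n
    using that by (auto simp: proj_coef_def split: if_splits)
  moreover have "y * proj_coef d a (m, n) = x * proj_coef d a (n, m)" if c: "res_class k r m n" for m n
  proof (cases "res_class k r n m")
    case False
    thus ?thesis using c by (simp add: proj_coef_def algebra_simps)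
  next
    case True
    hence "y = x \<or> y = -x" using special[OF res_class_both[OF c]] by simp
    thus ?thesis using True c by (auto simp: proj_coef_def algebra_simps)
  qed
  ultimately show ?thesis using proj_coef_H2[OF a] unfolding isotypic_def by blast
qed

text \<open>For a character the two residue classes coincide and each contributes
  \<open>a p\<close>, balanced by d/2 = 1/2. In dimension 2 the classes are disjoint and d/2 =
  1.\<close>

lemma proj_coef_fixes_S:
  assumes d: "d = 1 \<and> (r = 0 \<or> 2 * r = k) \<or> d = 2 \<and> \<not> (r = 0 \<or> 2 * r = k)" and a: "a \<in> S"
  shows "proj_coef d a = a"
proof
  fix p :: "nat \<times> nat"
  obtain m n where p: "p = (m, n)" by force
  have 1: "x * (cnj x * a (m, n) + cnj y * a (n, m)) = a (m, n)" if "res_class k r m n"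
  proof -
    have "y * a (m, n) = x * a (n, m)" using a that by (auto simp: isotypic_def)
    hence "x * (cnj x * a (m, n) + cnj y * a (n, m)) = (x * cnj x + y * cnj y) * a (m, n)"
      by (simp add: distrib_left distrib_right mult.assoc mult.left_commute[of x "cnj y"] mult.left_commute[of y "cnj y"])
    thus ?thesis by (simp add: xy)
  qed
  have 2: "y * (cnj y * a (m, n) + cnj x * a (n, m)) = a (m, n)" if "res_class k r n m"
  proof -
    have "y * a (n, m) = x * a (m, n)" using a that by (auto simp: isotypic_def)
    hence "y * (cnj y * a (m, n) + cnj x * a (n, m)) = (x * cnj x + y * cnj y) * a (m, n)"
      by (simp add: distrib_left distrib_right mult.assoc mult.left_commute[of y "cnj x"] mult.left_commute[of x "cnj x"] add.commute)
    thus ?thesis by (simp add: xy)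
  qed
  have 3: "\<not> res_class k r m n \<Longrightarrow> \<not> res_class k r n m \<Longrightarrow> a (m, n) = 0" using a unfolding isotypic_def by blast
  have e: "proj_coef d a p = of_nat d / 2 * ((if res_class k r m n then a (m, n) else 0) + (if res_class k r n m then a (m, n) else 0))"
    using 1 2 by (simp add: proj_coef_def p)
  show "proj_coef d a p = a p"
  proof (cases "r = 0 \<or> 2 * r = k")
    case True
    hence "d = 1" "res_class k r n m = res_class k r m n" using d res_class_commute by auto
    thus ?thesis unfolding e using 3 by (auto simp: p)
  next
    case False
    hence "d = 2" "\<not> (res_class k r n m \<and> res_class k r m n)" using d res_class_both by auto
    thus ?thesis unfolding e using 3 by (auto simp: p)
  qed
qed

lemma Psub_eq:
  assumes pi: "\<And>j. j < k \<Longrightarrow> \<pi> (j, False) 0 0 = x * cnj x * (xi k ^ r) ^ j + y * cnj y * inverse (xi k ^ r) ^ j"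
             "\<And>j. j < k \<Longrightarrow> \<pi> (j, True) 0 0 = cnj x * y * inverse (xi k ^ r) ^ j + x * cnj y * (xi k ^ r) ^ j"
    and d: "d = 1 \<and> (r = 0 \<or> 2 * r = k) \<or> d = 2 \<and> \<not> (r = 0 \<or> 2 * r = k)"
  shows "Psub k lam d \<pi> = fn ` S"
proof -
  have "Psub k lam d \<pi> = (\<lambda>a. fn (proj_coef d a)) ` H2 lam"
    unfolding Psub_def Aspace_eq image_image by (rule image_cong[OF refl], rule Pproj_fn) (rule pi, assumption)+
  also have "\<dots> = fn ` S"
  proof (intro equalityI subsetI)
    fix f assume "f \<in> (\<lambda>a. fn (proj_coef d a)) ` H2 lam"
    thus "f \<in> fn ` S" using proj_coef_in_S by blast
  next
    fix f assume "f \<in> fn ` S"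
    then obtain a where a: "a \<in> S" "f = fn a" by blast
    hence "f = fn (proj_coef d a)" using proj_coef_fixes_S[OF d] by simp
    thus "f \<in> (\<lambda>a. fn (proj_coef d a)) ` H2 lam" using isotypic_H2[OF a(1)] by blast
  qed
  finally show ?thesis .
qed

lemma Dcontraction_S: "Dcontraction k lam (fn ` S) (Mmult (phi1 k)) (Mmult phi2)"
  using isotypic_H2 isotypic_T1 isotypic_T2 by (intro Dcontraction_invariant_subspace subsetI) blast+

end

section \<open>From unitary equivalence of function spaces to intertwiners of sequences\<close>

context bergman
begin

text \<open>Conjugate \<open>U\<close> by \<open>fn\<close>; each property transfers because
  \<open>fn\<close> is injective on \<open>H2 lam\<close> and compatible with sums, norms and
  shifts.\<close>

lemma unit_equiv_intertwines:
  assumes S: "S \<subseteq> H2 lam" "\<And>a. a \<in> S \<Longrightarrow> T1 k a \<in> S \<and> T2 a \<in> S"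
      "\<And>a b c d. a \<in> S \<Longrightarrow> b \<in> S \<Longrightarrow> (\<lambda>p. c * a p + d * b p) \<in> S"
    and S': "S' \<subseteq> H2 lam"
    and U: "unit_equiv lam (fn ` S) (fn ` S') (Mmult (phi1 k)) (Mmult phi2)"
  shows "\<exists>V. intertwines lam k V S S'"
proof -
  obtain U where bij: "bij_betw U (fn ` S) (fn ` S')"
    and lin: "\<forall>f\<in>fn ` S. \<forall>g\<in>fn ` S. \<forall>a b. U (\<lambda>z. a * f z + b * g z) = (\<lambda>z. a * U f z + b * U g z)"
    and nrm: "\<forall>f\<in>fn ` S. Anorm lam (U f) = Anorm lam f"
    and com: "\<forall>f\<in>fn ` S. U (Mmult (phi1 k) f) = Mmult (phi1 k) (U f) \<and> U (Mmult phi2 f) = Mmult phi2 (U f)"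
    using U unfolding unit_equiv_def by (elim exE conjE)
  define V where "V a = coef lam (U (fn a))" for a
  have V: "V a \<in> S' \<and> fn (V a) = U (fn a)" if "a \<in> S" for a
  proof -
    have "U (fn a) \<in> fn ` S'" using bij that unfolding bij_betw_def by blast
    then obtain b where "b \<in> S'" "U (fn a) = fn b" by blast
    thus ?thesis using S' by (auto simp: V_def)
  qed
  have VH: "V a \<in> H2 lam" if "a \<in> S" for a using V[OF that] S' by blast
  note eqI = inj_onD[OF fn_inj]
  have "bij_betw V S S'"
    unfolding bij_betw_def
  proof
    show "inj_on V S"
    proof (rule inj_onI)
      fix a b assume ab: "a \<in> S" "b \<in> S" "V a = V b"
      hence "U (fn a) = U (fn b)" using V by metis
      hence "fn a = fn b" using bij ab by (auto simp: bij_betw_def dest: inj_onD)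
      thus "a = b" using eqI ab S(1) by blast
    qed
    show "V ` S = S'"
    proof (intro equalityI subsetI)
      fix b assume "b \<in> V ` S"
      thus "b \<in> S'" using V by blast
    next
      fix b assume b: "b \<in> S'"
      have "fn b \<in> U ` fn ` S" using b bij unfolding bij_betw_def by blast
      then obtain a where a: "a \<in> S" "fn b = U (fn a)" by blast
      have "fn (V a) = fn b" using V[OF a(1)] a(2) by simp
      hence "V a = b" using eqI[of "V a" b] VH[OF a(1)] b S' by blast
      thus "b \<in> V ` S" using a(1) by blast
    qed
  qed
  moreover have "V (\<lambda>p. c * a p + d * b p) = (\<lambda>p. c * V a p + d * V b p)" if ab: "a \<in> S" "b \<in> S" for a b c d
  proof (rule eqI)
    have aH: "a \<in> H2 lam" "b \<in> H2 lam" using ab S(1) by auto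
    show "fn (V (\<lambda>p. c * a p + d * b p)) = fn (\<lambda>p. c * V a p + d * V b p)"
      unfolding conjunct2[OF V[OF S(3)[OF ab]]] fn_lincomb[OF aH] fn_lincomb[OF VH[OF ab(1)] VH[OF ab(2)]]
        conjunct2[OF V[OF ab(1)]] conjunct2[OF V[OF ab(2)]]
      using lin ab by blast
    show "V (\<lambda>p. c * a p + d * b p) \<in> H2 lam" by (rule VH[OF S(3)[OF ab]])
    show "(\<lambda>p. c * V a p + d * V b p) \<in> H2 lam" by (rule H2_add[OF H2_scale[OF VH[OF ab(1)]] H2_scale[OF VH[OF ab(2)]]])
  qed
  moreover have "nrm2 lam (V a) = nrm2 lam a" if a: "a \<in> S" for a
  proof -
    have "Anorm lam (fn (V a)) = Anorm lam (fn a)" using nrm V[OF a] a by simp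
    thus ?thesis using Anorm_fn VH[OF a] a S(1) by (auto simp: nrm2_nonneg)
  qed
  moreover have "V (T1 k a) = T1 k (V a) \<and> V (T2 a) = T2 (V a)" if a: "a \<in> S" for a
  proof -
    have aH: "a \<in> H2 lam" using a S(1) by auto
    have "fn (V (T1 k a)) = fn (T1 k (V a))"
    proof -
      have "fn (V (T1 k a)) = U (fn (T1 k a))" using V[of "T1 k a"] S(2)[OF a] by blast
      also have "\<dots> = U (Mmult (phi1 k) (fn a))" by (simp only: Mmult_phi1[OF aH])
      also have "\<dots> = Mmult (phi1 k) (U (fn a))" using com a by blast
      also have "\<dots> = Mmult (phi1 k) (fn (V a))" using V[OF a] by simp
      finally show ?thesis by (simp only: Mmult_phi1[OF VH[OF a]])
    qed
    moreover have "fn (V (T2 a)) = fn (T2 (V a))"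
    proof -
      have "fn (V (T2 a)) = U (fn (T2 a))" using V[of "T2 a"] S(2)[OF a] by blast
      also have "\<dots> = U (Mmult phi2 (fn a))" by (simp only: Mmult_phi2[OF aH])
      also have "\<dots> = Mmult phi2 (U (fn a))" using com a by blast
      also have "\<dots> = Mmult phi2 (fn (V a))" using V[OF a] by simp
      finally show ?thesis by (simp only: Mmult_phi2[OF VH[OF a]])
    qed
    ultimately show ?thesis
      using eqI[of "V (T1 k a)" "T1 k (V a)"] eqI[of "V (T2 a)" "T2 (V a)"] VH S(2)[OF a]
        H2_T1[OF VH[OF a]] H2_shift[OF VH[OF a]] by blast
  qed
  ultimately have "intertwines lam k V S S'" unfolding intertwines_def by blast
  thus ?thesis by blast
qed

end

section \<open>The classification up to unitary equivalence\<close>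

lemma inverse_sqrt_2: "complex_of_real (1 / sqrt 2) * cnj (complex_of_real (1 / sqrt 2)) = 1 / 2"
proof -
  have "(1 / sqrt 2) * (1 / sqrt 2) = (1 / 2 :: real)" by simp
  hence "complex_of_real ((1 / sqrt 2) * (1 / sqrt 2)) = complex_of_real (1 / 2)" by (rule arg_cong)
  thus ?thesis by (simp only: of_real_mult of_real_divide complex_cnj_complex_of_real complex_cnj_divide complex_cnj_one of_real_1 of_real_numeral)
qed

text \<open>A character is given the shape of a two-dimensional matrix entry: xi^r equals its
  inverse, and \<open>x = 1 / sqrt 2\<close> splits each value into two equal halves. Thus
  \<open>Psub_eq\<close> handles both dimensions.\<close>

lemma one_dim_entries:
  assumes k: "2 \<le> k" and r: "r = 0 \<or> 2 * r = k" and s: "s = 1 \<or> s = (-1 :: complex)"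
    and x: "x = complex_of_real (1 / sqrt 2)"
    and p: "p = (xi k ^ r) ^ j" "q = s * (xi k ^ r) ^ j"
  shows "p = x * cnj x * (xi k ^ r) ^ j + (s * x) * cnj (s * x) * inverse (xi k ^ r) ^ j"
    and "q = cnj x * (s * x) * inverse (xi k ^ r) ^ j + x * cnj (s * x) * (xi k ^ r) ^ j"
proof -
  have "xi k ^ k = 1" using xi_power_k[of k] k by simp
  hence "(xi k ^ r) * (xi k ^ r) = 1" using r by (auto simp flip: power_add mult_2)
  hence inv: "inverse (xi k ^ r) = xi k ^ r" by (rule inverse_unique)
  have xx: "x * cnj x = 1 / 2" unfolding x by (rule inverse_sqrt_2)
  have sx: "(s * x) * cnj (s * x) = 1 / 2" "cnj x * (s * x) = s / 2" "x * cnj (s * x) = s / 2"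
    using s xx by (auto simp: mult.commute)
  show "p = x * cnj x * (xi k ^ r) ^ j + (s * x) * cnj (s * x) * inverse (xi k ^ r) ^ j"
    unfolding inv xx sx p by simp
  show "q = cnj x * (s * x) * inverse (xi k ^ r) ^ j + x * cnj (s * x) * (xi k ^ r) ^ j"
    unfolding inv xx sx p by (simp add: field_simps)
qed

context bergman
begin

lemma Psub_one_dim:
  assumes k: "2 \<le> k" and r: "r = 0 \<or> 2 * r = k" and s: "s = 1 \<or> s = (-1 :: complex)"
    and pi: "\<And>j. j < k \<Longrightarrow> \<pi> (j, False) 0 0 = (xi k ^ r) ^ j \<and> \<pi> (j, True) 0 0 = s * (xi k ^ r) ^ j"
    and x: "x = complex_of_real (1 / sqrt 2)"
  shows "dihedral_data lam k r x (s * x)" and "Psub k lam 1 \<pi> = fn ` isotypic lam k r x (s * x)"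
proof -
  have "x * cnj x + (s * x) * cnj (s * x) = 1"
    using s inverse_sqrt_2 unfolding x[symmetric] by (auto simp: mult.commute)
  then show D: "dihedral_data lam k r x (s * x)" by unfold_locales (use k r s in auto)
  show "Psub k lam 1 \<pi> = fn ` isotypic lam k r x (s * x)"
  proof (rule dihedral_data.Psub_eq[OF D])
    fix j assume "j < k"
    with pi have p: "\<pi> (j, False) 0 0 = (xi k ^ r) ^ j" "\<pi> (j, True) 0 0 = s * (xi k ^ r) ^ j" by auto
    show "\<pi> (j, False) 0 0 = x * cnj x * (xi k ^ r) ^ j + (s * x) * cnj (s * x) * inverse (xi k ^ r) ^ j"
      and "\<pi> (j, True) 0 0 = cnj x * (s * x) * inverse (xi k ^ r) ^ j + x * cnj (s * x) * (xi k ^ r) ^ j"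
      by (rule one_dim_entries[OF k r s x p])+
  qed (use r in auto)
qed

lemma Psub_two_dim:
  assumes k: "2 \<le> k" and r: "0 < r" "2 * r < k"
    and id: "\<forall>l<2. \<forall>i<2. v l * cnj (v i) + w l * cnj (w i) = (if l = i then 1 else 0)"
    and pi: "\<forall>j<k. \<forall>l<2. \<forall>i<2.
         \<pi> (j, False) l i = (xi k ^ r) ^ j * v l * cnj (v i) + inverse (xi k ^ r) ^ j * w l * cnj (w i) \<and>
         \<pi> (j, True) l i = inverse (xi k ^ r) ^ j * w l * cnj (v i) + (xi k ^ r) ^ j * v l * cnj (w i)"
  shows "dihedral_data lam k r (v 0) (w 0)" and "Psub k lam 2 \<pi> = fn ` isotypic lam k r (v 0) (w 0)"
proof -
  show D: "dihedral_data lam k r (v 0) (w 0)" by unfold_locales (use k r id in auto)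
  show "Psub k lam 2 \<pi> = fn ` isotypic lam k r (v 0) (w 0)"
    by (rule dihedral_data.Psub_eq[OF D]) (use pi r in \<open>auto simp: mult_ac\<close>)
qed

lemma irreducible_cases:
  assumes k: "2 \<le> k" and irr: "irreducible_rep k d \<pi>"
  obtains (one) r s x where "d = 1" "r = 0 \<or> 2 * r = k" "s = 1 \<or> s = -1" "x = complex_of_real (1 / sqrt 2)"
      "\<And>j. j < k \<Longrightarrow> \<pi> (j, False) 0 0 = (xi k ^ r) ^ j \<and> \<pi> (j, True) 0 0 = s * (xi k ^ r) ^ j"
      "dihedral_data lam k r x (s * x)" "Psub k lam d \<pi> = fn ` isotypic lam k r x (s * x)"
  | (two) r v w where "d = 2" "0 < r" "2 * r < k" "herm 2 v v = 1" "herm 2 w w = 1" "herm 2 v w = 0"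
      "\<forall>l<2. \<forall>i<2. v l * cnj (v i) + w l * cnj (w i) = (if l = i then 1 else 0)"
      "\<forall>j<k. \<forall>l<2. \<forall>i<2.
         \<pi> (j, False) l i = (xi k ^ r) ^ j * v l * cnj (v i) + inverse (xi k ^ r) ^ j * w l * cnj (w i) \<and>
         \<pi> (j, True) l i = inverse (xi k ^ r) ^ j * w l * cnj (v i) + (xi k ^ r) ^ j * v l * cnj (w i)"
      "dihedral_data lam k r (v 0) (w 0)" "Psub k lam d \<pi> = fn ` isotypic lam k r (v 0) (w 0)"
proof -
  interpret irrep k d \<pi> by unfold_locales (use k irr in auto)
  from classification show thesis
  proof
    assume "d = 1 \<and> (\<exists>r s. (r = 0 \<or> 2 * r = k) \<and> (s = 1 \<or> s = -1) \<and>
      (\<forall>j<k. \<pi> (j, False) 0 0 = (xi k ^ r) ^ j \<and> \<pi> (j, True) 0 0 = s * (xi k ^ r) ^ j))"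
    then obtain r s where d: "d = 1" and r: "r = 0 \<or> 2 * r = k" and s: "s = 1 \<or> s = (-1 :: complex)"
      and pi: "\<forall>j<k. \<pi> (j, False) 0 0 = (xi k ^ r) ^ j \<and> \<pi> (j, True) 0 0 = s * (xi k ^ r) ^ j"
      by (elim conjE exE)
    define x where "x = complex_of_real (1 / sqrt 2)"
    have pi': "\<And>j. j < k \<Longrightarrow> \<pi> (j, False) 0 0 = (xi k ^ r) ^ j \<and> \<pi> (j, True) 0 0 = s * (xi k ^ r) ^ j"
      using pi by blast
    have D: "dihedral_data lam k r x (s * x)" and P: "Psub k lam d \<pi> = fn ` isotypic lam k r x (s * x)"
      using Psub_one_dim[where \<pi> = \<pi>, OF k r s pi' x_def] d by auto
    show thesis by (rule one[of r s x]) (fact d r s x_def pi' D P)+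
  next
    assume "d = 2 \<and> (\<exists>r v w. 0 < r \<and> 2 * r < k \<and> herm 2 v v = 1 \<and> herm 2 w w = 1 \<and> herm 2 v w = 0 \<and>
      (\<forall>l<2. \<forall>i<2. v l * cnj (v i) + w l * cnj (w i) = (if l = i then 1 else 0)) \<and>
      (\<forall>j<k. \<forall>l<2. \<forall>i<2.
         \<pi> (j, False) l i = (xi k ^ r) ^ j * v l * cnj (v i) + inverse (xi k ^ r) ^ j * w l * cnj (w i) \<and>
         \<pi> (j, True) l i = inverse (xi k ^ r) ^ j * w l * cnj (v i) + (xi k ^ r) ^ j * v l * cnj (w i)))"
    then obtain r v w where d: "d = 2" and r: "0 < r" "2 * r < k" and on: "herm 2 v v = 1" "herm 2 w w = 1" "herm 2 v w = 0"
      and id: "\<forall>l<2. \<forall>i<2. v l * cnj (v i) + w l * cnj (w i) = (if l = i then 1 else 0)"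
      and pi: "\<forall>j<k. \<forall>l<2. \<forall>i<2.
         \<pi> (j, False) l i = (xi k ^ r) ^ j * v l * cnj (v i) + inverse (xi k ^ r) ^ j * w l * cnj (w i) \<and>
         \<pi> (j, True) l i = inverse (xi k ^ r) ^ j * w l * cnj (v i) + (xi k ^ r) ^ j * v l * cnj (w i)"
      by (elim conjE exE)
    show thesis
      by (rule two[OF d r on id pi]) (use Psub_two_dim[OF k r id pi] d in auto)
  qed
qed

lemma unit_equiv_data_eq:
  assumes D: "dihedral_data lam k r x y" "dihedral_data lam k r' x' y'"
    and U: "unit_equiv lam (fn ` isotypic lam k r x y) (fn ` isotypic lam k r' x' y') (Mmult (phi1 k)) (Mmult phi2)"
  shows "r = r'" and "r = 0 \<or> 2 * r = k \<Longrightarrow> y = x \<longleftrightarrow> y' = x'"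
proof -
  obtain V where V: "intertwines lam k V (isotypic lam k r x y) (isotypic lam k r' x' y')"
    using unit_equiv_intertwines[OF _ _ isotypic_lincomb _ U] isotypic_H2 isotypic_T1 isotypic_T2 by blast
  show "r = r'" "r = 0 \<or> 2 * r = k \<Longrightarrow> y = x \<longleftrightarrow> y' = x'"
    using intertwines_data_eq[OF D V] by blast+
qed

text \<open>Equality of the residues excludes a character against a two-dimensional representation,
  settles two dimensions outright, and leaves only the sign to compare for characters.\<close>

lemma unit_equiv_imp_equiv_rep:
  assumes k: "2 \<le> k" and irr: "irreducible_rep k d \<pi>" "irreducible_rep k d' \<pi>'"
    and U: "unit_equiv lam (Psub k lam d \<pi>) (Psub k lam d' \<pi>') (Mmult (phi1 k)) (Mmult phi2)"
  shows "equiv_rep k d \<pi> d' \<pi>'"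
  using k irr(1)
proof (cases rule: irreducible_cases)
  case A: (one r s x)
  show ?thesis using k irr(2)
  proof (cases rule: irreducible_cases)
    case B: (one r' s' x')
    note e = unit_equiv_data_eq[OF A(6) B(6) U[unfolded A(7) B(7)]]
    \<comment> \<open>With \<open>x\<close> nonzero, \<open>s * x = x\<close> is equivalent to
      \<open>s = 1\<close>, so the criterion on \<open>x\<close> and \<open>y\<close> compares the
      signs.\<close>
    have "x \<noteq> 0" "x' \<noteq> 0" using A(4) B(4) by auto
    hence "s = s'" using e(2)[OF A(2)] A(3) B(3) by auto
    hence "\<pi> g 0 0 = \<pi>' g 0 0" if "g \<in> Dgrp k" for g
      using that A(5) B(5) e(1) by (cases g; cases "snd g") (auto simp: Dgrp_def)
    thus ?thesis using A(1) B(1) equiv_rep_one by blast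
  next
    case B: (two r' v w)
    show ?thesis using unit_equiv_data_eq(1)[OF A(6) B(9) U[unfolded A(7) B(10)]] A(2) B(2,3) by auto
  qed
next
  case A: (two r v w)
  show ?thesis using k irr(2)
  proof (cases rule: irreducible_cases)
    case B: (one r' s' x')
    show ?thesis using unit_equiv_data_eq(1)[OF A(9) B(6) U[unfolded A(10) B(7)]] A(2,3) B(2) by auto
  next
    case B: (two r' v' w')
    have "r = r'" using unit_equiv_data_eq(1)[OF A(9) B(9) U[unfolded A(10) B(10)]] .
    hence "equiv_rep k 2 \<pi> 2 \<pi>'"
      using A(8) B(8) by (intro equiv_rep_two[OF A(4-6) B(4-6) A(7)[rule_format] B(7)[rule_format], of k _ "\<lambda>j. (xi k ^ r) ^ j" "\<lambda>j. inverse (xi k ^ r) ^ j"]) simp_all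
    thus ?thesis using A(1) B(1) by simp
  qed
qed

end

theorem theorem4p26:
  fixes k :: nat and lam :: real
  assumes "k \<ge> 2" and "lam \<ge> 1"
  shows "(\<forall>d \<pi>. irreducible_rep k d \<pi> \<longrightarrow>
            Dcontraction k lam (Psub k lam d \<pi>) (Mmult (phi1 k)) (Mmult phi2))
       \<and> (\<forall>d \<pi> d' \<pi>'. irreducible_rep k d \<pi> \<and> irreducible_rep k d' \<pi>' \<and> \<not> equiv_rep k d \<pi> d' \<pi>' \<longrightarrow>
            \<not> unit_equiv lam (Psub k lam d \<pi>) (Psub k lam d' \<pi>') (Mmult (phi1 k)) (Mmult phi2))"
proof (intro conjI allI impI)
  interpret bergman lam by unfold_locales (rule assms(2))
  fix d \<pi> assume irr: "irreducible_rep k d \<pi>"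
  show "Dcontraction k lam (Psub k lam d \<pi>) (Mmult (phi1 k)) (Mmult phi2)"
    using assms(1) irr
  proof (cases rule: irreducible_cases)
    case (one r s x)
    show ?thesis unfolding one(7) by (rule dihedral_data.Dcontraction_S[OF one(6)])
  next
    case (two r v w)
    show ?thesis unfolding two(10) by (rule dihedral_data.Dcontraction_S[OF two(9)])
  qed
next
  interpret bergman lam by unfold_locales (rule assms(2))
  fix d \<pi> d' \<pi>'
  assume "irreducible_rep k d \<pi> \<and> irreducible_rep k d' \<pi>' \<and> \<not> equiv_rep k d \<pi> d' \<pi>'"
  thus "\<not> unit_equiv lam (Psub k lam d \<pi>) (Psub k lam d' \<pi>') (Mmult (phi1 k)) (Mmult phi2)"
    using unit_equiv_imp_equiv_rep[OF assms(1)] by blast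
qed

end
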